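(* Let $\mathscr C$ be a class of graphs of shrubdepth at most $d$, where $d>1$. Then there exist a hereditary graph class $\mathscr C'$ of shrubdepth at most $d-1$, first-order formulas $\varphi(\bar x;\bar y)$ and $\lambda(\bar x;\bar y)$ (with $|\bar x|=2$) that are finitary on $\mathscr C$ and each define a partition, and an integer $\ell\in\mathbb N$, such that for every graph $G\in\mathscr C$ there exists $\bar s\in G^{\bar y}$ with: (1) $(\varphi(G^{\bar x};\bar s),\lambda(G^{\bar x};\bar s))$ is a dicing of $G$ of order at most $\ell$; and (2) for every part $A$ of $\varphi(G^{\bar x};\bar s)$, we have $G[A]\in\mathscr C'$.
   Context: Graphs are finite simple undirected graphs viewed as structures with one binary edge relation. A connection model for $G$ consists of a finite set $\mathsf{Labels}$, a labelling $\mathsf{label}\colon V(G)\to\mathsf{Labels}$, a rooted tree $T$ whose leaf set is $V(G)$, and for every non-leaf node $x$ of $T$ a symmetric relation $\mathsf{Adj}(x)\subseteq\mathsf{Labels}\times\mathsf{Labels}$, such that distinct $u,v$ are adjacent iff $(\mathsf{label}(u),\mathsf{label}(v))\in\mathsf{Adj}(x)$, $x$ the lowest common ancestor of $u,v$. Its depth is the depth of $T$ (the maximum number of nodes on a root-to-leaf path; so shrubdepth $1$ corresponds to graphs with at most one vertex). A graph class has shrubdepth at most $d$ if there is a finite label set such that every member has a connection model of depth at most $d$ using it. A class is hereditary if closed under induced subgraphs. For a formula $\varphi(\bar x;\bar y)$ and $\bar b\in G^{\bar y}$, $\varphi(G^{\bar x};\bar b)=\{\bar a\in G^{\bar x}:G\models\varphi(\bar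 a;\bar b)\}$. A formula $\varphi(\bar x;\bar y)$ with $|\bar x|=2$ defines a partition if for every graph $G$ and every $\bar b\in G^{\bar y}$, $\varphi(G^{\bar x};\bar b)$ is an equivalence relation on $V(G)$ (identified with the partition into its classes). A formula is finitary on $\mathscr C$ if there is $k$ such that for all $G\in\mathscr C$, $|\{\varphi(G^{\bar x};\bar b):\bar b\in G^{\bar y}\}|\le k$. A pair $(\mathcal P,\mathcal L)$ of partitions of $V(G)$ is a dicing of $G$ if there is a symmetric relation $Z\subseteq\mathcal L\times\mathcal L$ such that for all $u,v$ in different parts of $\mathcal P$, $u,v$ are adjacent iff $(\mathcal L(u),\mathcal L(v))\in Z$, where $\mathcal L(w)$ is the part of $\mathcal L$ containing $w$; its order is $|\mathcal L|$. *)

theory Defs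
  imports
    "Graph_Theory.Graph_Theory"
    "HOL-Library.Disjoint_Sets"
    "HOL-Library.Infinite_Typeclass"
begin

section \<open>Graphs and graph classes\<close>

text \<open>
  The library locale \<open>pair_graph\<close> describes finite, symmetric, loop-free relations. Graphs are
  nonempty, as relational structures and as leaf sets of rooted trees.

  Vertices are taken from a type of class \<open>infinite\<close>, so that every finite graph has an isomorphic
  copy over that type, and so that a tree whose leaves are the vertices of a given finite graph
  can draw its inner nodes from the same type.
\<close>

definition simple_graph :: "'a pair_pre_digraph \<Rightarrow> bool" where
  "simple_graph G \<longleftrightarrow> pair_graph G \<and> pverts G \<noteq> {}"

definition graph_class :: "'a pair_pre_digraph set \<Rightarrow> bool" where
  "graph_class C \<longleftrightarrow> (\<forall>G\<in>C. simple_graph G)"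

definition induced :: "'a pair_pre_digraph \<Rightarrow> 'a set \<Rightarrow> 'a pair_pre_digraph" where
  "induced G A = \<lparr> pverts = A, parcs = parcs G \<inter> A \<times> A \<rparr>"

lemma with_proj_induced: "with_proj (induced G A) = with_proj G \<restriction> A"
  by (auto simp: induced_def induce_subgraph_def with_proj_def)

definition hereditary :: "'a pair_pre_digraph set \<Rightarrow> bool" where
  "hereditary C \<longleftrightarrow> (\<forall>G\<in>C. \<forall>A. A \<subseteq> pverts G \<and> A \<noteq> {} \<longrightarrow> induced G A \<in> C)"

section \<open>Rooted trees\<close>

text \<open>A rooted tree is given by its parent-to-child arcs.\<close>

definition rooted_tree :: "'a pair_pre_digraph \<Rightarrow> 'a \<Rightarrow> bool" where
  "rooted_tree T r \<longleftrightarrow> pair_fin_digraph T \<and> r \<in> pverts T \<and>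
     (\<forall>x\<in>pverts T. \<exists>!p. pre_digraph.awalk (with_proj T) r p x)"

definition leaves :: "'a pair_pre_digraph \<Rightarrow> 'a set" where
  "leaves T = {x \<in> pverts T. \<forall>y. (x, y) \<notin> parcs T}"

text \<open>The depth counts nodes, not arcs: a one-node tree has depth 1.\<close>

definition tree_depth :: "'a pair_pre_digraph \<Rightarrow> 'a \<Rightarrow> nat" where
  "tree_depth T r =
     Max {length (pawalk_verts r p) | p x. x \<in> leaves T \<and> pre_digraph.awalk (with_proj T) r p x}"

text \<open>In a rooted tree, \<open>x \<rightarrow>\<^sup>*\<^bsub>with_proj T\<^esub> y\<close> says that \<open>x\<close> is \<open>y\<close> or an ancestor of \<open>y\<close>.\<close>

definition is_lca :: "'a pair_pre_digraph \<Rightarrow> 'a \<Rightarrow> 'a \<Rightarrow> 'a \<Rightarrow> bool" where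
  "is_lca T u v x \<longleftrightarrow> x \<rightarrow>\<^sup>*\<^bsub>with_proj T\<^esub> u \<and> x \<rightarrow>\<^sup>*\<^bsub>with_proj T\<^esub> v \<and>
     (\<forall>y. y \<rightarrow>\<^sup>*\<^bsub>with_proj T\<^esub> u \<and> y \<rightarrow>\<^sup>*\<^bsub>with_proj T\<^esub> v \<longrightarrow> y \<rightarrow>\<^sup>*\<^bsub>with_proj T\<^esub> x)"

section \<open>Connection models and shrubdepth\<close>

definition connection_model ::
  "'a pair_pre_digraph \<Rightarrow> 'l set \<Rightarrow> ('a \<Rightarrow> 'l) \<Rightarrow> 'a pair_pre_digraph \<Rightarrow> 'a \<Rightarrow> ('a \<Rightarrow> ('l \<times> 'l) set) \<Rightarrow> bool"
where
  "connection_model G Labels label T r Adj \<longleftrightarrow>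
     finite Labels \<and> label ` pverts G \<subseteq> Labels \<and>
     rooted_tree T r \<and> leaves T = pverts G \<and>
     (\<forall>x \<in> pverts T - leaves T. Adj x \<subseteq> Labels \<times> Labels \<and> sym (Adj x)) \<and>
     (\<forall>u\<in>pverts G. \<forall>v\<in>pverts G. u \<noteq> v \<longrightarrow>
        (\<forall>x. is_lca T u v x \<longrightarrow> ((u, v) \<in> parcs G \<longleftrightarrow> (label u, label v) \<in> Adj x)))"

text \<open>One finite label set serves the whole class; it may be taken to consist of numbers.\<close>

definition shrubdepth_at_most :: "'a pair_pre_digraph set \<Rightarrow> nat \<Rightarrow> bool" where
  "shrubdepth_at_most C d \<longleftrightarrow>
     (\<exists>Labels :: nat set. finite Labels \<and>
        (\<forall>G\<in>C. \<exists>label T r Adj. connection_model G Labels label T r Adj \<and> tree_depth T r \<le> d))"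

section \<open>First-order formulas\<close>

datatype fm =
    Equal nat nat
  | Edge nat nat
  | Neg fm
  | Conj fm fm
  | Exists nat fm

primrec fv :: "fm \<Rightarrow> nat set" where
  "fv (Equal i j) = {i, j}"
| "fv (Edge i j) = {i, j}"
| "fv (Neg p) = fv p"
| "fv (Conj p q) = fv p \<union> fv q"
| "fv (Exists i p) = fv p - {i}"

primrec sat :: "'a pair_pre_digraph \<Rightarrow> (nat \<Rightarrow> 'a) \<Rightarrow> fm \<Rightarrow> bool" where
  "sat G e (Equal i j) \<longleftrightarrow> e i = e j"
| "sat G e (Edge i j) \<longleftrightarrow> (e i, e j) \<in> parcs G"
| "sat G e (Neg p) \<longleftrightarrow> \<not> sat G e p"
| "sat G e (Conj p q) \<longleftrightarrow> sat G e p \<and> sat G e q"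
| "sat G e (Exists i p) \<longleftrightarrow> (\<exists>a\<in>pverts G. sat G (e(i := a)) p)"

text \<open>
  A formula \<open>\<phi>(x\<^sub>1, x\<^sub>2; y\<^sub>1, \<dots>, y\<^sub>m)\<close> has its free variables among \<open>0, \<dots>, m + 1\<close>: variables 0 and 1
  are \<open>x\<^sub>1\<close> and \<open>x\<^sub>2\<close>, and variable \<open>i + 1\<close> is \<open>y\<^sub>i\<close>.
\<close>

definition binary_formula :: "nat \<Rightarrow> fm \<Rightarrow> bool" where
  "binary_formula m p \<longleftrightarrow> fv p \<subseteq> {..<2 + m}"

definition tuples :: "'a pair_pre_digraph \<Rightarrow> nat \<Rightarrow> 'a list set" where
  "tuples G m = {bs. length bs = m \<and> set bs \<subseteq> pverts G}"

definition defined_rel :: "'a pair_pre_digraph \<Rightarrow> fm \<Rightarrow> 'a list \<Rightarrow> ('a \<times> 'a) set" where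
  "defined_rel G p bs =
     {(a1, a2). a1 \<in> pverts G \<and> a2 \<in> pverts G \<and> sat G (\<lambda>i. (a1 # a2 # bs) ! i) p}"

definition defined_partition :: "'a pair_pre_digraph \<Rightarrow> fm \<Rightarrow> 'a list \<Rightarrow> 'a set set" where
  "defined_partition G p bs = pverts G // defined_rel G p bs"

definition defines_partition :: "'a::infinite itself \<Rightarrow> nat \<Rightarrow> fm \<Rightarrow> bool" where
  "defines_partition _ m p \<longleftrightarrow>
     (\<forall>G :: 'a pair_pre_digraph. simple_graph G \<longrightarrow>
        (\<forall>bs\<in>tuples G m. equiv (pverts G) (defined_rel G p bs)))"

definition finitary_on :: "'a pair_pre_digraph set \<Rightarrow> nat \<Rightarrow> fm \<Rightarrow> bool" where
  "finitary_on C m p \<longleftrightarrow> (\<exists>k. \<forall>G\<in>C. card {defined_rel G p bs | bs. bs \<in> tuples G m} \<le> k)"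

section \<open>Dicings\<close>

definition part_of :: "'a set set \<Rightarrow> 'a \<Rightarrow> 'a set" where
  "part_of P w = (THE A. A \<in> P \<and> w \<in> A)"

definition dicing :: "'a pair_pre_digraph \<Rightarrow> 'a set set \<Rightarrow> 'a set set \<Rightarrow> bool" where
  "dicing G P L \<longleftrightarrow> partition_on (pverts G) P \<and> partition_on (pverts G) L \<and>
     (\<exists>Z \<subseteq> L \<times> L. sym Z \<and>
        (\<forall>u\<in>pverts G. \<forall>v\<in>pverts G. part_of P u \<noteq> part_of P v \<longrightarrow>
           ((u, v) \<in> parcs G \<longleftrightarrow> (part_of L u, part_of L v) \<in> Z)))"

end

theory Submission
  imports Defs
begin

text \<open>
  Call a graph \<open>shrub h k\<close> if it can be cut \<open>h\<close> times, each time along a dicing of order at most \<open>k\<close>,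
  until only single vertices are left; this is bounded shrubdepth \<open>h + 1\<close>.

  If \<open>d = 2\<close>, then being twins has boundedly many classes, and \<open>\<lambda>\<close> = twins, \<open>\<phi>\<close> = equality works.

  Let \<open>d > 2\<close>. Given \<open>m\<close> triples of vertices, label a vertex by its majority adjacencies to the triples (and
  by its adjacencies to the label classes that contain no triple), flip the graph between label classes
  so that the triples' classes become sparse, and let the parts be the connected components of the flip.
  Components and labels always form a dicing, and bounded shrubdepth bounds the length of induced paths, so
  that all this is first-order. Starting from the dicing below the root of a tree model, one picks a triple from
  every label that meets many parts, and merges the boundedly many parts that contain a rare label; this gives
  triples whose components have smaller shrubdepth.

  Parameters are avoided by choosing \<open>m\<close> minimal: suppose that two choices of \<open>m\<close> triples
  both have components of smaller shrubdepth, but some class of the first is not the class of a triple of the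
  second. Then this class is covered by boundedly many components of either choice, and components of the first choice
  that cross a component of the second are few. Merging the components inside those boundedly many components of
  the second choice makes the class rare, so that \<open>m - 1\<close> triples suffice, at the price of larger bounds. For some
  level in a growing sequence of bounds this cannot happen, and there all choices of triples yield the same two
  equivalence relations, which are therefore definable without parameters.
\<close>

section \<open>Shrubdepth without trees\<close>

text \<open>A dicing fixes the adjacency of u to a label only outside the part of u. Of three
  representatives in distinct parts at most one shares the part of u, so a majority recovers the
  fixed value without knowing the parts. Merging is affordable because boundedly many parts can be
  named in the labels: this multiplies the number of labels but costs no level. \<open>shrub\<close>
  quantifies over labellings and is not visibly first-order; \<open>layered\<close> quantifies over
  boundedly many vertices and walks of bounded length instead. Passing between the two changes the
  bounds, and every descent passes through \<open>shrub\<close>. A minimal number of triples for one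
  fixed bound is therefore useless: the smaller configuration lives at a larger bound. Both formulas
  must define equivalence relations on every graph, also outside the class. They therefore quantify
  universally over all configurations at the selected level: the result is an intersection of
  equivalence relations, and the full relation if there are none. On the class all these
  configurations give the same relations, so the intersection loses nothing.\<close>

definition dices :: "('a \<Rightarrow> 'a \<Rightarrow> bool) \<Rightarrow> 'a set \<Rightarrow> ('a \<Rightarrow> 'l) \<Rightarrow> ('a \<Rightarrow> 'p) \<Rightarrow> bool" where
  "dices E A lab part \<longleftrightarrow> (\<forall>u\<in>A. \<forall>v\<in>A. \<forall>u'\<in>A. \<forall>v'\<in>A. part u \<noteq> part v \<longrightarrow> part u' \<noteq> part v' \<longrightarrow>
     lab u = lab u' \<longrightarrow> lab v = lab v' \<longrightarrow> (E u v \<longleftrightarrow> E u' v'))"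

lemma dicesD:
  assumes "dices E A lab part" "u \<in> A" "v \<in> A" "u' \<in> A" "v' \<in> A" "part u \<noteq> part v" "part u' \<noteq> part v'"
    "lab u = lab u'" "lab v = lab v'"
  shows "E u v \<longleftrightarrow> E u' v'"
  using assms unfolding dices_def by blast

lemma dices_subset: "dices E A lab part \<Longrightarrow> B \<subseteq> A \<Longrightarrow> dices E B lab part"
  unfolding dices_def by blast

primrec shrub :: "nat \<Rightarrow> nat \<Rightarrow> ('a \<Rightarrow> 'a \<Rightarrow> bool) \<Rightarrow> 'a set \<Rightarrow> bool" where
  "shrub 0 k E A \<longleftrightarrow> (\<forall>u\<in>A. \<forall>v\<in>A. u = v)"
| "shrub (Suc n) k E A \<longleftrightarrow> (\<exists>(lab :: 'a \<Rightarrow> nat) (part :: 'a \<Rightarrow> nat).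
     lab ` A \<subseteq> {..<k} \<and> dices E A lab part \<and> (\<forall>p. shrub n k E {a \<in> A. part a = p}))"

lemma shrub_subset: "shrub n k E A \<Longrightarrow> B \<subseteq> A \<Longrightarrow> shrub n k E B"
proof (induction n arbitrary: A B)
  case (Suc n)
  then obtain lab part :: "'a \<Rightarrow> nat" where *: "lab ` A \<subseteq> {..<k}" "dices E A lab part"
    and s: "\<And>p. shrub n k E {a \<in> A. part a = p}" by auto
  have "shrub n k E {a \<in> B. part a = p}" for p
    using Suc.prems(2) by (intro Suc.IH[OF s[of p]]) auto
  moreover have "lab ` B \<subseteq> {..<k}" using *(1) Suc.prems(2) by blast
  ultimately show ?case using dices_subset[OF *(2) Suc.prems(2)] unfolding shrub.simps by blast
qed auto

lemma shrub_mono: "shrub n k E A \<Longrightarrow> k \<le> k' \<Longrightarrow> shrub n k' E A"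
proof (induction n arbitrary: A)
  case (Suc n)
  then obtain lab part :: "'a \<Rightarrow> nat" where *: "lab ` A \<subseteq> {..<k}" "dices E A lab part"
    and s: "\<And>p. shrub n k E {a \<in> A. part a = p}" by auto
  have "shrub n k' E {a \<in> A. part a = p}" for p
    using Suc s by blast
  moreover have "lab ` A \<subseteq> {..<k'}" using *(1) Suc.prems(2) by force
  ultimately show ?case using * unfolding shrub.simps by blast
qed auto

lemma shrub_empty: "shrub n k E {}"
  by (induction n) (auto simp: dices_def)

lemma finite_coding:
  assumes "finite S"
  shows "\<exists>f :: 'b \<Rightarrow> nat. inj_on f S \<and> f ` S = {..<card S}"
  using ex_bij_betw_finite_nat[OF assms] by (auto simp: bij_betw_def atLeast0LessThan)

text \<open>On a finite set, labels and part names of any type can be coded by numbers. Later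
  constructions may thus use pairs, sets or vertices as labels.\<close>

lemma shrub_SucI:
  fixes lab :: "'a \<Rightarrow> 'l" and part :: "'a \<Rightarrow> 'p"
  assumes fin: "finite A" and d: "dices E A lab part" and k: "card (lab ` A) \<le> k"
    and s: "\<And>a. a \<in> A \<Longrightarrow> shrub n k E {b \<in> A. part b = part a}"
  shows "shrub (Suc n) k E A"
proof -
  obtain f where f: "inj_on f (lab ` A)" "f ` lab ` A = {..<card (lab ` A)}"
    using finite_coding[of "lab ` A"] fin by auto
  obtain g :: "'p \<Rightarrow> nat" where g: "inj_on g (part ` A)"
    using finite_coding[of "part ` A"] fin by auto
  have fe: "f (lab u) = f (lab v) \<longleftrightarrow> lab u = lab v" if "u \<in> A" "v \<in> A" for u v
    using f(1) that by (auto simp: inj_on_def)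
  have ge: "g (part u) = g (part v) \<longleftrightarrow> part u = part v" if "u \<in> A" "v \<in> A" for u v
    using g that by (auto simp: inj_on_def)
  have "dices E A (f \<circ> lab) (g \<circ> part)"
    unfolding dices_def
  proof (intro ballI impI)
    fix u v u' v' assume h: "u \<in> A" "v \<in> A" "u' \<in> A" "v' \<in> A" "(g \<circ> part) u \<noteq> (g \<circ> part) v"
      "(g \<circ> part) u' \<noteq> (g \<circ> part) v'" "(f \<circ> lab) u = (f \<circ> lab) u'" "(f \<circ> lab) v = (f \<circ> lab) v'"
    show "E u v = E u' v'"
      using h by (intro dicesD[OF d]) (auto simp: fe ge)
  qed
  moreover have "(f \<circ> lab) ` A \<subseteq> {..<k}"
    using f(2) k by (auto simp: image_comp)
  moreover have "shrub n k E {a \<in> A. (g \<circ> part) a = p}" for p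
  proof (cases "\<exists>a\<in>A. g (part a) = p")
    case True
    then obtain a where a: "a \<in> A" "g (part a) = p" by blast
    then have "{b \<in> A. (g \<circ> part) b = p} = {b \<in> A. part b = part a}" using ge by auto
    then show ?thesis using s[OF a(1)] by simp
  next
    case False
    then have "{a \<in> A. (g \<circ> part) a = p} = {}" by auto
    then show ?thesis using shrub_empty by metis
  qed
  ultimately show ?thesis unfolding shrub.simps by blast
qed

text \<open>When F is a function of E and of the \<open>f\<close>-values of both ends, adding
  \<open>f\<close> to the labels keeps every dicing valid with the same parts. In particular, flips
  between label classes preserve bounded \<open>shrub\<close>.\<close>

lemma shrub_relabel:
  fixes f :: "'a \<Rightarrow> 'l"
  assumes "shrub n k E A" and "finite A" and "card (f ` A) \<le> l"
    and "\<And>u v u' v'. u \<in> A \<Longrightarrow> v \<in> A \<Longrightarrow> u' \<in> A \<Longrightarrow> v' \<in> A \<Longrightarrow> f u = f u' \<Longrightarrow> f v = f v' \<Longrightarrow>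
      E u v = E u' v' \<Longrightarrow> F u v = F u' v'"
  shows "shrub n (k * l) F A"
  using assms
proof (induction n arbitrary: A)
  case (Suc n)
  then obtain lab part :: "'a \<Rightarrow> nat" where *: "lab ` A \<subseteq> {..<k}" "dices E A lab part"
    and s: "\<And>p. shrub n k E {a \<in> A. part a = p}" by auto
  show ?case
  proof (rule shrub_SucI[where lab = "\<lambda>a. (lab a, f a)" and part = part])
    show "dices F A (\<lambda>a. (lab a, f a)) part"
      unfolding dices_def
    proof (intro ballI impI)
      fix u v u' v' assume h: "u \<in> A" "v \<in> A" "u' \<in> A" "v' \<in> A" "part u \<noteq> part v" "part u' \<noteq> part v'"
        "(lab u, f u) = (lab u', f u')" "(lab v, f v) = (lab v', f v')"
      have "E u v = E u' v'" using dicesD[OF *(2) h(1-6)] h(7,8) by simp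
      then show "F u v = F u' v'" using Suc.prems(4)[OF h(1-4)] h(7,8) by simp
    qed
    have "(\<lambda>a. (lab a, f a)) ` A \<subseteq> {..<k} \<times> f ` A" using *(1) by auto
    then have "card ((\<lambda>a. (lab a, f a)) ` A) \<le> card ({..<k} \<times> f ` A)"
      using Suc.prems(2) by (intro card_mono) auto
    also have "\<dots> \<le> k * l" using Suc.prems(3) by (simp add: card_cartesian_product)
    finally show "card ((\<lambda>a. (lab a, f a)) ` A) \<le> k * l" .
    fix a assume "a \<in> A"
    let ?B = "{b \<in> A. part b = part a}"
    have "card (f ` ?B) \<le> card (f ` A)" using Suc.prems(2) by (intro card_mono) auto
    then show "shrub n (k * l) F ?B"
      using Suc.prems by (intro Suc.IH s) auto
  qed (use Suc.prems in auto)
qed auto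

text \<open>Boundedly many part names fit into the labels, so the outer cut and the first cut inside
  each part can be made at once. The number of cuts does not grow.\<close>

lemma shrub_flatten:
  fixes lab :: "'a \<Rightarrow> 'l" and part :: "'a \<Rightarrow> 'p"
  assumes fin: "finite A" and d: "dices E A lab part" and K: "card (lab ` A) \<le> K" and M: "card (part ` A) \<le> M"
    and s: "\<And>a. a \<in> A \<Longrightarrow> shrub (Suc n) k E {b \<in> A. part b = part a}"
  shows "shrub (Suc n) (M * K * k) E A"
proof (cases "A = {}")
  case True then show ?thesis using shrub_empty by metis
next
  case False
  have "\<forall>p. \<exists>(lb :: 'a \<Rightarrow> nat) (pt :: 'a \<Rightarrow> nat). lb ` {b \<in> A. part b = p} \<subseteq> {..<k} \<and>
      dices E {b \<in> A. part b = p} lb pt \<and> (\<forall>q. shrub n k E {b \<in> {b \<in> A. part b = p}. pt b = q})"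
  proof
    fix p
    have "shrub (Suc n) k E {b \<in> A. part b = p}"
    proof (cases "\<exists>a\<in>A. part a = p")
      case True then show ?thesis using s by auto
    next
      case False
      then have "{b \<in> A. part b = p} = {}" by auto
      then show ?thesis using shrub_empty by metis
    qed
    then show "\<exists>(lb :: 'a \<Rightarrow> nat) (pt :: 'a \<Rightarrow> nat). lb ` {b \<in> A. part b = p} \<subseteq> {..<k} \<and>
      dices E {b \<in> A. part b = p} lb pt \<and> (\<forall>q. shrub n k E {b \<in> {b \<in> A. part b = p}. pt b = q})"
      by (simp only: shrub.simps)
  qed
  then obtain lb pt :: "'p \<Rightarrow> 'a \<Rightarrow> nat" where lb: "\<And>p. lb p ` {b \<in> A. part b = p} \<subseteq> {..<k}"
    and dp: "\<And>p. dices E {b \<in> A. part b = p} (lb p) (pt p)"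
    and sp: "\<And>p q. shrub n k E {b \<in> {b \<in> A. part b = p}. pt p b = q}"
    unfolding choice_iff by blast
  define lab2 where "lab2 a = ((part a, lab a), lb (part a) a)" for a
  define part2 where "part2 a = (part a, pt (part a) a)" for a
  \<comment> \<open>The factor \<open>M * K\<close> must be at least 1 to weaken k to
    \<open>M * K * k\<close>; only the empty set could prevent this.\<close>
  have "0 < card (part ` A)" "0 < card (lab ` A)" using False fin by (auto simp: card_gt_0_iff)
  then have M0: "1 \<le> M * K" using K M by simp
  show ?thesis
  proof (rule shrub_SucI[where lab = lab2 and part = part2])
    show "dices E A lab2 part2"
      unfolding dices_def
    proof (intro ballI impI)
      fix u v u' v' assume h: "u \<in> A" "v \<in> A" "u' \<in> A" "v' \<in> A" "part2 u \<noteq> part2 v" "part2 u' \<noteq> part2 v'"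
        "lab2 u = lab2 u'" "lab2 v = lab2 v'"
      show "E u v = E u' v'"
      \<comment> \<open>The labels contain the outer part. If u and v share it, all four vertices
        lie in it and the inner dicing decides; otherwise the outer one does.\<close>
      proof (cases "part u = part v")
        case True
        show ?thesis using h True
          by (intro dicesD[OF dp[of "part u"]]) (auto simp: lab2_def part2_def)
      next
        case False
        show ?thesis using h False
          by (intro dicesD[OF d]) (auto simp: lab2_def part2_def)
      qed
    qed
    have "lab2 ` A \<subseteq> (part ` A \<times> lab ` A) \<times> {..<k}" using lb by (auto simp: lab2_def)
    then have "card (lab2 ` A) \<le> card ((part ` A \<times> lab ` A) \<times> {..<k})"
      using fin by (intro card_mono) auto
    also have "\<dots> \<le> M * K * k" using K M by (simp add: card_cartesian_product mult_mono)
    finally show "card (lab2 ` A) \<le> M * K * k" .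
    fix a assume "a \<in> A"
    have "{b \<in> A. part2 b = part2 a} = {b \<in> {b \<in> A. part b = part a}. pt (part a) b = pt (part a) a}"
      by (auto simp: part2_def)
    then have "shrub n k E {b \<in> A. part2 b = part2 a}"
      using sp[of "part a" "pt (part a) a"] by simp
    then show "shrub n (M * K * k) E {b \<in> A. part2 b = part2 a}"
      by (rule shrub_mono) (use M0 in simp)
  qed fact
qed

section \<open>Induced paths in graphs of bounded shrubdepth\<close>

lemma pigeonhole_three:
  fixes S :: "nat set"
  assumes "finite C" "f ` S \<subseteq> C" "2 * card C < card S"
  shows "\<exists>x\<in>S. \<exists>y\<in>S. \<exists>z\<in>S. x < y \<and> y < z \<and> f x = f y \<and> f y = f z"
proof -
  have fS: "finite S" using assms(3) card.infinite by fastforce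
  have "\<exists>c\<in>C. 3 \<le> card {x \<in> S. f x = c}"
  proof (rule ccontr)
    assume "\<not> ?thesis"
    then have b: "card {x \<in> S. f x = c} \<le> 2" if "c \<in> C" for c using that by force
    have "S = (\<Union>c\<in>C. {x \<in> S. f x = c})" using assms(2) by auto
    then have "card S \<le> (\<Sum>c\<in>C. card {x \<in> S. f x = c})"
      using card_UN_le[OF assms(1)] by metis
    also have "\<dots> \<le> (\<Sum>c\<in>C. 2)" using b by (rule sum_mono)
    finally show False using assms(3) by simp
  qed
  then obtain c where c: "3 \<le> card {x \<in> S. f x = c}" by blast
  obtain T where T: "T \<subseteq> {x \<in> S. f x = c}" "card T = 3" using obtain_subset_with_card_n[OF c] by blast
  from T(2) obtain x y z where "T = {x, y, z}" "x \<noteq> y" "y \<noteq> z" "x \<noteq> z" by (auto simp: card_3_iff)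
  then have f: "x \<in> S" "y \<in> S" "z \<in> S" "f x = c" "f y = c" "f z = c" using T(1) by auto
  consider "x < y" "y < z" | "x < z" "z < y" | "y < x" "x < z" | "y < z" "z < x" | "z < x" "x < y" | "z < y" "y < x"
    using \<open>x \<noteq> y\<close> \<open>y \<noteq> z\<close> \<open>x \<noteq> z\<close> by linarith
  then show ?thesis by cases (use f in metis)+
qed

text \<open>
  Cut a long induced path into blocks. No block lies in one part, so it has an edge between different parts. If
  three of these edges carry the same labels, then the non-edges between their ends force these ends
  into common parts, a contradiction.
\<close>

primrec path_bound :: "nat \<Rightarrow> nat \<Rightarrow> nat" where
  "path_bound 0 k = 2"
| "path_bound (Suc n) k = (2 * (k * k) + 1) * (path_bound n k + 3)"

lemma shrub_induced_path:
  assumes "shrub n k E A" and "\<And>i. i < N \<Longrightarrow> q i \<in> A" and "inj_on q {..<N}"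
    and "\<And>i j. i < N \<Longrightarrow> j < N \<Longrightarrow> i \<noteq> j \<Longrightarrow> E (q i) (q j) \<longleftrightarrow> i = Suc j \<or> j = Suc i"
  shows "N < path_bound n k"
  using assms
proof (induction n arbitrary: A N q)
  case 0
  show ?case
  proof (rule ccontr)
    assume "\<not> ?thesis"
    then have "q 0 = q 1" "0 < N" "1 < N" using "0.prems" by auto
    then show False using "0.prems"(3) by (auto simp: inj_on_def)
  qed
next
  case (Suc n)
  then obtain lab part :: "'a \<Rightarrow> nat" where l: "lab ` A \<subseteq> {..<k}" and d: "dices E A lab part"
    and s: "\<And>p. shrub n k E {a \<in> A. part a = p}" by auto
  let ?b = "path_bound n k"
  \<comment> \<open>The extra 3 vertices per block keep edges chosen in different blocks apart; the
    number of blocks forces three chosen edges with the same ordered pair of labels.\<close>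
  let ?w = "?b + 3"
  let ?B = "2 * (k * k) + 1"
  show ?case
  proof (rule ccontr)
    assume "\<not> ?thesis"
    then have N: "?B * ?w \<le> N" by simp
    have inN: "x * ?w + i < N" if "x < ?B" "i < ?w" for x i
    proof -
      have "x * ?w + i < Suc x * ?w" using that by simp
      also have "\<dots> \<le> ?B * ?w" using that by (intro mult_le_mono) auto
      finally show ?thesis using N by simp
    qed
    have "\<exists>a. x * ?w \<le> a \<and> a < x * ?w + ?b \<and> Suc a < N \<and> part (q a) \<noteq> part (q (Suc a))" if x: "x < ?B" for x
    proof (rule ccontr)
      assume "\<not> ?thesis"
      then have c: "part (q a) = part (q (Suc a))" if "x * ?w \<le> a" "a < x * ?w + ?b" for a
        using inN[OF x, of "Suc a - x * ?w"] that by auto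
      have p: "part (q (x * ?w + i)) = part (q (x * ?w))" if "i < ?b" for i
        using that
      proof (induction i)
        case (Suc i) then show ?case using c[of "x * ?w + i"] by simp
      qed simp
      have "?b < ?b"
      proof (rule Suc.IH[OF s[of "part (q (x * ?w))"], where q = "\<lambda>i. q (x * ?w + i)"])
        fix i assume "i < ?b"
        then show "q (x * ?w + i) \<in> {a \<in> A. part a = part (q (x * ?w))}"
          using p inN[OF x, of i] Suc.prems(2) by auto
      next
        show "inj_on (\<lambda>i. q (x * ?w + i)) {..<?b}"
        proof (rule inj_onI)
          fix i j assume ij: "i \<in> {..<?b}" "j \<in> {..<?b}" "q (x * ?w + i) = q (x * ?w + j)"
          then have "x * ?w + i = x * ?w + j"
            using inN[OF x, of i] inN[OF x, of j] Suc.prems(3) by (auto simp only: inj_on_def lessThan_iff)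
          then show "i = j" by simp
        qed
      next
        fix i j assume "i < ?b" "j < ?b" "i \<noteq> j"
        then show "E (q (x * ?w + i)) (q (x * ?w + j)) \<longleftrightarrow> i = Suc j \<or> j = Suc i"
          using inN[OF x, of i] inN[OF x, of j] Suc.prems(4)[of "x * ?w + i" "x * ?w + j"] by auto
      qed
      then show False by simp
    qed
    then obtain a where a: "\<And>x. x < ?B \<Longrightarrow> x * ?w \<le> a x \<and> a x < x * ?w + ?b \<and> Suc (a x) < N \<and>
      part (q (a x)) \<noteq> part (q (Suc (a x)))" by metis
    let ?f = "\<lambda>x. (lab (q (a x)), lab (q (Suc (a x))))"
    have "?f ` {..<?B} \<subseteq> {..<k} \<times> {..<k}"
    proof (rule image_subsetI)
      fix x assume "x \<in> {..<?B}"
      then have "q (a x) \<in> A" "q (Suc (a x)) \<in> A" using a[of x] Suc.prems(2) by auto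
      then show "?f x \<in> {..<k} \<times> {..<k}" using l by auto
    qed
    then obtain x y z where xyz: "x < ?B" "y < ?B" "z < ?B" "x < y" "y < z" "?f x = ?f y" "?f y = ?f z"
      using pigeonhole_three[of "{..<k} \<times> {..<k}" ?f "{..<?B}"] by auto
    have gap: "a x + 3 \<le> a y" if "x < ?B" "y < ?B" "x < y" for x y
    proof -
      have "Suc x * ?w \<le> y * ?w" using that by (intro mult_le_mono) auto
      then have "x * ?w + ?b + 3 \<le> y * ?w" by simp
      then show ?thesis using a[OF that(1)] a[OF that(2)] by linarith
    qed
    have same: "part (q (a x)) = part (q (Suc (a y))) \<and> part (q (a y)) = part (q (Suc (a x)))"
      if h: "x < ?B" "y < ?B" "x < y" "?f x = ?f y" for x y
    proof -
      note g = gap[OF h(1-3)] and ax = a[OF h(1)] and ay = a[OF h(2)]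
      have A: "q (a x) \<in> A" "q (Suc (a x)) \<in> A" "q (a y) \<in> A" "q (Suc (a y)) \<in> A"
        using ax ay Suc.prems(2) by auto
      have e: "E (q (a x)) (q (Suc (a x)))" using Suc.prems(4)[of "a x" "Suc (a x)"] ax by auto
      have n1: "\<not> E (q (a x)) (q (Suc (a y)))" using Suc.prems(4)[of "a x" "Suc (a y)"] ax ay g by auto
      have n2: "\<not> E (q (a y)) (q (Suc (a x)))" using Suc.prems(4)[of "a y" "Suc (a x)"] ax ay g by auto
      show ?thesis
      proof
        show "part (q (a x)) = part (q (Suc (a y)))"
        proof (rule ccontr)
          assume "\<not> ?thesis"
          then have "E (q (a x)) (q (Suc (a x))) = E (q (a x)) (q (Suc (a y)))"
            using A ax h(4) by (intro dicesD[OF d]) auto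
          then show False using e n1 by simp
        qed
        show "part (q (a y)) = part (q (Suc (a x)))"
        proof (rule ccontr)
          assume "\<not> ?thesis"
          then have "E (q (a x)) (q (Suc (a x))) = E (q (a y)) (q (Suc (a x)))"
            using A ax h(4) by (intro dicesD[OF d]) auto
          then show False using e n2 by simp
        qed
      qed
    qed
    \<comment> \<open>Two such edges only give crosswise equalities between parts. The third edge
      links them: both ends of the middle edge y would lie in the part of
      \<open>q (a z)\<close>.\<close>
    have "part (q (a x)) = part (q (Suc (a y)))" "part (q (a y)) = part (q (Suc (a x)))"
      "part (q (a z)) = part (q (Suc (a x)))" "part (q (a z)) = part (q (Suc (a y)))"
      using same[of x y] same[of x z] same[of y z] xyz by auto
    then show False using a[of y] a[of x] xyz by auto
  qed
qed

section \<open>Configurations of representatives\<close>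

primrec reach :: "('a \<Rightarrow> 'a \<Rightarrow> bool) \<Rightarrow> 'a set \<Rightarrow> nat \<Rightarrow> 'a \<Rightarrow> 'a \<Rightarrow> bool" where
  "reach F A 0 u v \<longleftrightarrow> u = v"
| "reach F A (Suc t) u v \<longleftrightarrow> (\<exists>w\<in>A. reach F A t u w \<and> (w = v \<or> F w v))"

text \<open>Expresses that t steps exhaust the components, which makes connectedness first-order.
  Testing one additional step is enough, as longer walks can then be absorbed step by step.\<close>

definition stable :: "('a \<Rightarrow> 'a \<Rightarrow> bool) \<Rightarrow> 'a set \<Rightarrow> nat \<Rightarrow> bool" where
  "stable F A t \<longleftrightarrow> (\<forall>u\<in>A. \<forall>v\<in>A. reach F A (Suc t) u v \<longrightarrow> reach F A t u v)"

definition sym_on_set :: "('a \<Rightarrow> 'a \<Rightarrow> bool) \<Rightarrow> 'a set \<Rightarrow> bool" where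
  "sym_on_set F A \<longleftrightarrow> (\<forall>u\<in>A. \<forall>v\<in>A. F u v \<longrightarrow> F v u)"

lemma sym_on_setD: "sym_on_set F A \<Longrightarrow> u \<in> A \<Longrightarrow> v \<in> A \<Longrightarrow> F u v \<longleftrightarrow> F v u"
  unfolding sym_on_set_def by blast

lemma sym_on_set_subset: "sym_on_set F A \<Longrightarrow> B \<subseteq> A \<Longrightarrow> sym_on_set F B"
  unfolding sym_on_set_def by blast

lemma reach_refl: "u \<in> A \<Longrightarrow> reach F A t u u"
  by (induction t) auto

lemma reach_mono: "v \<in> A \<Longrightarrow> reach F A t u v \<Longrightarrow> t \<le> t' \<Longrightarrow> reach F A t' u v"
  by (induction t' rule: nat_induct) (auto simp: le_Suc_eq)

lemma reach_step:
  assumes "stable F A t" "u \<in> A" "w \<in> A" "v \<in> A" "reach F A t u w" "F w v"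
  shows "reach F A t u v"
  using assms unfolding stable_def by fastforce

lemma reach_absorb:
  assumes "stable F A t" "u \<in> A" "w \<in> A" "v \<in> A" "reach F A t u w" "reach F A t' w v"
  shows "reach F A t u v"
  using assms(4,6)
proof (induction t' arbitrary: v)
  case 0 then show ?case using assms by simp
next
  case (Suc t')
  then obtain x where x: "x \<in> A" "reach F A t' w x" "x = v \<or> F x v" by auto
  then have "reach F A t u x" using Suc.IH by blast
  then show ?case using x reach_step[OF assms(1,2) x(1) Suc.prems(1)] by auto
qed

lemma reach_link:
  assumes "stable F A t" "u \<in> A" "v \<in> A" "F u v"
  shows "reach F A t u v"
  using reach_step[OF assms(1,2,2,3) reach_refl[OF assms(2)]] assms(4) by blast

lemma reach_sym:
  assumes "stable F A t" "sym_on_set F A" "u \<in> A" "v \<in> A" "reach F A t' u v"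
  shows "reach F A t v u"
  using assms(4,5)
proof (induction t' arbitrary: v)
  case 0 then show ?case by (auto intro: reach_refl)
next
  case (Suc t')
  then obtain x where x: "x \<in> A" "reach F A t' u x" "x = v \<or> F x v" by auto
  then have i: "reach F A t x u" using Suc.IH by blast
  show ?case
  proof (cases "x = v")
    case False
    then have "F v x" using x Suc.prems(1) sym_on_setD[OF assms(2)] by blast
    then have "reach F A t v x" using reach_link[OF assms(1) Suc.prems(1) x(1)] by blast
    then show ?thesis using reach_absorb[OF assms(1) Suc.prems(1) x(1) assms(3) _ i] by blast
  qed (use i in simp)
qed

lemma reach_trans:
  assumes "stable F A t" "u \<in> A" "w \<in> A" "v \<in> A" "reach F A t u w" "reach F A t w v"
  shows "reach F A t u v"
  using assms by (rule reach_absorb)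

lemma stable_reach:
  assumes "stable F A t" "t \<le> t'" "u \<in> A" "v \<in> A"
  shows "reach F A t' u v \<longleftrightarrow> reach F A t u v"
  using reach_absorb[OF assms(1,3,3,4) reach_refl[OF assms(3)]] reach_mono[OF assms(4) _ assms(2)] by blast

lemma stable_mono:
  assumes "stable F A t" "t \<le> t'"
  shows "stable F A t'"
  using stable_reach[OF assms(1)] assms(2) unfolding stable_def by (metis le_SucI)

definition cell :: "('a \<Rightarrow> 'a \<Rightarrow> bool) \<Rightarrow> 'a set \<Rightarrow> nat \<Rightarrow> 'a \<Rightarrow> 'a set" where
  "cell F A t a = {b \<in> A. reach F A t a b}"

lemma cell_mono: "stable F A t \<Longrightarrow> t \<le> t' \<Longrightarrow> a \<in> A \<Longrightarrow> cell F A t' a = cell F A t a"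
  unfolding cell_def using stable_reach by fast

lemma cell_eq_iff:
  assumes "stable F A t" "sym_on_set F A" "u \<in> A" "v \<in> A"
  shows "cell F A t u = cell F A t v \<longleftrightarrow> reach F A t u v"
proof
  assume "cell F A t u = cell F A t v"
  then have "v \<in> cell F A t u" using assms(4) by (auto simp: cell_def reach_refl)
  then show "reach F A t u v" by (simp add: cell_def)
next
  assume r: "reach F A t u v"
  have r': "reach F A t v u" using reach_sym[OF assms r] .
  show "cell F A t u = cell F A t v"
    unfolding cell_def using reach_trans[OF assms(1)] r r' assms(3,4) by blast
qed

text \<open>The exact distance of each vertex from u is recorded, because this is what makes the
  path induced.\<close>

lemma shortest_path:
  assumes "u \<in> A" "v \<in> A" "reach F A i u v" "\<And>i'. i' < i \<Longrightarrow> \<not> reach F A i' u v"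
  shows "\<exists>q. q i = v \<and> (\<forall>a\<le>i. q a \<in> A \<and> reach F A a u (q a) \<and> (\<forall>b<a. \<not> reach F A b u (q a))) \<and>
    (\<forall>a<i. F (q a) (q (Suc a)))"
  using assms(2-)
proof (induction i arbitrary: v)
  case 0
  then show ?case using assms(1) by (intro exI[of _ "\<lambda>_. v"]) auto
next
  case (Suc i)
  then obtain w where w: "w \<in> A" "reach F A i u w" "w = v \<or> F w v" by auto
  have wv: "F w v" using w Suc.prems(3)[of i] by auto
  have "\<not> reach F A i' u w" if "i' < i" for i'
    using Suc.prems(3)[of "Suc i'"] that w(1) wv by auto
  then obtain q where q: "q i = w" "\<forall>a\<le>i. q a \<in> A \<and> reach F A a u (q a) \<and> (\<forall>b<a. \<not> reach F A b u (q a))"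
    "\<forall>a<i. F (q a) (q (Suc a))" using Suc.IH[OF w(1,2)] by blast
  show ?case
    using q wv Suc.prems
    by (intro exI[of _ "q(Suc i := v)"]) (auto simp: le_Suc_eq less_Suc_eq)
qed

text \<open>If t steps do not suffice, some vertex has distance t + 1. A shortest path to it is
  induced, and its first t + 1 vertices already exceed \<open>path_bound\<close>.\<close>

lemma shrub_stable:
  assumes "shrub n k F A" "sym_on_set F A"
  shows "stable F A (path_bound n k)"
  unfolding stable_def
proof (intro ballI impI, rule ccontr)
  let ?t = "path_bound n k"
  fix u v assume uv: "u \<in> A" "v \<in> A" "reach F A (Suc ?t) u v" "\<not> reach F A ?t u v"
  have "\<not> reach F A i u v" if "i < Suc ?t" for i
    using reach_mono[OF uv(2)] uv(4) that less_Suc_eq_le by blast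
  then obtain q where q: "\<And>a. a \<le> Suc ?t \<Longrightarrow> q a \<in> A" "\<And>a. a \<le> Suc ?t \<Longrightarrow> reach F A a u (q a)"
    "\<And>a b. a \<le> Suc ?t \<Longrightarrow> b < a \<Longrightarrow> \<not> reach F A b u (q a)"
    "\<And>a. a < Suc ?t \<Longrightarrow> F (q a) (q (Suc a))"
    using shortest_path[OF uv(1-3)] by blast
  have ne: "q a \<noteq> q b" if "a \<le> Suc ?t" "b \<le> Suc ?t" "b < a" for a b
    using q(2)[OF that(2)] q(3)[OF that(1,3)] by metis
  have far: "\<not> F (q b) (q a)" if "a \<le> Suc ?t" "Suc b < a" for a b
  proof
    assume "F (q b) (q a)"
    then have "reach F A (Suc b) u (q a)" using q(1,2)[of b] that by auto
    then show False using q(3)[OF that] by simp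
  qed
  have "Suc ?t < path_bound n k"
  proof (rule shrub_induced_path[OF assms(1)])
    show "inj_on q {..<Suc ?t}"
    proof (rule inj_onI, rule ccontr)
      fix x y assume h: "x \<in> {..<Suc ?t}" "y \<in> {..<Suc ?t}" "q x = q y" "x \<noteq> y"
      then show False using ne[of x y] ne[of y x] by (cases x y rule: linorder_cases) auto
    qed
    fix i j assume ij: "i < Suc ?t" "j < Suc ?t" "i \<noteq> j"
    have s: "F (q i) (q j) \<longleftrightarrow> F (q j) (q i)"
      using q(1) ij by (intro sym_on_setD[OF assms(2)]) auto
    show "F (q i) (q j) \<longleftrightarrow> i = Suc j \<or> j = Suc i"
    proof -
      consider "j = Suc i" | "Suc i < j" | "i = Suc j" | "Suc j < i" using ij by linarith
      then show ?thesis
        using far[of i j] far[of j i] q(4)[of i] q(4)[of j] s ij by cases auto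
    qed
  qed (use q(1) in auto)
  then show False by simp
qed

section \<open>Majority labels and the flip they define\<close>

definition maj :: "('a \<Rightarrow> 'a \<Rightarrow> bool) \<Rightarrow> (nat \<Rightarrow> 'a) \<Rightarrow> nat \<Rightarrow> 'a \<Rightarrow> bool" where
  "maj E s j u \<longleftrightarrow> E u (s (3 * j)) \<and> E u (s (3 * j + 1)) \<or> E u (s (3 * j)) \<and> E u (s (3 * j + 2)) \<or>
     E u (s (3 * j + 1)) \<and> E u (s (3 * j + 2))"

definition agree :: "('a \<Rightarrow> 'a \<Rightarrow> bool) \<Rightarrow> nat \<Rightarrow> (nat \<Rightarrow> 'a) \<Rightarrow> 'a \<Rightarrow> 'a \<Rightarrow> bool" where
  "agree E m s u v \<longleftrightarrow> (\<forall>j<m. maj E s j u \<longleftrightarrow> maj E s j v)"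

definition generic :: "('a \<Rightarrow> 'a \<Rightarrow> bool) \<Rightarrow> nat \<Rightarrow> (nat \<Rightarrow> 'a) \<Rightarrow> 'a \<Rightarrow> bool" where
  "generic E m s w \<longleftrightarrow> (\<exists>j<m. agree E m s w (s (3 * j)))"

text \<open>
  Labels without representatives are taken into account only through the vertices complete to them. Hence the
  labelling depends only on the set of the functions \<open>maj E s j\<close> and on which labels have
  representatives, which is why it can be canonical.
\<close>

definition full :: "('a \<Rightarrow> 'a \<Rightarrow> bool) \<Rightarrow> 'a set \<Rightarrow> nat \<Rightarrow> (nat \<Rightarrow> 'a) \<Rightarrow> 'a \<Rightarrow> 'a \<Rightarrow> bool" where
  "full E A m s u w \<longleftrightarrow> (\<forall>x\<in>A. agree E m s x w \<longrightarrow> E u x)"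

definition sim :: "('a \<Rightarrow> 'a \<Rightarrow> bool) \<Rightarrow> 'a set \<Rightarrow> nat \<Rightarrow> (nat \<Rightarrow> 'a) \<Rightarrow> 'a \<Rightarrow> 'a \<Rightarrow> bool" where
  "sim E A m s u v \<longleftrightarrow> agree E m s u v \<and>
     (\<forall>w\<in>A. \<not> generic E m s w \<longrightarrow> (full E A m s u w \<longleftrightarrow> full E A m s v w))"

text \<open>The first member \<open>s (3 * j)\<close> stands for the label class of the triple
  j.\<close>

definition gtype :: "('a \<Rightarrow> 'a \<Rightarrow> bool) \<Rightarrow> 'a set \<Rightarrow> nat \<Rightarrow> (nat \<Rightarrow> 'a) \<Rightarrow> nat \<Rightarrow> 'a \<Rightarrow> bool" where
  "gtype E A m s j v \<longleftrightarrow> sim E A m s v (s (3 * j))"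

definition rare :: "('a \<Rightarrow> 'a \<Rightarrow> bool) \<Rightarrow> 'a set \<Rightarrow> nat \<Rightarrow> (nat \<Rightarrow> 'a) \<Rightarrow> 'a \<Rightarrow> bool" where
  "rare E A m s v \<longleftrightarrow> (\<forall>j<m. \<not> gtype E A m s j v)"

text \<open>The edges of the flipped graph: pairs whose adjacency contradicts the majority predicted
  by the class of one end. Nothing predicts the adjacency of two rare vertices, so all rare vertices
  are forced into one component.\<close>

definition link :: "('a \<Rightarrow> 'a \<Rightarrow> bool) \<Rightarrow> 'a set \<Rightarrow> nat \<Rightarrow> (nat \<Rightarrow> 'a) \<Rightarrow> 'a \<Rightarrow> 'a \<Rightarrow> bool" where
  "link E A m s u v \<longleftrightarrow> rare E A m s u \<and> rare E A m s v \<or>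
     (\<exists>j<m. gtype E A m s j v \<and> (E u v \<longleftrightarrow> \<not> maj E s j u)) \<or>
     (\<exists>j<m. gtype E A m s j u \<and> (E u v \<longleftrightarrow> \<not> maj E s j v))"

text \<open>Agreement classes are named by their sets of majorities, which puts the labels into a
  finite range independent of the graph: 2 ^ m sets of indices, paired with 2 ^ 2 ^ m families of
  such sets. This is the origin of \<open>simcount\<close>.\<close>

definition simlab :: "('a \<Rightarrow> 'a \<Rightarrow> bool) \<Rightarrow> 'a set \<Rightarrow> nat \<Rightarrow> (nat \<Rightarrow> 'a) \<Rightarrow> 'a \<Rightarrow> nat set \<times> nat set set" where
  "simlab E A m s u = ({j. j < m \<and> maj E s j u},
     {{j. j < m \<and> maj E s j w} | w. w \<in> A \<and> \<not> generic E m s w \<and> full E A m s u w})"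

definition simcount :: "nat \<Rightarrow> nat" where
  "simcount m = 2 ^ m * 2 ^ 2 ^ m"

lemma simcount_mono: "m \<le> m' \<Longrightarrow> simcount m \<le> simcount m'"
  unfolding simcount_def by (intro mult_mono power_increasing) auto

lemma agree_iff: "agree E m s u v \<longleftrightarrow> {j. j < m \<and> maj E s j u} = {j. j < m \<and> maj E s j v}"
  unfolding agree_def by auto

lemma agree_cong: "agree E m s w w' \<Longrightarrow> generic E m s w = generic E m s w'"
  "agree E m s w w' \<Longrightarrow> full E A m s u w = full E A m s u w'"
  unfolding generic_def full_def agree_iff by auto

lemma sim_iff: "sim E A m s u v \<longleftrightarrow> simlab E A m s u = simlab E A m s v"
proof
  assume "sim E A m s u v"
  then show "simlab E A m s u = simlab E A m s v"
    unfolding sim_def simlab_def agree_iff by auto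
next
  assume eq: "simlab E A m s u = simlab E A m s v"
  have *: "full E A m s v w"
    if eq: "simlab E A m s u = simlab E A m s v" and w: "w \<in> A" "\<not> generic E m s w" "full E A m s u w" for u v w
  proof -
    have "{j. j < m \<and> maj E s j w} \<in> snd (simlab E A m s u)"
      using w unfolding simlab_def by auto
    then have "{j. j < m \<and> maj E s j w} \<in> snd (simlab E A m s v)" using eq by simp
    then obtain w' where "{j. j < m \<and> maj E s j w} = {j. j < m \<and> maj E s j w'}" "full E A m s v w'"
      unfolding simlab_def by auto
    then show ?thesis using agree_cong(2)[of E m s w w'] by (simp add: agree_iff)
  qed
  have "agree E m s u v" using eq unfolding simlab_def agree_iff by auto
  then show "sim E A m s u v" unfolding sim_def using *[OF eq] *[OF eq[symmetric]] by blast
qed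

lemma sim_agree: "sim E A m s u v \<Longrightarrow> agree E m s u v"
  unfolding sim_def by blast

lemma sim_maj: "sim E A m s u v \<Longrightarrow> j < m \<Longrightarrow> maj E s j u \<longleftrightarrow> maj E s j v"
  unfolding sim_def agree_def by blast

lemma card_simlab: "card (simlab E A m s ` B) \<le> simcount m"
proof -
  have "simlab E A m s ` B \<subseteq> Pow {..<m} \<times> Pow (Pow {..<m})"
    unfolding simlab_def by auto
  then have "card (simlab E A m s ` B) \<le> card (Pow {..<m} \<times> Pow (Pow {..<m}))"
    by (intro card_mono) auto
  then show ?thesis by (simp add: card_cartesian_product card_Pow simcount_def)
qed

lemma finite_simlab: "finite (simlab E A m s ` B)"
proof (rule finite_subset)
  show "simlab E A m s ` B \<subseteq> Pow {..<m} \<times> Pow (Pow {..<m})"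
    unfolding simlab_def by auto
qed auto

text \<open>Every clause of \<open>link\<close> reads only the labels of the two ends and their
  adjacency. Hence \<open>shrub_relabel\<close> applies to the flip.\<close>

lemma link_cong:
  assumes "sim E A m s u u'" "sim E A m s v v'" "E u v = E u' v'"
  shows "link E A m s u v = link E A m s u' v'"
proof -
  have "gtype E A m s j u = gtype E A m s j u'" "gtype E A m s j v = gtype E A m s j v'" for j
    using assms(1,2) unfolding gtype_def sim_iff by auto
  then show ?thesis unfolding link_def rare_def using assms(3) sim_maj[OF assms(1)] sim_maj[OF assms(2)] by auto
qed

lemma sym_link: "sym_on_set E A \<Longrightarrow> sym_on_set (link E A m s) A"
  unfolding sym_on_set_def link_def by blast

lemma gtype_maj:
  assumes "\<not> link E A m s u v" "j < m" "gtype E A m s j v"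
  shows "E u v \<longleftrightarrow> maj E s j u"
  using assms unfolding link_def by blast

text \<open>The ends of an unlinked pair are not both rare, so one of them belongs to a triple. The
  majority of the other end towards this triple is the adjacency, and it depends on the label
  only.\<close>

lemma unlinked_determined:
  assumes "\<not> link E A m s u v" "\<not> link E A m s u' v'" "sim E A m s u u'" "sim E A m s v v'"
  shows "E u v \<longleftrightarrow> E u' v'"
proof -
  have t: "gtype E A m s j u = gtype E A m s j u'" "gtype E A m s j v = gtype E A m s j v'" for j
    using assms(3,4) unfolding gtype_def sim_iff by auto
  consider j where "j < m" "gtype E A m s j u" | j where "j < m" "gtype E A m s j v"
    using assms(1) unfolding link_def rare_def by blast
  then show ?thesis
  proof cases
    case 1
    then have "E u v \<longleftrightarrow> maj E s j v" "E u' v' \<longleftrightarrow> maj E s j v'" using assms(1,2) t unfolding link_def by blast+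
    then show ?thesis using sim_maj[OF assms(4) 1(1)] by simp
  next
    case 2
    then have "E u v \<longleftrightarrow> maj E s j u" "E u' v' \<longleftrightarrow> maj E s j u'" using assms(1,2) t unfolding link_def by blast+
    then show ?thesis using sim_maj[OF assms(3) 2(1)] by simp
  qed
qed

text \<open>Vertices in different components are unlinked, whichever triples were chosen. This is
  why \<open>layered\<close> and \<open>config\<close> contain no dicing condition.\<close>

lemma dices_cell:
  assumes "stable (link E A m s) A t" "sym_on_set E A"
  shows "dices E A (simlab E A m s) (cell (link E A m s) A t)"
  unfolding dices_def
proof (intro ballI impI)
  let ?c = "cell (link E A m s) A t"
  note sl = sym_link[OF assms(2), of m s]
  fix u v u' v' assume h: "u \<in> A" "v \<in> A" "u' \<in> A" "v' \<in> A" "?c u \<noteq> ?c v" "?c u' \<noteq> ?c v'"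
    "simlab E A m s u = simlab E A m s u'" "simlab E A m s v = simlab E A m s v'"
  have "\<not> link E A m s u v" "\<not> link E A m s u' v'"
    using h reach_link[OF assms(1)] cell_eq_iff[OF assms(1) sl] by blast+
  then show "E u v = E u' v'" using unlinked_determined h(7,8) unfolding sim_iff by metis
qed

section \<open>Twin classes\<close>

definition twin :: "('a \<Rightarrow> 'a \<Rightarrow> bool) \<Rightarrow> 'a set \<Rightarrow> 'a \<Rightarrow> 'a \<Rightarrow> bool" where
  "twin E A u v \<longleftrightarrow> (\<forall>w\<in>A. w \<noteq> u \<longrightarrow> w \<noteq> v \<longrightarrow> (E u w \<longleftrightarrow> E v w))"

lemma twin_refl: "twin E A u u" by (simp add: twin_def)

lemma twin_sym: "twin E A u v \<Longrightarrow> twin E A v u" by (auto simp: twin_def)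

lemma twinD: "twin E A u v \<Longrightarrow> w \<in> A \<Longrightarrow> w \<noteq> u \<Longrightarrow> w \<noteq> v \<Longrightarrow> E u w \<longleftrightarrow> E v w"
  by (auto simp: twin_def)

lemma twin_trans:
  assumes "sym_on_set E A" "u \<in> A" "v \<in> A" "w \<in> A" "twin E A u v" "twin E A v w"
  shows "twin E A u w"
  unfolding twin_def
proof (intro ballI impI)
  fix x assume x: "x \<in> A" "x \<noteq> u" "x \<noteq> w"
  show "E u x \<longleftrightarrow> E w x"
  proof (cases "x = v")
    case False
    then show ?thesis using x twinD[OF assms(5) x(1)] twinD[OF assms(6) x(1)] by auto
  next
    case True
    show ?thesis
    proof (cases "u = w")
      case False
      \<comment> \<open>Neither twin relation can be tested at v itself. The detour is E u v, E v u,
        E w u, E u w, E v w, E w v, alternating symmetry with one of the twin relations.\<close>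
      have "E u v \<longleftrightarrow> E v u" "E w v \<longleftrightarrow> E v w" "E w u \<longleftrightarrow> E u w"
        using sym_on_setD[OF assms(1)] assms(2-4) by blast+
      moreover have "E v w \<longleftrightarrow> E u w" using twinD[OF assms(5,4)] x True False by auto
      moreover have "E v u \<longleftrightarrow> E w u" using twinD[OF assms(6,2)] x True False by auto
      ultimately show ?thesis using True by blast
    qed simp
  qed
qed

text \<open>Replace the ends one at a time, passing through the pair u', v. If v = u' this is not a
  pair; then the way leads through u, v', and if also v' = u only symmetry is left.\<close>

lemma twin_determined:
  assumes "sym_on_set E A" "u \<in> A" "v \<in> A" "u' \<in> A" "v' \<in> A" "twin E A u u'" "twin E A v v'" "u \<noteq> v" "u' \<noteq> v'"
  shows "E u v \<longleftrightarrow> E u' v'"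
proof (cases "v = u'")
  case False
  have "E u v \<longleftrightarrow> E u' v" using twinD[OF assms(6,3)] assms(8) False by auto
  moreover have "E v u' \<longleftrightarrow> E v' u'" using twinD[OF assms(7,4)] assms(9) False by auto
  moreover have "E v u' \<longleftrightarrow> E u' v" "E v' u' \<longleftrightarrow> E u' v'" using sym_on_setD[OF assms(1)] assms(2-5) by blast+
  ultimately show ?thesis by simp
next
  case True
  show ?thesis
  proof (cases "v' = u")
    case True
    then show ?thesis using \<open>v = u'\<close> sym_on_setD[OF assms(1)] assms(2-5) by blast
  next
    case False
    have "E u v' \<longleftrightarrow> E u' v'" using twinD[OF assms(6,5)] assms(9) False by auto
    moreover have "E u' u \<longleftrightarrow> E v' u" using twinD[OF assms(7,2)] assms(8) True False by auto
    moreover have "E u u' \<longleftrightarrow> E u' u" "E v' u \<longleftrightarrow> E u v'" using sym_on_setD[OF assms(1)] assms(2-5) by blast+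
    ultimately show ?thesis using True by simp
  qed
qed

text \<open>A first-order substitute for \<open>shrub\<close>, equivalent to it up to changing the bounds.\<close>

primrec layered :: "nat \<Rightarrow> nat \<Rightarrow> ('a \<Rightarrow> 'a \<Rightarrow> bool) \<Rightarrow> 'a set \<Rightarrow> bool" where
  "layered 0 t E A \<longleftrightarrow> (\<exists>s. (\<forall>i<t. s i \<in> A) \<and> (\<forall>u\<in>A. \<exists>i<t. twin E A u (s i)))"
| "layered (Suc n) t E A \<longleftrightarrow> (\<exists>m\<le>t. \<exists>s. (\<forall>r<3 * m. s r \<in> A) \<and> stable (link E A m s) A t \<and>
     (\<forall>a\<in>A. layered n t E (cell (link E A m s) A t a)))"

text \<open>Exposes the witness in \<open>layered (Suc n)\<close>. The number m of triples is
  separated from the bound t because m will be minimised while t grows.\<close>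

definition config :: "nat \<Rightarrow> nat \<Rightarrow> nat \<Rightarrow> ('a \<Rightarrow> 'a \<Rightarrow> bool) \<Rightarrow> 'a set \<Rightarrow> (nat \<Rightarrow> 'a) \<Rightarrow> bool" where
  "config n t m E A s \<longleftrightarrow> (\<forall>r<3 * m. s r \<in> A) \<and> stable (link E A m s) A t \<and>
     (\<forall>a\<in>A. layered n t E (cell (link E A m s) A t a))"

lemma layered_Suc_config: "layered (Suc n) t E A \<longleftrightarrow> (\<exists>m\<le>t. \<exists>s. config n t m E A s)"
  by (simp add: config_def)

lemma cell_self: "a \<in> A \<Longrightarrow> a \<in> cell F A t a"
  by (simp add: cell_def reach_refl)

lemma cell_subset: "cell F A t a \<subseteq> A"
  by (auto simp: cell_def)

lemma layered_mono: "layered n t E A \<Longrightarrow> t \<le> t' \<Longrightarrow> A \<noteq> {} \<Longrightarrow> layered n t' E A"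
proof (induction n arbitrary: A)
  case 0
  then obtain s where s: "\<forall>i<t. s i \<in> A" "\<forall>u\<in>A. \<exists>i<t. twin E A u (s i)" by auto
  \<comment> \<open>The additional entries are filled with an arbitrary vertex; on the empty set no
    entry would be possible.\<close>
  obtain a where "a \<in> A" using 0 by blast
  then show ?case using s 0
    by (auto intro!: exI[of _ "\<lambda>i. if i < t then s i else a"]) (metis order_less_le_trans)
next
  case (Suc n)
  then obtain m s where ms: "m \<le> t" "\<forall>r<3 * m. s r \<in> A" "stable (link E A m s) A t"
    "\<forall>a\<in>A. layered n t E (cell (link E A m s) A t a)" by auto
  have "stable (link E A m s) A t'" using ms(3) Suc.prems(2) by (rule stable_mono)
  moreover have "layered n t' E (cell (link E A m s) A t' a)" if "a \<in> A" for a
    using cell_mono[OF ms(3) Suc.prems(2) that] ms(4) that Suc.IH[OF _ Suc.prems(2)] cell_self[OF that] by (metis empty_iff)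
  ultimately show ?case using ms(1,2) Suc.prems(2) unfolding layered.simps by (meson order_trans)
qed

lemma config_mono:
  assumes "config n t m E A s" "t \<le> t'"
  shows "config n t' m E A s"
proof -
  have st: "stable (link E A m s) A t" using assms(1) by (simp add: config_def)
  have "layered n t' E (cell (link E A m s) A t' a)" if "a \<in> A" for a
    using assms that layered_mono[OF _ assms(2)] cell_self[OF that] unfolding config_def
    by (metis cell_mono[OF st assms(2) that] empty_iff)
  then show ?thesis using assms stable_mono[OF st assms(2)] unfolding config_def by blast
qed

text \<open>Any number dominating the label counts of all levels would do; the sum is the
  simplest.\<close>

primrec shrub_count :: "nat \<Rightarrow> nat \<Rightarrow> nat" where
  "shrub_count 0 t = t"
| "shrub_count (Suc n) t = simcount t + shrub_count n t"

lemma layered_0_shrub: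
  assumes "finite A" "sym_on_set E A" "layered 0 t E A"
  shows "shrub (Suc 0) t E A"
proof -
  obtain s where s: "\<forall>i<t. s i \<in> A" "\<forall>u\<in>A. \<exists>i<t. twin E A u (s i)" using assms(3) by auto
  then obtain f where f: "\<And>u. u \<in> A \<Longrightarrow> f u < t \<and> twin E A u (s (f u))" by metis
  show ?thesis
  proof (rule shrub_SucI[where lab = f and part = "\<lambda>u. u"])
    show "dices E A f (\<lambda>u. u)"
      unfolding dices_def
    proof (intro ballI impI)
      fix u v u' v' assume h: "u \<in> A" "v \<in> A" "u' \<in> A" "v' \<in> A" "u \<noteq> v" "u' \<noteq> v'" "f u = f u'" "f v = f v'"
      have "twin E A u u'" "twin E A v v'"
        using h f s(1) twin_trans[OF assms(2)] twin_sym by metis+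
      then show "E u v = E u' v'" using twin_determined[OF assms(2) h(1-4)] h by blast
    qed
    have "f ` A \<subseteq> {..<t}" using f by auto
    then show "card (f ` A) \<le> t" using card_mono[of "{..<t}"] by auto
  qed (use assms in auto)
qed

lemma layered_shrub:
  assumes "finite A" "sym_on_set E A" "layered n t E A"
  shows "shrub (Suc n) (shrub_count n t) E A"
  using assms
proof (induction n arbitrary: A)
  case 0
  then show ?case using layered_0_shrub unfolding shrub_count.simps by blast
next
  case (Suc n)
  then obtain m s where ms: "m \<le> t" "\<forall>r<3 * m. s r \<in> A" "stable (link E A m s) A t"
    "\<forall>a\<in>A. layered n t E (cell (link E A m s) A t a)" by auto
  note sl = sym_link[OF Suc.prems(2), of m s]
  show ?case
  proof (rule shrub_SucI[OF Suc.prems(1) dices_cell[OF ms(3) Suc.prems(2)]])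
    have "card (simlab E A m s ` A) \<le> simcount t"
      using card_simlab simcount_mono[OF ms(1)] order_trans by blast
    then show "card (simlab E A m s ` A) \<le> shrub_count (Suc n) t" by simp
    fix a assume a: "a \<in> A"
    have "{b \<in> A. cell (link E A m s) A t b = cell (link E A m s) A t a} = cell (link E A m s) A t a"
      using cell_eq_iff[OF ms(3) sl a] unfolding cell_def by blast
    moreover have "shrub (Suc n) (shrub_count n t) E (cell (link E A m s) A t a)"
      using Suc.prems ms(4) a cell_subset
      by (intro Suc.IH) (auto intro: finite_subset[OF cell_subset] sym_on_set_subset[OF _ cell_subset])
    ultimately show "shrub (Suc n) (shrub_count (Suc n) t) E {b \<in> A. cell (link E A m s) A t b = cell (link E A m s) A t a}"
      using shrub_mono[of "Suc n" "shrub_count n t" E _ "shrub_count (Suc n) t"] by (simp only: shrub_count.simps le_add2)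
  qed
qed

section \<open>Existence of configurations\<close>

text \<open>The list \<open>l\<close> contains the labels that own a triple, and X is the union of
  the parts that meet any other label. The aim is that the triples, without knowledge of
  \<open>part\<close>, yield components that stay inside one part or inside X.\<close>

locale spread =
  fixes E :: "'a \<Rightarrow> 'a \<Rightarrow> bool" and A :: "'a set" and lab :: "'a \<Rightarrow> 'l" and part :: "'a \<Rightarrow> 'p"
    and m :: nat and l :: "nat \<Rightarrow> 'l" and s :: "nat \<Rightarrow> 'a" and X :: "'a set"
  assumes sym: "sym_on_set E A" and d: "dices E A lab part"
    and X_def: "X = {v \<in> A. \<exists>u\<in>A. part u = part v \<and> lab u \<notin> l ` {..<m}}"
    and s: "\<And>j i. j < m \<Longrightarrow> i < 3 \<Longrightarrow> s (3 * j + i) \<in> A - X \<and> lab (s (3 * j + i)) = l j"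
    and far: "\<And>j i i'. j < m \<Longrightarrow> i < 3 \<Longrightarrow> i' < 3 \<Longrightarrow> i \<noteq> i' \<Longrightarrow> part (s (3 * j + i)) \<noteq> part (s (3 * j + i'))"
begin

lemma X_part: "v \<in> A \<Longrightarrow> x \<in> X \<Longrightarrow> part v = part x \<Longrightarrow> v \<in> X"
  unfolding X_def by auto

lemma X_subset: "X \<subseteq> A"
  unfolding X_def by auto

lemma s0: "j < m \<Longrightarrow> s (3 * j) \<in> A" "j < m \<Longrightarrow> s (3 * j) \<notin> X" "j < m \<Longrightarrow> lab (s (3 * j)) = l j"
  using s[of j 0] by auto

lemma outside_lab: "v \<in> A - X \<Longrightarrow> \<exists>j<m. lab v = l j"
  unfolding X_def by auto

text \<open>At most one of the three representatives lies in the part of u. The dicing forces the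
  other two to behave like v.\<close>

lemma maj_iff:
  assumes j: "j < m" and u: "u \<in> A" and v: "v \<in> A" "lab v = l j" "part u \<noteq> part v"
  shows "maj E s j u \<longleftrightarrow> E u v"
proof -
  have e: "E u (s (3 * j + i)) \<longleftrightarrow> E u v" if "i < 3" "part (s (3 * j + i)) \<noteq> part u" for i
    using s[OF j that(1)] that(2) u v by (intro dicesD[OF d]) auto
  have "part (s (3 * j)) \<noteq> part (s (3 * j + 1))" "part (s (3 * j)) \<noteq> part (s (3 * j + 2))"
    "part (s (3 * j + 1)) \<noteq> part (s (3 * j + 2))"
    using far[OF j, of 0 1] far[OF j, of 0 2] far[OF j, of 1 2] by auto
  then consider "part (s (3 * j)) \<noteq> part u" "part (s (3 * j + 1)) \<noteq> part u"
    | "part (s (3 * j)) \<noteq> part u" "part (s (3 * j + 2)) \<noteq> part u"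
    | "part (s (3 * j + 1)) \<noteq> part u" "part (s (3 * j + 2)) \<noteq> part u" by metis
  then show ?thesis
    by cases (use e[of 0] e[of 1] e[of 2] in \<open>auto simp: maj_def\<close>)
qed

lemma ex_far:
  assumes j: "j < m"
  shows "\<exists>i<3. part (s (3 * j + i)) \<noteq> p \<and> part (s (3 * j + i)) \<noteq> q"
proof -
  have "part (s (3 * j + 0)) \<noteq> part (s (3 * j + 1))" "part (s (3 * j + 0)) \<noteq> part (s (3 * j + 2))"
    "part (s (3 * j + 1)) \<noteq> part (s (3 * j + 2))"
    using far[OF j, of 0 1] far[OF j, of 0 2] far[OF j, of 1 2] by auto
  moreover have "(0::nat) < 3" "(1::nat) < 3" "(2::nat) < 3" by auto
  ultimately show ?thesis by metis
qed

text \<open>Three parts leave a representative outside the parts of both u and u', and there the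
  dicing compares them directly.\<close>

lemma maj_lab:
  assumes j: "j < m" and u: "u \<in> A" "u' \<in> A" "lab u = lab u'"
  shows "maj E s j u \<longleftrightarrow> maj E s j u'"
proof -
  obtain i where i: "i < 3" "part (s (3 * j + i)) \<noteq> part u" "part (s (3 * j + i)) \<noteq> part u'"
    using ex_far[OF j] by blast
  have x: "s (3 * j + i) \<in> A" "lab (s (3 * j + i)) = l j" using s[OF j i(1)] by auto
  have "maj E s j u \<longleftrightarrow> E u (s (3 * j + i))" "maj E s j u' \<longleftrightarrow> E u' (s (3 * j + i))"
    using maj_iff[OF j _ x] u i by metis+
  moreover have "E u (s (3 * j + i)) \<longleftrightarrow> E u' (s (3 * j + i))"
    using i u x by (intro dicesD[OF d]) auto
  ultimately show ?thesis by simp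
qed

lemma agree_lab: "u \<in> A \<Longrightarrow> u' \<in> A \<Longrightarrow> lab u = lab u' \<Longrightarrow> agree E m s u u'"
  unfolding agree_def using maj_lab by blast

lemma outside_agree: "v \<in> A \<Longrightarrow> lab v = l j \<Longrightarrow> j < m \<Longrightarrow> agree E m s v (s (3 * j))"
  using agree_lab s0 by metis

lemma nongeneric_X: "w \<in> A \<Longrightarrow> \<not> generic E m s w \<Longrightarrow> w \<in> X"
  using outside_lab[of w] outside_agree[of w] unfolding generic_def by blast

text \<open>The agreement class of w consists of nongeneric vertices and hence lies in X, away from
  the part of v. So v sees the whole class alike, as given by a single majority value.\<close>

lemma full_iff:
  assumes v: "v \<in> A - X" "lab v = l j" "j < m" and w: "w \<in> A" "\<not> generic E m s w"
  shows "full E A m s v w \<longleftrightarrow> maj E s j w"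
proof -
  have "E v x \<longleftrightarrow> maj E s j w" if x: "x \<in> A" "agree E m s x w" for x
  proof -
    have "x \<in> X" using nongeneric_X x w agree_cong(1) by metis
    then have "part x \<noteq> part v" using X_part[of v x] v(1) by auto
    then have "maj E s j x \<longleftrightarrow> E x v" using v x by (intro maj_iff) auto
    then show ?thesis using x v sym_on_setD[OF sym, of v x] unfolding agree_def by blast
  qed
  moreover have "agree E m s w w" by (simp add: agree_def)
  ultimately show ?thesis unfolding full_def using w(1) by blast
qed

lemma outside_gtype:
  assumes "v \<in> A - X" "lab v = l j" "j < m"
  shows "gtype E A m s j v"
  unfolding gtype_def sim_def
proof (intro conjI ballI impI)
  show "agree E m s v (s (3 * j))" using assms outside_agree by blast
  fix w assume "w \<in> A" "\<not> generic E m s w"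
  then show "full E A m s v w \<longleftrightarrow> full E A m s (s (3 * j)) w"
    using full_iff[OF assms] full_iff[of "s (3 * j)" j w] s0[OF assms(3)] assms(3) by blast
qed

text \<open>Both sides are the adjacency that the dicing prescribes between the labels
  \<open>l i\<close> and \<open>l j\<close>, read from either end.\<close>

lemma maj_swap:
  assumes "i < m" "j < m"
  shows "maj E s i (s (3 * j)) \<longleftrightarrow> maj E s j (s (3 * i))"
proof -
  obtain a where a: "a < 3" "part (s (3 * i + a)) \<noteq> part (s (3 * j))"
    using ex_far[OF assms(1)] by blast
  note x = s[OF assms(1) a(1)]
  have "maj E s i (s (3 * j)) \<longleftrightarrow> E (s (3 * j)) (s (3 * i + a))"
    using a x s0[OF assms(2)] by (intro maj_iff[OF assms(1)]) auto
  also have "\<dots> \<longleftrightarrow> E (s (3 * i + a)) (s (3 * j))"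
    using x s0[OF assms(2)] sym_on_setD[OF sym] by blast
  also have "\<dots> \<longleftrightarrow> maj E s j (s (3 * i + a))"
    using a x s0[OF assms(2)] by (intro maj_iff[OF assms(2), symmetric]) auto
  also have "\<dots> \<longleftrightarrow> maj E s j (s (3 * i))"
    using x s0[OF assms(1)] by (intro maj_lab[OF assms(2)]) auto
  finally show ?thesis .
qed

text \<open>Different labels may fall into one \<open>sim\<close> class, so v may belong to a triple
  i besides the triple j of its own label. Then i and j must have the same majority at u. If u is
  generic, \<open>maj_swap\<close> shows this through a triple k with which u agrees; if u is not,
  it is exactly what the \<open>full\<close> clause of \<open>sim\<close> records.\<close>

lemma not_link:
  assumes u: "u \<in> A" and v: "v \<in> A - X" and p: "part u \<noteq> part v"
  shows "\<not> link E A m s u v"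
proof
  assume link: "link E A m s u v"
  obtain j where j: "j < m" "lab v = l j" using outside_lab[OF v] by blast
  have gv: "gtype E A m s j v" using outside_gtype[OF v j(2,1)] .
  have e: "maj E s j u \<longleftrightarrow> E u v" using maj_iff[OF j(1) u _ j(2) p] v by blast
  have "\<not> rare E A m s v" using gv j unfolding rare_def by blast
  then consider i where "i < m" "gtype E A m s i v" "E u v \<longleftrightarrow> \<not> maj E s i u"
    | i where "i < m" "gtype E A m s i u" "E u v \<longleftrightarrow> \<not> maj E s i v"
    using link unfolding link_def by blast
  then show False
  proof cases
    case 1
    have ss: "sim E A m s (s (3 * i)) (s (3 * j))"
      using gv 1(2) unfolding gtype_def sim_iff by simp
    have "maj E s i u \<longleftrightarrow> maj E s j u"
    proof (cases "generic E m s u")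
      case True
      then obtain k where k: "k < m" "agree E m s u (s (3 * k))" unfolding generic_def by blast
      have "maj E s i u \<longleftrightarrow> maj E s k (s (3 * i))"
        using k 1(1) maj_swap unfolding agree_def by blast
      also have "\<dots> \<longleftrightarrow> maj E s k (s (3 * j))" using sim_maj[OF ss k(1)] .
      also have "\<dots> \<longleftrightarrow> maj E s j u"
        using k j(1) maj_swap unfolding agree_def by blast
      finally show ?thesis .
    next
      case False
      have "full E A m s (s (3 * i)) u \<longleftrightarrow> maj E s i u" "full E A m s (s (3 * j)) u \<longleftrightarrow> maj E s j u"
        using full_iff[of "s (3 * i)" i u] full_iff[of "s (3 * j)" j u] s0[OF 1(1)] s0[OF j(1)] 1(1) j(1) False u
        by blast+
      then show ?thesis using ss False u unfolding sim_def by blast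
    qed
    then show False using 1(3) e by blast
  next
    case 2
    have "maj E s j u \<longleftrightarrow> maj E s j (s (3 * i))"
      using 2(2) j(1) unfolding gtype_def by (rule sim_maj)
    also have "\<dots> \<longleftrightarrow> maj E s i (s (3 * j))" using maj_swap 2(1) j(1) by blast
    also have "\<dots> \<longleftrightarrow> maj E s i v" using outside_agree[of v j] v j 2(1) unfolding agree_def by blast
    finally show False using 2(3) e by blast
  qed
qed

lemma link_part:
  assumes "u \<in> A" "v \<in> A" "link E A m s u v"
  shows "part u = part v \<or> u \<in> X \<and> v \<in> X"
proof (rule ccontr)
  assume *: "\<not> ?thesis"
  have "link E A m s v u" using sym_on_setD[OF sym_link[OF sym] assms(1,2)] assms(3) by blast
  then show False using not_link[of u v] not_link[of v u] assms * by auto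
qed

lemma reach_part:
  assumes "u \<in> A" "v \<in> A" "reach (link E A m s) A t u v"
  shows "part u = part v \<or> u \<in> X \<and> v \<in> X"
  using assms(2,3)
proof (induction t arbitrary: v)
  case (Suc t)
  then obtain w where w: "w \<in> A" "reach (link E A m s) A t u w" "w = v \<or> link E A m s w v" by auto
  have *: "part u = part w \<or> u \<in> X \<and> w \<in> X" using Suc.IH w by blast
  show ?case
  proof (cases "w = v")
    case False
    then have "part w = part v \<or> w \<in> X \<and> v \<in> X" using w link_part Suc.prems(1) by blast
    then show ?thesis using * X_part[of u w] X_part[of v w] assms(1) Suc.prems(1) by auto
  qed (use * in simp)
qed simp

end

text \<open>The combinatorial counterpart of \<open>config\<close>; one number k bounds both the
  walks and the labels used inside the components.\<close>

definition shrub_config :: "nat \<Rightarrow> nat \<Rightarrow> nat \<Rightarrow> ('a \<Rightarrow> 'a \<Rightarrow> bool) \<Rightarrow> 'a set \<Rightarrow> (nat \<Rightarrow> 'a) \<Rightarrow> bool" where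
  "shrub_config n k m E A s \<longleftrightarrow> (\<forall>r<3 * m. s r \<in> A) \<and> stable (link E A m s) A k \<and>
     (\<forall>a\<in>A. shrub (Suc n) k E (cell (link E A m s) A k a))"

lemma shrub_config_mono:
  assumes "shrub_config n k m E A s" "k \<le> k'"
  shows "shrub_config n k' m E A s"
proof -
  have st: "stable (link E A m s) A k" using assms(1) by (simp add: shrub_config_def)
  have "shrub (Suc n) k' E (cell (link E A m s) A k' a)" if "a \<in> A" for a
    using assms(1) that shrub_mono[OF _ assms(2)] cell_mono[OF st assms(2) that] unfolding shrub_config_def by metis
  then show ?thesis using assms(1) stable_mono[OF st assms(2)] unfolding shrub_config_def by blast
qed

lemma obtain_three:
  assumes "3 \<le> card P"
  obtains f :: "nat \<Rightarrow> 'p" where "\<And>i. i < 3 \<Longrightarrow> f i \<in> P" "\<And>i j. i < 3 \<Longrightarrow> j < 3 \<Longrightarrow> i \<noteq> j \<Longrightarrow> f i \<noteq> f j"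
proof -
  obtain T where T: "T \<subseteq> P" "card T = 3" using obtain_subset_with_card_n[OF assms] by blast
  then have "finite T" using card.infinite by fastforce
  then obtain f where "bij_betw f {0..<card T} T" using ex_bij_betw_nat_finite by blast
  then have f: "inj_on f {0..<3}" "f ` {0..<3} = T" using T(2) by (simp_all add: bij_betw_def)
  show ?thesis
  proof (rule that[of f])
    show "f i \<in> P" if "i < 3" for i using f(2) T(1) that by auto
    show "f i \<noteq> f j" if "i < 3" "j < 3" "i \<noteq> j" for i j using inj_onD[OF f(1), of i j] that by auto
  qed
qed

text \<open>Each label outside S meets at most M parts, so X consists of at most
  \<open>K * M\<close> parts. A label in S that meets \<open>3 + K * M\<close> parts still has three
  of them outside X for its triple. The three summands of the bound serve the components inside X,
  which is flattened, the components inside single parts, and the stability of the flip.\<close>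

lemma shrub_config_spread:
  fixes lab :: "'a \<Rightarrow> 'l" and part :: "'a \<Rightarrow> 'p"
  assumes fin: "finite A" and sym: "sym_on_set E A" and d: "dices E A lab part" and K: "card (lab ` A) \<le> K"
    and sh: "\<And>a. a \<in> A \<Longrightarrow> shrub (Suc n) k E {b \<in> A. part b = part a}"
    and S: "finite S" "card S \<le> m"
    and M: "\<And>a. a \<in> A \<Longrightarrow> lab a \<notin> S \<Longrightarrow> card (part ` {b \<in> A. lab b = lab a}) \<le> M"
    and big: "\<And>x. x \<in> S \<Longrightarrow> 3 + K * M \<le> card (part ` {b \<in> A. lab b = x})"
  shows "\<exists>s. shrub_config n (K * M * K * k + k + path_bound (Suc (Suc n)) ((K + k) * simcount m)) (card S) E A s"
proof -
  define X where "X = {v \<in> A. \<exists>u\<in>A. part u = part v \<and> lab u \<notin> S}"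
  have finX: "finite X" using fin by (auto simp: X_def)
  have "part ` X \<subseteq> (\<Union>x\<in>lab ` A - S. part ` {b \<in> A. lab b = x})"
  proof
    fix p assume "p \<in> part ` X"
    then obtain u where "u \<in> A" "part u = p" "lab u \<notin> S" unfolding X_def by auto
    then show "p \<in> (\<Union>x\<in>lab ` A - S. part ` {b \<in> A. lab b = x})" by blast
  qed
  then have "card (part ` X) \<le> card (\<Union>x\<in>lab ` A - S. part ` {b \<in> A. lab b = x})"
    using fin by (intro card_mono) auto
  also have "\<dots> \<le> (\<Sum>x\<in>lab ` A - S. card (part ` {b \<in> A. lab b = x}))"
    using fin by (intro card_UN_le) auto
  also have "\<dots> \<le> (\<Sum>x\<in>lab ` A - S. M)" using M by (intro sum_mono) auto
  also have "\<dots> \<le> K * M"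
  proof -
    have "card (lab ` A - S) \<le> K" using K card_mono[of "lab ` A" "lab ` A - S"] fin by auto
    then show ?thesis by simp
  qed
  finally have cX: "card (part ` X) \<le> K * M" .
  have "\<exists>f :: nat \<Rightarrow> 'a. (\<forall>i<3. f i \<in> A - X \<and> lab (f i) = x) \<and> (\<forall>i<3. \<forall>j<3. i \<noteq> j \<longrightarrow> part (f i) \<noteq> part (f j))"
    if x: "x \<in> S" for x
  proof -
    have "card (part ` {b \<in> A. lab b = x}) \<le> card (part ` {b \<in> A. lab b = x} - part ` X) + card (part ` X)"
      using diff_card_le_card_Diff[of "part ` X" "part ` {b \<in> A. lab b = x}"] finX by auto
    then have three: "3 \<le> card (part ` {b \<in> A. lab b = x} - part ` X)" using big[OF x] cX by linarith
    obtain g :: "nat \<Rightarrow> 'p" where g: "\<And>i. i < 3 \<Longrightarrow> g i \<in> part ` {b \<in> A. lab b = x} - part ` X"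
      "\<And>i j. i < 3 \<Longrightarrow> j < 3 \<Longrightarrow> i \<noteq> j \<Longrightarrow> g i \<noteq> g j"
      by (rule obtain_three[OF three]) (rule that)
    have "\<forall>i. \<exists>b. i < 3 \<longrightarrow> b \<in> A - X \<and> lab b = x \<and> part b = g i"
    proof
      fix i
      show "\<exists>b. i < 3 \<longrightarrow> b \<in> A - X \<and> lab b = x \<and> part b = g i"
      proof (cases "i < 3")
        case True
        from g(1)[OF True] obtain b where "b \<in> A" "lab b = x" "g i = part b" by auto
        moreover from this have "b \<notin> X" using g(1)[OF True] by auto
        ultimately have "b \<in> A - X \<and> lab b = x \<and> part b = g i" by simp
        then show ?thesis by (intro exI[of _ b] impI)
      qed simp
    qed
    then obtain f where "\<forall>i. i < 3 \<longrightarrow> f i \<in> A - X \<and> lab (f i) = x \<and> part (f i) = g i"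
      unfolding choice_iff by blast
    then show ?thesis using g(2) by (intro exI[of _ f]) auto
  qed
  then have "\<forall>x. \<exists>f :: nat \<Rightarrow> 'a. x \<in> S \<longrightarrow> (\<forall>i<3. f i \<in> A - X \<and> lab (f i) = x) \<and>
      (\<forall>i<3. \<forall>j<3. i \<noteq> j \<longrightarrow> part (f i) \<noteq> part (f j))" by blast
  then obtain f :: "'l \<Rightarrow> nat \<Rightarrow> 'a" where f: "\<forall>x. x \<in> S \<longrightarrow> (\<forall>i<3. f x i \<in> A - X \<and> lab (f x i) = x) \<and>
      (\<forall>i<3. \<forall>j<3. i \<noteq> j \<longrightarrow> part (f x i) \<noteq> part (f x j))" unfolding choice_iff by blast
  define m0 where "m0 = card S"
  obtain l where l: "bij_betw l {..<m0} S"
    using ex_bij_betw_nat_finite[OF S(1)] unfolding m0_def atLeast0LessThan by blast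
  then have lS: "l ` {..<m0} = S" by (simp add: bij_betw_def)
  define s where "s r = f (l (r div 3)) (r mod 3)" for r
  have s: "s (3 * j + i) = f (l j) i" if "i < 3" for i j
    using that by (simp add: s_def)
  interpret spread E A lab part m0 l s X
  proof
    show "X = {v \<in> A. \<exists>u\<in>A. part u = part v \<and> lab u \<notin> l ` {..<m0}}" unfolding lS X_def ..
    fix j i assume ji: "j < m0" "i < (3::nat)"
    have "l j \<in> S" using lS ji(1) by auto
    then show "s (3 * j + i) \<in> A - X \<and> lab (s (3 * j + i)) = l j"
      using f ji s by auto
  next
    fix j i i' assume ji: "j < m0" "i < (3::nat)" "i' < (3::nat)" "i \<noteq> i'"
    have "l j \<in> S" using lS ji(1) by auto
    then show "part (s (3 * j + i)) \<noteq> part (s (3 * j + i'))"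
      using f ji s by auto
  qed fact+
  let ?F = "link E A m0 s"
  let ?k = "K * M * K * k + k + path_bound (Suc (Suc n)) ((K + k) * simcount m)"
  \<comment> \<open>Before the smaller components are known, the whole graph has n + 2 cuts, and so
    has its flip; this suffices to bound the walks.\<close>
  have "shrub (Suc (Suc n)) (K + k) E A"
  proof (rule shrub_SucI[OF fin d])
    show "card (lab ` A) \<le> K + k" using K by simp
    show "shrub (Suc n) (K + k) E {b \<in> A. part b = part a}" if "a \<in> A" for a
      using sh[OF that] by (rule shrub_mono) simp
  qed
  then have "shrub (Suc (Suc n)) ((K + k) * simcount m) ?F A"
  proof (rule shrub_relabel[where f = "simlab E A m0 s"])
    show "card (simlab E A m0 s ` A) \<le> simcount m"
      using card_simlab simcount_mono S(2) order_trans unfolding m0_def by blast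
    fix u v u' v' assume "simlab E A m0 s u = simlab E A m0 s u'" "simlab E A m0 s v = simlab E A m0 s v'" "E u v = E u' v'"
    then show "?F u v = ?F u' v'" by (intro link_cong) (simp_all add: sim_iff)
  qed (rule fin)
  then have st: "stable ?F A ?k"
    using shrub_stable[OF _ sym_link[OF sym]] stable_mono by (metis le_add2)
  have X: "shrub (Suc n) (K * M * K * k) E X"
  proof (rule shrub_flatten[OF finX])
    show "dices E X lab part" using dices_subset[OF d] X_def by auto
    show "card (lab ` X) \<le> K"
      using K card_mono[of "lab ` A" "lab ` X"] fin X_def by (auto intro: order_trans)
    show "card (part ` X) \<le> K * M" by (rule cX)
    fix a assume "a \<in> X"
    then show "shrub (Suc n) k E {b \<in> X. part b = part a}"
      using X_subset by (intro shrub_subset[OF sh[of a]]) auto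
  qed
  have "shrub (Suc n) ?k E (cell ?F A ?k a)" if a: "a \<in> A" for a
  proof (cases "a \<in> X")
    case True
    have "cell ?F A ?k a \<subseteq> X"
    proof
      fix b assume b: "b \<in> cell ?F A ?k a"
      then have "b \<in> A" by (simp add: cell_def)
      moreover have "part a = part b \<or> a \<in> X \<and> b \<in> X" using b reach_part[OF a, of b ?k] by (auto simp: cell_def)
      ultimately show "b \<in> X" using X_part[of b a] True by auto
    qed
    then have "shrub (Suc n) (K * M * K * k) E (cell ?F A ?k a)" by (rule shrub_subset[OF X])
    then show ?thesis by (rule shrub_mono) simp
  next
    case False
    have "cell ?F A ?k a \<subseteq> {b \<in> A. part b = part a}"
    proof
      fix b assume b: "b \<in> cell ?F A ?k a"
      then have "b \<in> A" by (simp add: cell_def)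
      moreover have "part a = part b" using b False reach_part[OF a, of b ?k] by (auto simp: cell_def)
      ultimately show "b \<in> {b \<in> A. part b = part a}" by simp
    qed
    then have "shrub (Suc n) k E (cell ?F A ?k a)" by (rule shrub_subset[OF sh[OF a]])
    then show ?thesis by (rule shrub_mono) simp
  qed
  moreover have "\<forall>r<3 * m0. s r \<in> A"
  proof (intro allI impI)
    fix r assume "r < 3 * m0"
    then have "r div 3 < m0" by (simp add: less_mult_imp_div_less mult.commute)
    then have "l (r div 3) \<in> S" using lS by auto
    then show "s r \<in> A" using f unfolding s_def by auto
  qed
  ultimately show ?thesis using st unfolding shrub_config_def m0_def by blast
qed

text \<open>S contains the candidates for triples. A candidate that meets too few parts is dropped
  and M is raised to cover it. At most m drops are possible, so the final bound does not depend on
  the graph.\<close>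

lemma shrub_config_exists:
  "\<exists>k'. \<forall>(E :: 'a \<Rightarrow> 'a \<Rightarrow> bool) A (lab :: 'a \<Rightarrow> 'l) (part :: 'a \<Rightarrow> 'p) S. finite A \<longrightarrow> sym_on_set E A \<longrightarrow>
     dices E A lab part \<longrightarrow> card (lab ` A) \<le> K \<longrightarrow> (\<forall>a\<in>A. shrub (Suc n) k E {b \<in> A. part b = part a}) \<longrightarrow>
     finite S \<longrightarrow> card S \<le> m \<longrightarrow> (\<forall>a\<in>A. lab a \<notin> S \<longrightarrow> card (part ` {b \<in> A. lab b = lab a}) \<le> M) \<longrightarrow>
     (\<exists>m'\<le>m. \<exists>s. shrub_config n k' m' E A s)"
proof (induction m arbitrary: M)
  case 0
  show ?case
  proof (rule exI[of _ "K * M * K * k + k + path_bound (Suc (Suc n)) ((K + k) * simcount 0)"], intro allI impI)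
    fix E :: "'a \<Rightarrow> 'a \<Rightarrow> bool" and A and lab :: "'a \<Rightarrow> 'l" and part :: "'a \<Rightarrow> 'p" and S
    assume h: "finite A" "sym_on_set E A" "dices E A lab part" "card (lab ` A) \<le> K"
      "\<forall>a\<in>A. shrub (Suc n) k E {b \<in> A. part b = part a}" "finite S" "card S \<le> 0"
      "\<forall>a\<in>A. lab a \<notin> S \<longrightarrow> card (part ` {b \<in> A. lab b = lab a}) \<le> M"
    have "S = {}" using h(6,7) by simp
    then have "\<exists>s. shrub_config n (K * M * K * k + k + path_bound (Suc (Suc n)) ((K + k) * simcount 0)) (card S) E A s"
      using h by (intro shrub_config_spread[where lab = lab and part = part]) auto
    then show "\<exists>m'\<le>0. \<exists>s. shrub_config n (K * M * K * k + k + path_bound (Suc (Suc n)) ((K + k) * simcount 0)) m' E A s"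
      using h(7) by blast
  qed
next
  case (Suc m)
  obtain k' where k': "\<forall>(E :: 'a \<Rightarrow> 'a \<Rightarrow> bool) A (lab :: 'a \<Rightarrow> 'l) (part :: 'a \<Rightarrow> 'p) S. finite A \<longrightarrow> sym_on_set E A \<longrightarrow>
     dices E A lab part \<longrightarrow> card (lab ` A) \<le> K \<longrightarrow> (\<forall>a\<in>A. shrub (Suc n) k E {b \<in> A. part b = part a}) \<longrightarrow>
     finite S \<longrightarrow> card S \<le> m \<longrightarrow> (\<forall>a\<in>A. lab a \<notin> S \<longrightarrow> card (part ` {b \<in> A. lab b = lab a}) \<le> M + 3 + K * M) \<longrightarrow>
     (\<exists>m'\<le>m. \<exists>s. shrub_config n k' m' E A s)" using Suc.IH by blast
  let ?k = "K * M * K * k + k + path_bound (Suc (Suc n)) ((K + k) * simcount (Suc m))"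
  show ?case
  proof (rule exI[of _ "k' + ?k"], intro allI impI)
    fix E :: "'a \<Rightarrow> 'a \<Rightarrow> bool" and A and lab :: "'a \<Rightarrow> 'l" and part :: "'a \<Rightarrow> 'p" and S
    assume h: "finite A" "sym_on_set E A" "dices E A lab part" "card (lab ` A) \<le> K"
      "\<forall>a\<in>A. shrub (Suc n) k E {b \<in> A. part b = part a}" "finite S" "card S \<le> Suc m"
      "\<forall>a\<in>A. lab a \<notin> S \<longrightarrow> card (part ` {b \<in> A. lab b = lab a}) \<le> M"
    show "\<exists>m'\<le>Suc m. \<exists>s. shrub_config n (k' + ?k) m' E A s"
    proof (cases "\<forall>x\<in>S. 3 + K * M \<le> card (part ` {b \<in> A. lab b = x})")
      case True
      then have "\<exists>s. shrub_config n ?k (card S) E A s"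
        using h by (intro shrub_config_spread[where lab = lab and part = part]) auto
      then show ?thesis using h(7) shrub_config_mono[of n ?k _ E A _ "k' + ?k"] le_add2 by blast
    next
      case False
      then obtain x where x: "x \<in> S" "card (part ` {b \<in> A. lab b = x}) < 3 + K * M" by auto
      have "card (part ` {b \<in> A. lab b = lab a}) \<le> M + 3 + K * M" if "a \<in> A" "lab a \<notin> S - {x}" for a
      proof (cases "lab a = x")
        case True
        then show ?thesis using x by simp
      next
        case False
        then have "card (part ` {b \<in> A. lab b = lab a}) \<le> M" using h(8) that by blast
        then show ?thesis by simp
      qed
      moreover have "finite (S - {x})" "card (S - {x}) \<le> m" using h(6,7) x(1) by auto
      ultimately have "\<exists>m'\<le>m. \<exists>s. shrub_config n k' m' E A s" using k' h(1-5) by blast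
      then show ?thesis using shrub_config_mono[of n k' _ E A _ "k' + ?k"] le_add1 le_SucI by blast
    qed
  qed
qed

lemma shrub_config_imp_config:
  assumes t: "\<forall>(E :: 'a \<Rightarrow> 'a \<Rightarrow> bool) A. finite A \<longrightarrow> sym_on_set E A \<longrightarrow> A \<noteq> {} \<longrightarrow> shrub (Suc n) k E A \<longrightarrow> layered n t E A"
    and c: "shrub_config n k m E A s" and fin: "finite A" and sym: "sym_on_set E (A :: 'a set)"
  shows "config n (k + t) m E A s"
  unfolding config_def
proof (intro conjI ballI)
  have st: "stable (link E A m s) A k" using c by (simp add: shrub_config_def)
  then show "stable (link E A m s) A (k + t)" by (rule stable_mono) simp
  show "\<forall>r<3 * m. s r \<in> A" using c by (simp add: shrub_config_def)
  fix a assume a: "a \<in> A"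
  let ?C = "cell (link E A m s) A k a"
  have "shrub (Suc n) k E ?C" using c a by (simp add: shrub_config_def del: shrub.simps)
  moreover have ne: "?C \<noteq> {}" using cell_self[OF a, of "link E A m s" k] by blast
  ultimately have "layered n t E ?C"
    by (intro t[rule_format] finite_subset[OF cell_subset fin] sym_on_set_subset[OF sym cell_subset])
  then have "layered n (k + t) E ?C" by (rule layered_mono[of n t]) (use ne in simp_all)
  then show "layered n (k + t) E (cell (link E A m s) A (k + t) a)" using cell_mono[OF st _ a, of "k + t"] by simp
qed

lemma shrub_0_layered:
  assumes "A \<noteq> {}" "shrub (Suc 0) k E A"
  shows "layered 0 k E A"
proof -
  obtain lab part :: "'a \<Rightarrow> nat" where l: "lab ` A \<subseteq> {..<k}" and d: "dices E A lab part"
    and p: "\<And>p. shrub 0 k E {a \<in> A. part a = p}" using assms(2) unfolding shrub.simps(2)[of 0] by blast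
  have ne: "part u \<noteq> part v" if "u \<in> A" "v \<in> A" "u \<noteq> v" for u v
  proof
    assume "part u = part v"
    then have "u = v"
      by (intro bspec[OF bspec[OF p[of "part u", unfolded shrub.simps]]]) (use that in simp_all)
    then show False using that by simp
  qed
  \<comment> \<open>Every entry has to be a vertex of A, so a number that is not a label is given an
    arbitrary one. The parts being singletons, equal labels mean twins.\<close>
  define s where "s i = (SOME a. a \<in> A \<and> (i \<in> lab ` A \<longrightarrow> lab a = i))" for i
  have s: "s i \<in> A \<and> (i \<in> lab ` A \<longrightarrow> lab (s i) = i)" for i
    unfolding s_def by (rule someI_ex) (use assms(1) in blast)
  have "twin E A u (s (lab u))" if u: "u \<in> A" for u
    unfolding twin_def
  proof (intro ballI impI)
    fix w assume w: "w \<in> A" "w \<noteq> u" "w \<noteq> s (lab u)"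
    show "E u w = E (s (lab u)) w"
    proof (rule dicesD[OF d])
      show "part u \<noteq> part w" "part (s (lab u)) \<noteq> part w" using ne u w s by metis+
      show "lab u = lab (s (lab u))" using s u by simp
    qed (use u w s in simp_all)
  qed
  moreover have "lab u < k" if "u \<in> A" for u using l that by auto
  ultimately show ?thesis using s unfolding layered.simps by blast
qed

lemma shrub_layered:
  "\<exists>t. \<forall>(E :: 'a \<Rightarrow> 'a \<Rightarrow> bool) A. finite A \<longrightarrow> sym_on_set E A \<longrightarrow> A \<noteq> {} \<longrightarrow> shrub (Suc n) k E A \<longrightarrow> layered n t E A"
proof (induction n arbitrary: k)
  case 0
  show ?case
    by (rule exI[of _ k], intro allI impI) (rule shrub_0_layered)
next
  case (Suc n)
  obtain k' where k': "\<forall>(E :: 'a \<Rightarrow> 'a \<Rightarrow> bool) A (lab :: 'a \<Rightarrow> nat) (part :: 'a \<Rightarrow> nat) S. finite A \<longrightarrow> sym_on_set E A \<longrightarrow>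
     dices E A lab part \<longrightarrow> card (lab ` A) \<le> k \<longrightarrow> (\<forall>a\<in>A. shrub (Suc n) k E {b \<in> A. part b = part a}) \<longrightarrow>
     finite S \<longrightarrow> card S \<le> k \<longrightarrow> (\<forall>a\<in>A. lab a \<notin> S \<longrightarrow> card (part ` {b \<in> A. lab b = lab a}) \<le> 0) \<longrightarrow>
     (\<exists>m'\<le>k. \<exists>s. shrub_config n k' m' E A s)" using shrub_config_exists by blast
  obtain t where t: "\<forall>(E :: 'a \<Rightarrow> 'a \<Rightarrow> bool) A. finite A \<longrightarrow> sym_on_set E A \<longrightarrow> A \<noteq> {} \<longrightarrow> shrub (Suc n) k' E A \<longrightarrow> layered n t E A"
    using Suc.IH by blast
  show ?case
  proof (rule exI[of _ "k + (k' + t)"], intro allI impI)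
    fix E :: "'a \<Rightarrow> 'a \<Rightarrow> bool" and A
    assume h: "finite A" "sym_on_set E A" "A \<noteq> {}" "shrub (Suc (Suc n)) k E A"
    then obtain lab part :: "'a \<Rightarrow> nat" where l: "lab ` A \<subseteq> {..<k}" and d: "dices E A lab part"
      and p: "\<And>p. shrub (Suc n) k E {a \<in> A. part a = p}" unfolding shrub.simps(2)[of "Suc n"] by blast
    have "card (lab ` A) \<le> k" using card_mono[OF _ l] by simp
    \<comment> \<open>All labels start as candidates. The condition on the other labels is then
      vacuous, which allows M = 0.\<close>
    then obtain m s where ms: "m \<le> k" "shrub_config n k' m E A s"
      using k'[rule_format, OF h(1,2) d _ p, of "lab ` A"] h(1) by blast
    have "config n (k' + t) m E A s" using shrub_config_imp_config[OF t ms(2) h(1,2)] .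
    then have "config n (k + (k' + t)) m E A s" by (rule config_mono) simp
    then show "layered (Suc n) (k + (k' + t)) E A" using ms(1) unfolding layered_Suc_config by (intro exI[of _ m]) auto
  qed
qed

section \<open>Canonical configurations\<close>

text \<open>Equal majority functions transfer \<open>agree\<close>; the shared vertex pins down
  which label class each triple stands for.\<close>

definition matching :: "('a \<Rightarrow> 'a \<Rightarrow> bool) \<Rightarrow> 'a set \<Rightarrow> nat \<Rightarrow> (nat \<Rightarrow> 'a) \<Rightarrow> (nat \<Rightarrow> 'a) \<Rightarrow> nat \<Rightarrow> nat \<Rightarrow> bool" where
  "matching E A m s s' j j' \<longleftrightarrow> (\<forall>u\<in>A. maj E s j u \<longleftrightarrow> maj E s' j' u) \<and>
     (\<exists>v\<in>A. gtype E A m s j v \<and> gtype E A m s' j' v)"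

lemma matching_sym: "matching E A m s s' j j' \<Longrightarrow> matching E A m s' s j' j"
  unfolding matching_def by blast

text \<open>Labels and links depend on the triples only through their majority functions and
  classes, without order or multiplicity. Hence a relation that is total on both sides suffices, and
  no bijection is required.\<close>

locale matched =
  fixes E :: "'a \<Rightarrow> 'a \<Rightarrow> bool" and A :: "'a set" and m :: nat and s s' :: "nat \<Rightarrow> 'a"
  assumes left: "\<And>j. j < m \<Longrightarrow> \<exists>j'<m. matching E A m s s' j j'"
    and right: "\<And>j'. j' < m \<Longrightarrow> \<exists>j<m. matching E A m s s' j j'"
    and s_A: "\<And>j. j < m \<Longrightarrow> s (3 * j) \<in> A" "\<And>j. j < m \<Longrightarrow> s' (3 * j) \<in> A"
begin

lemma agree_eq:
  assumes "u \<in> A" "v \<in> A"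
  shows "agree E m s u v \<longleftrightarrow> agree E m s' u v"
proof
  assume h: "agree E m s u v"
  show "agree E m s' u v"
    unfolding agree_def
  proof (intro allI impI)
    fix j' assume "j' < m"
    then obtain j where "j < m" "matching E A m s s' j j'" using right by blast
    then show "maj E s' j' u \<longleftrightarrow> maj E s' j' v" using h assms unfolding agree_def matching_def by metis
  qed
next
  assume h: "agree E m s' u v"
  show "agree E m s u v"
    unfolding agree_def
  proof (intro allI impI)
    fix j assume "j < m"
    then obtain j' where "j' < m" "matching E A m s s' j j'" using left by blast
    then show "maj E s j u \<longleftrightarrow> maj E s j v" using h assms unfolding agree_def matching_def by metis
  qed
qed

lemma generic_eq:
  assumes "w \<in> A"
  shows "generic E m s w \<longleftrightarrow> generic E m s' w"
proof
  assume "generic E m s w"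
  then obtain j where j: "j < m" "agree E m s w (s (3 * j))" unfolding generic_def by blast
  obtain j' v where j': "j' < m" "v \<in> A" "gtype E A m s j v" "gtype E A m s' j' v"
    using left[OF j(1)] unfolding matching_def by blast
  have "agree E m s w v" using j(2) sim_agree[OF j'(3)[unfolded gtype_def]] by (simp add: agree_iff)
  then have "agree E m s' w v" using agree_eq assms j'(2) by blast
  then have "agree E m s' w (s' (3 * j'))" using sim_agree[OF j'(4)[unfolded gtype_def]] by (simp add: agree_iff)
  then show "generic E m s' w" using j'(1) unfolding generic_def by blast
next
  assume "generic E m s' w"
  then obtain j' where j': "j' < m" "agree E m s' w (s' (3 * j'))" unfolding generic_def by blast
  obtain j v where j: "j < m" "v \<in> A" "gtype E A m s j v" "gtype E A m s' j' v"
    using right[OF j'(1)] unfolding matching_def by blast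
  have "agree E m s' w v" using j'(2) sim_agree[OF j(4)[unfolded gtype_def]] by (simp add: agree_iff)
  then have "agree E m s w v" using agree_eq assms j(2) by blast
  then have "agree E m s w (s (3 * j))" using sim_agree[OF j(3)[unfolded gtype_def]] by (simp add: agree_iff)
  then show "generic E m s w" using j(1) unfolding generic_def by blast
qed

lemma full_eq: "w \<in> A \<Longrightarrow> full E A m s u w \<longleftrightarrow> full E A m s' u w"
  unfolding full_def using agree_eq by blast

lemma sim_eq: "u \<in> A \<Longrightarrow> v \<in> A \<Longrightarrow> sim E A m s u v \<longleftrightarrow> sim E A m s' u v"
  unfolding sim_def using agree_eq generic_eq full_eq by blast

lemma gtype_eq:
  assumes "matching E A m s s' j j'" "u \<in> A"
  shows "gtype E A m s j u \<longleftrightarrow> gtype E A m s' j' u"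
proof -
  obtain v where v: "v \<in> A" "gtype E A m s j v" "gtype E A m s' j' v"
    using assms(1) unfolding matching_def by blast
  have "gtype E A m s j u \<longleftrightarrow> sim E A m s u v" using v(2) unfolding gtype_def sim_iff by simp
  moreover have "gtype E A m s' j' u \<longleftrightarrow> sim E A m s' u v" using v(3) unfolding gtype_def sim_iff by simp
  ultimately show ?thesis using sim_eq assms(2) v(1) by blast
qed

lemma rare_eq: "u \<in> A \<Longrightarrow> rare E A m s u \<longleftrightarrow> rare E A m s' u"
  unfolding rare_def using gtype_eq left right by metis

lemma ex_group_eq:
  assumes "u \<in> A" "v \<in> A"
  shows "(\<exists>j<m. gtype E A m s j v \<and> (E x y \<longleftrightarrow> \<not> maj E s j u)) \<longleftrightarrow>
    (\<exists>j<m. gtype E A m s' j v \<and> (E x y \<longleftrightarrow> \<not> maj E s' j u))"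
proof
  assume "\<exists>j<m. gtype E A m s j v \<and> (E x y \<longleftrightarrow> \<not> maj E s j u)"
  then obtain j where j: "j < m" "gtype E A m s j v" "E x y \<longleftrightarrow> \<not> maj E s j u" by blast
  obtain j' where j': "j' < m" "matching E A m s s' j j'" using left[OF j(1)] by blast
  have "gtype E A m s' j' v" using gtype_eq[OF j'(2) assms(2)] j(2) by blast
  moreover have "maj E s j u \<longleftrightarrow> maj E s' j' u" using j'(2) assms(1) unfolding matching_def by blast
  ultimately show "\<exists>j<m. gtype E A m s' j v \<and> (E x y \<longleftrightarrow> \<not> maj E s' j u)" using j(3) j'(1) by blast
next
  assume "\<exists>j<m. gtype E A m s' j v \<and> (E x y \<longleftrightarrow> \<not> maj E s' j u)"
  then obtain j' where j': "j' < m" "gtype E A m s' j' v" "E x y \<longleftrightarrow> \<not> maj E s' j' u" by blast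
  obtain j where j: "j < m" "matching E A m s s' j j'" using right[OF j'(1)] by blast
  have "gtype E A m s j v" using gtype_eq[OF j(2) assms(2)] j'(2) by blast
  moreover have "maj E s j u \<longleftrightarrow> maj E s' j' u" using j(2) assms(1) unfolding matching_def by blast
  ultimately show "\<exists>j<m. gtype E A m s j v \<and> (E x y \<longleftrightarrow> \<not> maj E s j u)" using j'(3) j(1) by blast
qed

lemma link_eq:
  assumes "u \<in> A" "v \<in> A"
  shows "link E A m s u v \<longleftrightarrow> link E A m s' u v"
  unfolding link_def rare_eq[OF assms(1)] rare_eq[OF assms(2)] ex_group_eq[OF assms] ex_group_eq[OF assms(2,1)] ..

lemma reach_eq: "v \<in> A \<Longrightarrow> reach (link E A m s) A t u v \<longleftrightarrow> reach (link E A m s') A t u v"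
proof (induction t arbitrary: v)
  case (Suc t)
  then show ?case using link_eq by auto
qed simp

end

section \<open>Descent from an unmatched triple\<close>

lemma triple_matching:
  assumes st: "stable (link E A m s) A t" "stable (link E A m s') A t" and sym: "sym_on_set E A"
    and j: "j < m" "j' < m"
    and f: "\<And>i. i < 3 \<Longrightarrow> f i \<in> A \<and> gtype E A m s j (f i) \<and> gtype E A m s' j' (f i)"
    and ne: "\<And>i i'. i < 3 \<Longrightarrow> i' < 3 \<Longrightarrow> i \<noteq> i' \<Longrightarrow>
      cell (link E A m s) A t (f i) \<noteq> cell (link E A m s) A t (f i') \<and>
      cell (link E A m s') A t (f i) \<noteq> cell (link E A m s') A t (f (i' :: nat))"
  shows "matching E A m s s' j j'"
  unfolding matching_def
proof
  show "\<exists>v\<in>A. gtype E A m s j v \<and> gtype E A m s' j' v" using f[of 0] by auto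
  show "\<forall>u\<in>A. maj E s j u \<longleftrightarrow> maj E s' j' u"
  proof
    fix u assume u: "u \<in> A"
    let ?p = "cell (link E A m s) A t" and ?q = "cell (link E A m s') A t"
    \<comment> \<open>Each of the two partitions puts at most one of the three vertices into the
      cell of u, so one vertex avoids u in both. It is unlinked from u in both flips, and its
      adjacency to u equals both majorities.\<close>
    have "\<exists>i<3. ?p (f i) \<noteq> ?p u \<and> ?q (f i) \<noteq> ?q u"
    proof -
      have "?p (f 0) \<noteq> ?p (f 1)" "?p (f 0) \<noteq> ?p (f 2)" "?p (f 1) \<noteq> ?p (f 2)"
        "?q (f 0) \<noteq> ?q (f 1)" "?q (f 0) \<noteq> ?q (f 2)" "?q (f 1) \<noteq> ?q (f 2)"
        using ne[of 0 1] ne[of 0 2] ne[of 1 2] by auto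
      moreover have "(0::nat) < 3" "(1::nat) < 3" "(2::nat) < 3" by auto
      ultimately show ?thesis by metis
    qed
    then obtain i where i: "i < 3" "?p (f i) \<noteq> ?p u" "?q (f i) \<noteq> ?q u" by blast
    have fi: "f i \<in> A" "gtype E A m s j (f i)" "gtype E A m s' j' (f i)" using f[OF i(1)] by auto
    have "\<not> link E A m s u (f i)"
      using i(2) reach_link[OF st(1) u fi(1)] cell_eq_iff[OF st(1) sym_link[OF sym] u fi(1)] by metis
    moreover have "\<not> link E A m s' u (f i)"
      using i(3) reach_link[OF st(2) u fi(1)] cell_eq_iff[OF st(2) sym_link[OF sym] u fi(1)] by metis
    ultimately show "maj E s j u \<longleftrightarrow> maj E s' j' u"
      using gtype_maj j fi by metis
  qed
qed

text \<open>Take a maximal set of elements pairwise separated by both maps. It has at most two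
  members, and maximality says that it covers.\<close>

lemma two_cover:
  assumes "\<And>f :: nat \<Rightarrow> 'a. (\<And>i. i < 3 \<Longrightarrow> f i \<in> B) \<Longrightarrow>
    (\<And>i i'. i < 3 \<Longrightarrow> i' < 3 \<Longrightarrow> i \<noteq> i' \<Longrightarrow> p (f i) \<noteq> p (f i') \<and> q (f i) \<noteq> q (f i')) \<Longrightarrow> False"
  shows "\<exists>U\<subseteq>B. finite U \<and> card U \<le> 2 \<and> (\<forall>v\<in>B. \<exists>u\<in>U. p v = p u \<or> q v = q u)"
proof (cases "B = {}")
  case False
  then obtain x where x: "x \<in> B" by blast
  show ?thesis
  proof (cases "\<forall>v\<in>B. p v = p x \<or> q v = q x")
    case True
    then show ?thesis using x by (intro exI[of _ "{x}"]) auto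
  next
    case False
    then obtain y where y: "y \<in> B" "p y \<noteq> p x" "q y \<noteq> q x" by blast
    have "p v = p x \<or> q v = q x \<or> p v = p y \<or> q v = q y" if v: "v \<in> B" for v
    proof (rule ccontr)
      assume n: "\<not> ?thesis"
      let ?f = "\<lambda>i :: nat. if i = 0 then x else if i = 1 then y else v"
      show False
      proof (rule assms[of ?f])
        show "?f i \<in> B" for i using x y v by auto
        show "p (?f i) \<noteq> p (?f i') \<and> q (?f i) \<noteq> q (?f i')" if "i < 3" "i' < 3" "i \<noteq> i'" for i i'
          using that y n by auto
      qed
    qed
    then show ?thesis using x y by (intro exI[of _ "{x, y}"]) (auto simp: card_insert_if)
  qed
qed auto

lemma reach_crossing:
  assumes "u \<in> A" "v \<in> A" "reach F A t u v" "u \<in> Q" "v \<notin> Q"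
  shows "\<exists>x y t'. x \<in> A \<and> y \<in> A \<and> x \<in> Q \<and> y \<notin> Q \<and> F x y \<and> reach F A t' u x"
  using assms(2,3,5)
proof (induction t arbitrary: v)
  case 0
  then show ?case using assms(4) by simp
next
  case (Suc t)
  then obtain w where w: "w \<in> A" "reach F A t u w" "w = v \<or> F w v" by auto
  show ?case
  proof (cases "w \<in> Q")
    case True
    then show ?thesis using w Suc.prems by metis
  next
    case False
    then show ?thesis using Suc.IH w by blast
  qed
qed

text \<open>A first component that leaves the second cell Q contains a link from some x in Q to some
  y outside. Name the component by the labels of x and y in both labellings, whence the fourth
  power. If two components have the same name, the dicing into second cells shows that x1 sees y1
  and y2 alike; then x1 is linked to y2, and the components coincide.\<close>

lemma cut_cells:
  fixes E :: "'a \<Rightarrow> 'a \<Rightarrow> bool"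
  assumes st: "stable (link E A m s) A t" "stable (link E A m s') A t" and sym: "sym_on_set E A"
    and u0: "u0 \<in> A"
  shows "card {cell (link E A m s) A t v | v. v \<in> cell (link E A m s') A t u0 \<and>
      \<not> cell (link E A m s) A t v \<subseteq> cell (link E A m s') A t u0} \<le> simcount m ^ 4"
proof -
  let ?p = "cell (link E A m s) A t" and ?q = "cell (link E A m s') A t"
  let ?l = "simlab E A m s" and ?l' = "simlab E A m s'"
  let ?Q = "?q u0"
  let ?D = "{?p v | v. v \<in> ?Q \<and> \<not> ?p v \<subseteq> ?Q}"
  note sl = sym_link[OF sym, of m s] and sl' = sym_link[OF sym, of m s']
  note pe = cell_eq_iff[OF st(1) sl] and qe = cell_eq_iff[OF st(2) sl']
  have "\<forall>K. \<exists>xy. K \<in> ?D \<longrightarrow> fst xy \<in> A \<and> snd xy \<in> A \<and> fst xy \<in> ?Q \<and> snd xy \<notin> ?Q \<and>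
      link E A m s (fst xy) (snd xy) \<and> ?p (fst xy) = K"
  proof
    fix K
    show "\<exists>xy. K \<in> ?D \<longrightarrow> fst xy \<in> A \<and> snd xy \<in> A \<and> fst xy \<in> ?Q \<and> snd xy \<notin> ?Q \<and>
      link E A m s (fst xy) (snd xy) \<and> ?p (fst xy) = K"
    proof (cases "K \<in> ?D")
      case True
      then obtain v b where v: "K = ?p v" "v \<in> ?Q" "b \<in> ?p v" "b \<notin> ?Q" by auto
      have vA: "v \<in> A" and b: "b \<in> A" "reach (link E A m s) A t v b" using v by (auto simp: cell_def)
      obtain x y t' where xy: "x \<in> A" "y \<in> A" "x \<in> ?Q" "y \<notin> ?Q" "link E A m s x y" "reach (link E A m s) A t' v x"
        using reach_crossing[OF vA b v(2,4)] by blast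
      have "reach (link E A m s) A t v x"
        using reach_absorb[OF st(1) vA vA xy(1) reach_refl[OF vA] xy(6)] .
      then have "?p x = K" using pe[OF vA xy(1)] v(1) by simp
      then show ?thesis using xy by (intro exI[of _ "(x, y)"]) simp
    next
      case False
      then show ?thesis by blast
    qed
  qed
  then obtain f where "\<forall>K. K \<in> ?D \<longrightarrow> fst (f K) \<in> A \<and> snd (f K) \<in> A \<and> fst (f K) \<in> ?Q \<and> snd (f K) \<notin> ?Q \<and>
      link E A m s (fst (f K)) (snd (f K)) \<and> ?p (fst (f K)) = K" unfolding choice_iff by blast
  then have f: "fst (f K) \<in> A" "snd (f K) \<in> A" "fst (f K) \<in> ?Q" "snd (f K) \<notin> ?Q"
      "link E A m s (fst (f K)) (snd (f K))" "?p (fst (f K)) = K" if "K \<in> ?D" for K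
    using that by blast+
  define g where "g K = (?l (fst (f K)), ?l (snd (f K)), ?l' (fst (f K)), ?l' (snd (f K)))" for K
  have "inj_on g ?D"
  proof (rule inj_onI)
    fix K1 K2 assume K: "K1 \<in> ?D" "K2 \<in> ?D" and g: "g K1 = g K2"
    note f1 = f[OF K(1)] and f2 = f[OF K(2)]
    obtain x1 y1 x2 y2 where fe: "f K1 = (x1, y1)" "f K2 = (x2, y2)" by fastforce
    have qd: "?q x \<noteq> ?q y" if "x \<in> ?Q" "y \<notin> ?Q" "x \<in> A" "y \<in> A" for x y
    proof
      assume "?q x = ?q y"
      moreover have "?q x = ?Q" using that qe[OF u0 that(3)] by (simp add: cell_def)
      ultimately show False using that(2) cell_self[OF that(4)] by metis
    qed
    have "E x1 y1 \<longleftrightarrow> E x1 y2"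
    proof (rule dicesD[OF dices_cell[OF st(2) sym]])
      show "?q x1 \<noteq> ?q y1" "?q x1 \<noteq> ?q y2" using qd f1 f2 unfolding fe fst_conv snd_conv by blast+
      show "?l' y1 = ?l' y2" using g unfolding g_def fe by simp
    qed (use f1 f2 in \<open>simp_all add: fe\<close>)
    moreover have "?l y1 = ?l y2" using g unfolding g_def fe by simp
    ultimately have "link E A m s x1 y2"
      using link_cong[of E A m s x1 x1 y1 y2] f1(5) unfolding fe fst_conv snd_conv sim_iff by blast
    then have "?p x1 = ?p y2" using reach_link[OF st(1)] pe f1 f2 unfolding fe fst_conv snd_conv by blast
    moreover have "?p x2 = ?p y2" using reach_link[OF st(1)] pe f2 unfolding fe fst_conv snd_conv by blast
    ultimately show "K1 = K2" using f1(6) f2(6) unfolding fe by simp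
  qed
  moreover have "g ` ?D \<subseteq> ?l ` A \<times> ?l ` A \<times> ?l' ` A \<times> ?l' ` A"
    unfolding g_def using f by blast
  ultimately have "card ?D \<le> card (?l ` A \<times> ?l ` A \<times> ?l' ` A \<times> ?l' ` A)"
    by (rule card_inj_on_le) (auto simp: finite_simlab)
  also have "\<dots> \<le> simcount m * (simcount m * (simcount m * simcount m))"
    unfolding card_cartesian_product by (intro mult_le_mono card_simlab)
  also have "\<dots> = simcount m ^ 4" by (simp add: power4_eq_xxxx mult.assoc)
  finally show ?thesis .
qed

lemma dices_coarser:
  assumes "dices E A lab part" "\<And>u v. u \<in> A \<Longrightarrow> v \<in> A \<Longrightarrow> part u = part v \<Longrightarrow> part' u = part' v"
  shows "dices E A lab part'"
  unfolding dices_def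
proof (intro ballI impI)
  fix u v u' v' assume h: "u \<in> A" "v \<in> A" "u' \<in> A" "v' \<in> A" "part' u \<noteq> part' v" "part' u' \<noteq> part' v'"
    "lab u = lab u'" "lab v = lab v'"
  have "part u \<noteq> part v" "part u' \<noteq> part v'" using assms(2) h(1-6) by metis+
  then show "E u v = E u' v'" using dicesD[OF assms(1) h(1-4)] h(7,8) by blast
qed

lemma rare_cell:
  assumes st: "stable (link E A m s) A t" and sym: "sym_on_set E A" and "u \<in> A" "v \<in> A" "rare E A m s u" "rare E A m s v"
  shows "cell (link E A m s) A t u = cell (link E A m s) A t v"
proof -
  have "link E A m s u v" using assms(5,6) unfolding link_def by blast
  then show ?thesis using reach_link[OF st assms(3,4)] cell_eq_iff[OF st sym_link[OF sym] assms(3,4)] by blast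
qed

text \<open>Split the class of j by the labels of the second choice. Three vertices of one piece in
  different cells of both choices would match j to a triple of the second choice, unless their
  second label is rare; but rare vertices share a cell. So \<open>two_cover\<close> gives two
  vertices per label.\<close>

lemma unmatched_cover:
  assumes st: "stable (link E A m s) A t" "stable (link E A m s') A t" and sym: "sym_on_set E A"
    and j: "j < m" and un: "\<And>j'. j' < m \<Longrightarrow> \<not> matching E A m s s' j j'"
  shows "\<exists>U\<subseteq>{v \<in> A. gtype E A m s j v}. finite U \<and> card U \<le> 2 * simcount m \<and>
    (\<forall>v\<in>A. gtype E A m s j v \<longrightarrow> (\<exists>u\<in>U. cell (link E A m s) A t v = cell (link E A m s) A t u \<or>
       cell (link E A m s') A t v = cell (link E A m s') A t u))"
proof -
  let ?p = "cell (link E A m s) A t" and ?q = "cell (link E A m s') A t"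
  let ?C = "{v \<in> A. gtype E A m s j v}" and ?l' = "simlab E A m s'"
  have "\<exists>U\<subseteq>{v \<in> ?C. ?l' v = y}. finite U \<and> card U \<le> 2 \<and>
      (\<forall>v\<in>{v \<in> ?C. ?l' v = y}. \<exists>u\<in>U. ?p v = ?p u \<or> ?q v = ?q u)" (is "\<exists>U\<subseteq>?B. _") for y
  proof (rule two_cover)
    fix f :: "nat \<Rightarrow> 'a"
    assume fB: "\<And>i. i < 3 \<Longrightarrow> f i \<in> ?B"
      and ne: "\<And>i i'. i < 3 \<Longrightarrow> i' < 3 \<Longrightarrow> i \<noteq> i' \<Longrightarrow> ?p (f i) \<noteq> ?p (f i') \<and> ?q (f i) \<noteq> ?q (f i')"
    have gg: "gtype E A m s' j' (f i) = gtype E A m s' j' (f 0)" if "i < 3" for i j'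
      using fB[OF that] fB[of 0] unfolding gtype_def sim_iff by simp
    show False
    proof (cases "\<exists>j'<m. gtype E A m s' j' (f 0)")
      case True
      then obtain j' where j': "j' < m" "gtype E A m s' j' (f 0)" by blast
      have "matching E A m s s' j j'"
      proof (rule triple_matching[OF st sym j j'(1), of f])
        show "f i \<in> A \<and> gtype E A m s j (f i) \<and> gtype E A m s' j' (f i)" if "i < 3" for i
          using fB[OF that] gg[OF that, of j'] j'(2) by simp
      qed (rule ne)
      then show False using un j'(1) by blast
    next
      case False
      then have "rare E A m s' (f 0)" "rare E A m s' (f 1)" using gg[of 1] unfolding rare_def by auto
      then have "?q (f 0) = ?q (f 1)" using fB[of 0] fB[of 1] by (intro rare_cell[OF st(2) sym]) auto
      then show False using ne[of 0 1] by simp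
    qed
  qed
  then have "\<forall>y. \<exists>U. U \<subseteq> {v \<in> ?C. ?l' v = y} \<and> finite U \<and> card U \<le> 2 \<and>
      (\<forall>v\<in>{v \<in> ?C. ?l' v = y}. \<exists>u\<in>U. ?p v = ?p u \<or> ?q v = ?q u)" by simp
  then obtain U where U: "\<forall>y. U y \<subseteq> {v \<in> ?C. ?l' v = y} \<and> finite (U y) \<and> card (U y) \<le> 2 \<and>
      (\<forall>v\<in>{v \<in> ?C. ?l' v = y}. \<exists>u\<in>U y. ?p v = ?p u \<or> ?q v = ?q u)" unfolding choice_iff by blast
  let ?U = "\<Union>y\<in>?l' ` A. U y"
  have "card ?U \<le> (\<Sum>y\<in>?l' ` A. card (U y))" using finite_simlab by (rule card_UN_le)
  also have "\<dots> \<le> (\<Sum>y\<in>?l' ` A. 2)" using U by (intro sum_mono) blast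
  also have "\<dots> \<le> 2 * simcount m" using card_simlab[of E A m s' A] by simp
  finally have "card ?U \<le> 2 * simcount m" .
  moreover have "finite ?U" using U finite_simlab by (intro finite_UN_I) auto
  moreover have "?U \<subseteq> ?C" using U by blast
  moreover have "\<exists>u\<in>?U. ?p v = ?p u \<or> ?q v = ?q u" if v: "v \<in> A" "gtype E A m s j v" for v
  proof -
    have "v \<in> {v' \<in> ?C. ?l' v' = ?l' v}" using v by simp
    then obtain u where "u \<in> U (?l' v)" "?p v = ?p u \<or> ?q v = ?q u" using U by blast
    then show ?thesis using v(1) by blast
  qed
  ultimately show ?thesis by (intro exI[of _ ?U]) simp
qed

text \<open>Every component inside a second cell of a covering vertex is absorbed by that cell,
  which has bounded shrubdepth because \<open>s'\<close> is a configuration as well. The class of j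
  then meets few parts and stops being a candidate, which leaves m - 1 candidate labels.\<close>

lemma descent_dicing:
  fixes E :: "'a \<Rightarrow> 'a \<Rightarrow> bool"
  assumes fin: "finite A" and sym: "sym_on_set E A"
    and c: "config n t m E A s" "config n t m E A s'"
    and j: "j < m" and un: "\<And>j'. j' < m \<Longrightarrow> \<not> matching E A m s s' j j'"
  shows "\<exists>(part :: 'a \<Rightarrow> 'a set) S. dices E A (simlab E A m s) part \<and>
    (\<forall>a\<in>A. shrub (Suc n) (shrub_count n t) E {b \<in> A. part b = part a}) \<and> finite S \<and> card S \<le> m - 1 \<and>
    (\<forall>a\<in>A. simlab E A m s a \<notin> S \<longrightarrow>
       card (part ` {b \<in> A. simlab E A m s b = simlab E A m s a}) \<le> 4 * simcount m + 2 * simcount m * simcount m ^ 4 + 1)"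
proof -
  have st: "stable (link E A m s) A t" "stable (link E A m s') A t" using c by (simp_all add: config_def)
  have sA: "s r \<in> A" if "r < 3 * m" for r using c(1) that by (simp add: config_def)
  let ?p = "cell (link E A m s) A t" and ?q = "cell (link E A m s') A t"
  let ?l = "simlab E A m s"
  note sl = sym_link[OF sym, of m s] and sl' = sym_link[OF sym, of m s']
  note pe = cell_eq_iff[OF st(1) sl] and qe = cell_eq_iff[OF st(2) sl']
  obtain U where U: "U \<subseteq> {v \<in> A. gtype E A m s j v}" "finite U" "card U \<le> 2 * simcount m"
    "\<And>v. v \<in> A \<Longrightarrow> gtype E A m s j v \<Longrightarrow> \<exists>u\<in>U. ?p v = ?p u \<or> ?q v = ?q u"
    using unmatched_cover[OF st sym j un] by blast
  have UA: "u \<in> A" if "u \<in> U" for u using U(1) that by blast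
  define inU where "inU K \<longleftrightarrow> (\<exists>u\<in>U. K \<subseteq> ?q u)" for K
  define part where "part v = (if inU (?p v) then (SOME Q. Q \<in> ?q ` U \<and> ?p v \<subseteq> Q) else ?p v)" for v
  have pin: "part v \<in> ?q ` U \<and> ?p v \<subseteq> part v" if "inU (?p v)" for v
  proof -
    have "\<exists>Q. Q \<in> ?q ` U \<and> ?p v \<subseteq> Q" using that unfolding inU_def by blast
    then have "(SOME Q. Q \<in> ?q ` U \<and> ?p v \<subseteq> Q) \<in> ?q ` U \<and> ?p v \<subseteq> (SOME Q. Q \<in> ?q ` U \<and> ?p v \<subseteq> Q)"
      by (rule someI_ex)
    then show ?thesis using that by (simp add: part_def)
  qed
  have pout: "part v = ?p v" if "\<not> inU (?p v)" for v using that by (simp add: part_def)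
  have pp: "?p u = ?p v \<Longrightarrow> part u = part v" for u v by (simp add: part_def)
  have sub: "?p v \<subseteq> part v" for v using pin pout by (cases "inU (?p v)") auto
  \<comment> \<open>The label of triple j is removed even when another triple carries it
    too.\<close>
  define S where "S = (\<lambda>i. ?l (s (3 * i))) ` ({..<m} - {j}) - {?l (s (3 * j))}"
  show ?thesis
  proof (intro exI conjI ballI impI)
    show "dices E A ?l part" using dices_coarser[OF dices_cell[OF st(1) sym]] pp by blast
    show "finite S" unfolding S_def by auto
    have "card S \<le> card ((\<lambda>i. ?l (s (3 * i))) ` ({..<m} - {j}))" unfolding S_def by (intro card_mono) auto
    also have "\<dots> \<le> card ({..<m} - {j})" by (intro card_image_le) auto
    finally show "card S \<le> m - 1" using j by simp
  next
    fix a assume a: "a \<in> A"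
    have shc: "shrub (Suc n) (shrub_count n t) E K" if "K = ?p v \<or> K = ?q v" "v \<in> A" for K v
    proof (rule layered_shrub)
      show "finite K" "sym_on_set E K"
        using that finite_subset[OF cell_subset fin] sym_on_set_subset[OF sym cell_subset] by auto
      show "layered n t E K" using that c unfolding config_def by auto
    qed
    show "shrub (Suc n) (shrub_count n t) E {b \<in> A. part b = part a}"
    proof (rule shrub_subset)
      have "part a \<in> ?q ` U \<or> part a = ?p a" using pin pout by blast
      then obtain v where "v \<in> A" "part a = ?p v \<or> part a = ?q v" using UA a by blast
      then show "shrub (Suc n) (shrub_count n t) E (part a)" using shc by metis
      show "{b \<in> A. part b = part a} \<subseteq> part a"
      proof
        fix b assume b: "b \<in> {b \<in> A. part b = part a}"
        then have "b \<in> ?p b" by (intro cell_self) simp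
        then show "b \<in> part a" using sub[of b] b by auto
      qed
    qed
  next
    fix a assume a: "a \<in> A" "?l a \<notin> S"
    let ?L = "simcount m"
    \<comment> \<open>The bound adds up the second cells of the covering vertices, their first
      cells, and the first cells cut by these second cells; the final 1 is for a rare label.\<close>
    show "card (part ` {b \<in> A. ?l b = ?l a}) \<le> 4 * ?L + 2 * ?L * ?L ^ 4 + 1"
    proof (cases "?l a = ?l (s (3 * j))")
      case True
      let ?D = "\<lambda>u. {?p v | v. v \<in> ?q u \<and> \<not> ?p v \<subseteq> ?q u}"
      have "part ` {b \<in> A. ?l b = ?l a} \<subseteq> ?q ` U \<union> ?p ` U \<union> (\<Union>u\<in>U. ?D u)"
      proof (rule image_subsetI)
        fix v assume "v \<in> {b \<in> A. ?l b = ?l a}"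
        then have v: "v \<in> A" "gtype E A m s j v" using True unfolding gtype_def sim_iff by auto
        show "part v \<in> ?q ` U \<union> ?p ` U \<union> (\<Union>u\<in>U. ?D u)"
        proof (cases "inU (?p v)")
          case True
          then show ?thesis using pin by blast
        next
          case False
          obtain u where u: "u \<in> U" "?p v = ?p u \<or> ?q v = ?q u" using U(4)[OF v] by blast
          show ?thesis
          proof (cases "?p v = ?p u")
            case True
            then show ?thesis using pout[OF False] u(1) by blast
          next
            case nq: False
            then have "v \<in> ?q u" using u(2) cell_self[OF v(1)] by metis
            moreover have "\<not> ?p v \<subseteq> ?q u" using False u(1) unfolding inU_def by blast
            ultimately have "?p v \<in> ?D u" by blast
            then have "part v \<in> ?D u" unfolding pout[OF False] .
            then show ?thesis using u(1) by blast
          qed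
        qed
      qed
      then have "card (part ` {b \<in> A. ?l b = ?l a}) \<le> card (?q ` U \<union> ?p ` U \<union> (\<Union>u\<in>U. ?D u))"
      proof (intro card_mono)
        have "?D u \<subseteq> ?p ` A" for u by (auto simp: cell_def)
        then have "finite (?D u)" for u using fin finite_subset by blast
        then show "finite (?q ` U \<union> ?p ` U \<union> (\<Union>u\<in>U. ?D u))" using U(2) by blast
      qed
      also have "\<dots> \<le> card (?q ` U) + card (?p ` U) + card (\<Union>u\<in>U. ?D u)"
        by (meson add_mono card_Un_le order_refl order_trans)
      also have "\<dots> \<le> 2 * ?L + 2 * ?L + 2 * ?L * ?L ^ 4"
      proof (intro add_mono)
        show "card (?q ` U) \<le> 2 * ?L" "card (?p ` U) \<le> 2 * ?L"
          using card_image_le[OF U(2)] U(3) order_trans by blast+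
        have "card (\<Union>u\<in>U. ?D u) \<le> (\<Sum>u\<in>U. card (?D u))" using U(2) by (rule card_UN_le)
        also have "\<dots> \<le> (\<Sum>u\<in>U. ?L ^ 4)" using cut_cells[OF st sym UA] by (intro sum_mono)
        also have "\<dots> \<le> 2 * ?L * ?L ^ 4" using U(3) by simp
        finally show "card (\<Union>u\<in>U. ?D u) \<le> 2 * ?L * ?L ^ 4" .
      qed
      finally show ?thesis by simp
    next
      case False
      \<comment> \<open>A label that is neither in S nor that of j belongs to no triple, and all
        rare vertices share one cell.\<close>
      have ra: "rare E A m s b" if b: "?l b = ?l a" for b
        unfolding rare_def
      proof (intro allI impI notI)
        fix i assume i: "i < m" "gtype E A m s i b"
        then have "?l a = ?l (s (3 * i))" using b unfolding gtype_def sim_iff by simp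
        then have "?l a \<in> S" using i(1) False unfolding S_def by auto
        then show False using a(2) by blast
      qed
      have "part ` {b \<in> A. ?l b = ?l a} \<subseteq> {part a}"
        using rare_cell[OF st(1) sym _ a(1) ra ra] pp by blast
      then have "card (part ` {b \<in> A. ?l b = ?l a}) \<le> card {part a}" by (intro card_mono) auto
      then show ?thesis by simp
    qed
  qed
qed

text \<open>The new bound is chosen before the graph and the triples. Only this uniformity allows it
  to enter a formula.\<close>

lemma descent:
  "\<exists>t'. \<forall>(E :: 'a \<Rightarrow> 'a \<Rightarrow> bool) A s s' j. finite A \<longrightarrow> sym_on_set E A \<longrightarrow> config n t m E A s \<longrightarrow> config n t m E A s' \<longrightarrow>
     j < m \<longrightarrow> (\<forall>j'<m. \<not> matching E A m s s' j j') \<longrightarrow> (\<exists>m'<m. \<exists>s''. config n t' m' E A s'')"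
proof -
  let ?M = "4 * simcount m + 2 * simcount m * simcount m ^ 4 + 1"
  obtain k where k: "\<forall>(E :: 'a \<Rightarrow> 'a \<Rightarrow> bool) A (lab :: 'a \<Rightarrow> nat set \<times> nat set set) (part :: 'a \<Rightarrow> 'a set) S.
     finite A \<longrightarrow> sym_on_set E A \<longrightarrow> dices E A lab part \<longrightarrow> card (lab ` A) \<le> simcount m \<longrightarrow>
     (\<forall>a\<in>A. shrub (Suc n) (shrub_count n t) E {b \<in> A. part b = part a}) \<longrightarrow>
     finite S \<longrightarrow> card S \<le> m - 1 \<longrightarrow> (\<forall>a\<in>A. lab a \<notin> S \<longrightarrow> card (part ` {b \<in> A. lab b = lab a}) \<le> ?M) \<longrightarrow>
     (\<exists>m'\<le>m - 1. \<exists>s. shrub_config n k m' E A s)"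
    using shrub_config_exists by blast
  obtain t1 where t1: "\<forall>(E :: 'a \<Rightarrow> 'a \<Rightarrow> bool) A. finite A \<longrightarrow> sym_on_set E A \<longrightarrow> A \<noteq> {} \<longrightarrow> shrub (Suc n) k E A \<longrightarrow> layered n t1 E A"
    using shrub_layered by blast
  show ?thesis
  proof (rule exI[of _ "k + t1"], intro allI impI)
    fix E :: "'a \<Rightarrow> 'a \<Rightarrow> bool" and A s s' j
    assume h: "finite A" "sym_on_set E A" "config n t m E A s" "config n t m E A s'" "j < m"
      "\<forall>j'<m. \<not> matching E A m s s' j j'"
    obtain part :: "'a \<Rightarrow> 'a set" and S where "dices E A (simlab E A m s) part"
      "\<forall>a\<in>A. shrub (Suc n) (shrub_count n t) E {b \<in> A. part b = part a}" "finite S" "card S \<le> m - 1"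
      "\<forall>a\<in>A. simlab E A m s a \<notin> S \<longrightarrow> card (part ` {b \<in> A. simlab E A m s b = simlab E A m s a}) \<le> ?M"
      using descent_dicing[OF h(1-5)] h(6) by blast
    then have "\<exists>m'\<le>m - 1. \<exists>s. shrub_config n k m' E A s"
      using k[rule_format, OF h(1,2) _ card_simlab] by blast
    then obtain m' s'' where m': "m' \<le> m - 1" "shrub_config n k m' E A s''" by blast
    have "config n (k + t1) m' E A s''" using shrub_config_imp_config[OF t1 m'(2) h(1,2)] .
    moreover have "m' < m" using m'(1) h(5) by simp
    ultimately show "\<exists>m'<m. \<exists>s''. config n (k + t1) m' E A s''" by blast
  qed
qed

section \<open>Levels at which the number of triples cannot drop\<close>

definition tight :: "nat \<Rightarrow> nat \<Rightarrow> nat \<Rightarrow> nat \<Rightarrow> ('a \<Rightarrow> 'a \<Rightarrow> bool) \<Rightarrow> 'a set \<Rightarrow> bool" where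
  "tight n t t' m E A \<longleftrightarrow> (\<exists>s. config n t m E A s) \<and> (\<forall>m'<m. \<not> (\<exists>s. config n t' m' E A s))"

text \<open>At a tight level the descent is blocked, so every triple of either choice is matched;
  the descent is applied in both directions.\<close>

lemma descent_step:
  "\<exists>t'. \<forall>m\<le>k. \<forall>(E :: 'a \<Rightarrow> 'a \<Rightarrow> bool) A s s'. finite A \<longrightarrow> sym_on_set E A \<longrightarrow> config n t m E A s \<longrightarrow> config n t m E A s' \<longrightarrow>
     tight n t t' m E A \<longrightarrow> matched E A m s s'"
proof -
  have "\<forall>m. \<exists>t'. \<forall>(E :: 'a \<Rightarrow> 'a \<Rightarrow> bool) A s s' j. finite A \<longrightarrow> sym_on_set E A \<longrightarrow> config n t m E A s \<longrightarrow> config n t m E A s' \<longrightarrow>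
     j < m \<longrightarrow> (\<forall>j'<m. \<not> matching E A m s s' j j') \<longrightarrow> (\<exists>m'<m. \<exists>s''. config n t' m' E A s'')"
    using descent by blast
  then obtain T where T: "\<And>m (E :: 'a \<Rightarrow> 'a \<Rightarrow> bool) A s s' j. finite A \<Longrightarrow> sym_on_set E A \<Longrightarrow> config n t m E A s \<Longrightarrow>
     config n t m E A s' \<Longrightarrow> j < m \<Longrightarrow> (\<forall>j'<m. \<not> matching E A m s s' j j') \<Longrightarrow> (\<exists>m'<m. \<exists>s''. config n (T m) m' E A s'')"
    unfolding choice_iff by blast
  show ?thesis
  \<comment> \<open>The sum dominates the bounds for all m up to k, so that one level serves them
    together.\<close>
  proof (rule exI[of _ "\<Sum>m\<le>k. T m"], intro allI impI)
    fix m and E :: "'a \<Rightarrow> 'a \<Rightarrow> bool" and A s s'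
    assume h: "m \<le> k" "finite A" "sym_on_set E A" "config n t m E A s" "config n t m E A s'"
      "tight n t (\<Sum>m\<le>k. T m) m E A"
    have le: "T m \<le> (\<Sum>m\<le>k. T m)" using h(1) member_le_sum[of m "{..k}" T] by auto
    have no: "\<not> config n (T m) m' E A s''" if "m' < m" for m' s''
      using h(6) that config_mono[OF _ le] unfolding tight_def by blast
    show "matched E A m s s'"
    proof
      show "\<exists>j'<m. matching E A m s s' j j'" if "j < m" for j
        using T[OF h(2-5) that] no by blast
      show "\<exists>j<m. matching E A m s s' j j'" if "j' < m" for j'
        using T[OF h(2,3,5,4) that] no matching_sym by blast
    qed (use h(4,5) in \<open>auto simp: config_def\<close>)
  qed
qed

text \<open>A level that is not tight yields fewer triples at the next level, and m can drop at most
  m times.\<close>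

lemma tight_exists:
  assumes "config n (T i) m E A s"
  shows "\<exists>i'\<le>i + m. \<exists>m'\<le>m. tight n (T i') (T (Suc i')) m' E A"
  using assms
proof (induction m arbitrary: i s rule: less_induct)
  case (less m)
  show ?case
  proof (cases "\<exists>m'<m. \<exists>s. config n (T (Suc i)) m' E A s")
    case True
    then obtain m' s' where m': "m' < m" "config n (T (Suc i)) m' E A s'" by blast
    obtain i2 m2 where "i2 \<le> Suc i + m'" "m2 \<le> m'" "tight n (T i2) (T (Suc i2)) m2 E A"
      using less.IH[OF m'] by blast
    then show ?thesis using m'(1) by (intro exI[of _ i2] conjI exI[of _ m2]) auto
  next
    case False
    then show ?thesis using less.prems unfolding tight_def by (intro exI[of _ i] conjI exI[of _ m]) auto
  qed
qed

text \<open>T iterates the bound of the descent, so each level is followed by the one at which its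
  descent would land. The initial number of triples is at most \<open>T 0\<close>, hence this one
  number bounds both the index of a tight level and its number of triples.\<close>

lemma canonical_config:
  "\<exists>k (T :: nat \<Rightarrow> nat). \<forall>(E :: 'a \<Rightarrow> 'a \<Rightarrow> bool) A. finite A \<longrightarrow> sym_on_set E A \<longrightarrow> A \<noteq> {} \<longrightarrow>
     shrub (Suc (Suc n)) K E A \<longrightarrow>
     (\<exists>i\<le>k. \<exists>m\<le>k. tight n (T i) (T (Suc i)) m E A) \<and>
     (\<forall>i m. m \<le> k \<longrightarrow> tight n (T i) (T (Suc i)) m E A \<longrightarrow>
        (\<forall>s s'. config n (T i) m E A s \<longrightarrow> config n (T i) m E A s' \<longrightarrow> matched E A m s s'))"
proof -
  obtain t where t: "\<forall>(E :: 'a \<Rightarrow> 'a \<Rightarrow> bool) A. finite A \<longrightarrow> sym_on_set E A \<longrightarrow> A \<noteq> {} \<longrightarrow>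
      shrub (Suc (Suc n)) K E A \<longrightarrow> layered (Suc n) t E A" using shrub_layered by blast
  have "\<forall>t0. \<exists>t'. \<forall>m\<le>t. \<forall>(E :: 'a \<Rightarrow> 'a \<Rightarrow> bool) A s s'. finite A \<longrightarrow> sym_on_set E A \<longrightarrow> config n t0 m E A s \<longrightarrow>
      config n t0 m E A s' \<longrightarrow> tight n t0 t' m E A \<longrightarrow> matched E A m s s'"
    using descent_step by blast
  from choice[OF this] obtain step where step: "\<forall>t0. \<forall>m\<le>t. \<forall>(E :: 'a \<Rightarrow> 'a \<Rightarrow> bool) A s s'. finite A \<longrightarrow> sym_on_set E A \<longrightarrow>
      config n t0 m E A s \<longrightarrow> config n t0 m E A s' \<longrightarrow> tight n t0 (step t0) m E A \<longrightarrow> matched E A m s s'" ..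
  define T where "T i = (step ^^ i) t" for i
  have T: "T 0 = t" "T (Suc i) = step (T i)" for i by (simp_all add: T_def)
  show ?thesis
  proof (rule exI[of _ t], rule exI[of _ T], intro allI impI conjI)
    fix E :: "'a \<Rightarrow> 'a \<Rightarrow> bool" and A
    assume h: "finite A" "sym_on_set E A" "A \<noteq> {}" "shrub (Suc (Suc n)) K E A"
    have "layered (Suc n) t E A" by (rule t[rule_format]) (rule h)+
    then obtain m s where ms: "m \<le> t" "config n (T 0) m E A s" unfolding layered_Suc_config T(1) by blast
    obtain i' m' where "i' \<le> 0 + m" "m' \<le> m" "tight n (T i') (T (Suc i')) m' E A"
      using tight_exists[of n T 0 m E A s] ms(2) by blast
    then show "\<exists>i\<le>t. \<exists>m\<le>t. tight n (T i) (T (Suc i)) m E A"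
      using ms(1) by (intro exI[of _ i'] conjI exI[of _ m']) auto
    fix i m s s'
    assume "m \<le> t" "tight n (T i) (T (Suc i)) m E A" "config n (T i) m E A s" "config n (T i) m E A s'"
    then show "matched E A m s s'" using step[rule_format, of m A E "T i" s s'] h(1,2) unfolding T(2) by simp
  qed
qed

section \<open>First-order definability\<close>

text \<open>Definability is treated semantically, so that no formula is ever written out. It refers
  to all structures over the type, whether graphs or not.\<close>

definition fo :: "nat \<Rightarrow> ('a pair_pre_digraph \<Rightarrow> (nat \<Rightarrow> 'a) \<Rightarrow> bool) \<Rightarrow> bool" where
  "fo n R \<longleftrightarrow> (\<exists>p. fv p \<subseteq> {..<n} \<and> (\<forall>G e. sat G e p \<longleftrightarrow> R G e))"

definition edge :: "'a pair_pre_digraph \<Rightarrow> 'a \<Rightarrow> 'a \<Rightarrow> bool" where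
  "edge G u v \<longleftrightarrow> (u, v) \<in> parcs G"

lemma fo_eq: "i < n \<Longrightarrow> j < n \<Longrightarrow> fo n (\<lambda>G e. e i = e j)"
  unfolding fo_def by (intro exI[of _ "Equal i j"]) auto

lemma fo_edge: "i < n \<Longrightarrow> j < n \<Longrightarrow> fo n (\<lambda>G e. edge G (e i) (e j))"
  unfolding fo_def edge_def by (intro exI[of _ "Edge i j"]) auto

lemma fo_not: "fo n R \<Longrightarrow> fo n (\<lambda>G e. \<not> R G e)"
  unfolding fo_def by (metis fv.simps(3) sat.simps(3))

lemma fo_and: "fo n R \<Longrightarrow> fo n S \<Longrightarrow> fo n (\<lambda>G e. R G e \<and> S G e)"
  unfolding fo_def by (metis Un_least fv.simps(4) sat.simps(4))

lemma fo_or: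
  assumes "fo n R" "fo n S"
  shows "fo n (\<lambda>G e. R G e \<or> S G e)"
  using fo_not[OF fo_and[OF fo_not[OF assms(1)] fo_not[OF assms(2)]]] by simp

lemma fo_imp:
  assumes "fo n R" "fo n S"
  shows "fo n (\<lambda>G e. R G e \<longrightarrow> S G e)"
  using fo_not[OF fo_and[OF assms(1) fo_not[OF assms(2)]]] by simp

lemma fo_iff:
  assumes "fo n R" "fo n S"
  shows "fo n (\<lambda>G e. R G e \<longleftrightarrow> S G e)"
  using fo_and[OF fo_imp[OF assms] fo_imp[OF assms(2,1)]] by (simp add: iff_conv_conj_imp)

text \<open>The formula must be closed because n may be 0, so a tautology about an existential
  sentence is taken.\<close>

lemma fo_True: "fo n (\<lambda>G e. True)"
  unfolding fo_def by (intro exI[of _ "Neg (Conj (Exists 0 (Equal 0 0)) (Neg (Exists 0 (Equal 0 0))))"]) auto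

lemma fo_all_less:
  fixes k :: nat
  assumes "\<And>j. j < k \<Longrightarrow> fo n (R j)"
  shows "fo n (\<lambda>G e. \<forall>j<k. R j G e)"
  using assms
proof (induction k)
  case 0
  then show ?case using fo_True by simp
next
  case (Suc k)
  then have "fo n (\<lambda>G e. (\<forall>j<k. R j G e) \<and> R k G e)" by (intro fo_and) auto
  then show ?case by (simp add: All_less_Suc conj_commute)
qed

lemma fo_ex_less:
  fixes k :: nat
  assumes "\<And>j. j < k \<Longrightarrow> fo n (R j)"
  shows "fo n (\<lambda>G e. \<exists>j<k. R j G e)"
  using fo_not[OF fo_all_less[of k n "\<lambda>j G e. \<not> R j G e", OF fo_not[OF assms]]] by simp

text \<open>The bound variable is the first index beyond the context. As R ignores it, nothing is
  captured.\<close>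

lemma fo_ex:
  assumes "fo (Suc n) (\<lambda>G e. R G e (e n))" "\<And>G e a. R G (e(n := a)) = R G e"
  shows "fo n (\<lambda>G e. \<exists>a\<in>pverts G. R G e a)"
proof -
  obtain p where p: "fv p \<subseteq> {..<Suc n}" "\<And>G e. sat G e p \<longleftrightarrow> R G e (e n)" using assms(1) unfolding fo_def by blast
  show ?thesis unfolding fo_def
    using p by (intro exI[of _ "Exists n p"]) (auto simp: assms(2) less_Suc_eq)
qed

text \<open>
  Allowing all larger contexts \<open>n'\<close> keeps definability stable under introducing variables, so that no
  formula has to be renamed.
\<close>

definition dset :: "nat \<Rightarrow> ('a pair_pre_digraph \<Rightarrow> (nat \<Rightarrow> 'a) \<Rightarrow> 'a set) \<Rightarrow> bool" where
  "dset n A \<longleftrightarrow> (\<forall>G e. A G e \<subseteq> pverts G) \<and> (\<forall>G e i a. n \<le> i \<longrightarrow> A G (e(i := a)) = A G e) \<and>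
     (\<forall>n'\<ge>n. \<forall>i<n'. fo n' (\<lambda>G e. e i \<in> A G e))"

definition drel :: "nat \<Rightarrow> ('a pair_pre_digraph \<Rightarrow> (nat \<Rightarrow> 'a) \<Rightarrow> 'a \<Rightarrow> 'a \<Rightarrow> bool) \<Rightarrow> bool" where
  "drel n R \<longleftrightarrow> (\<forall>G e i a. n \<le> i \<longrightarrow> R G (e(i := a)) = R G e) \<and>
     (\<forall>n'\<ge>n. \<forall>i<n'. \<forall>j<n'. fo n' (\<lambda>G e. R G e (e i) (e j)))"

lemma dset_subset: "dset n A \<Longrightarrow> A G e \<subseteq> pverts G"
  unfolding dset_def by blast

lemma dset_local: "dset n A \<Longrightarrow> n \<le> i \<Longrightarrow> A G (e(i := a)) = A G e"
  unfolding dset_def by blast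

lemma dset_fo: "dset n A \<Longrightarrow> n \<le> n' \<Longrightarrow> i < n' \<Longrightarrow> fo n' (\<lambda>G e. e i \<in> A G e)"
  unfolding dset_def by blast

lemma dset_mono: "dset n A \<Longrightarrow> n \<le> n' \<Longrightarrow> dset n' A"
  unfolding dset_def by (meson order_trans)

lemma drel_fo: "drel n R \<Longrightarrow> n \<le> n' \<Longrightarrow> i < n' \<Longrightarrow> j < n' \<Longrightarrow> fo n' (\<lambda>G e. R G e (e i) (e j))"
  unfolding drel_def by blast

lemma dset_verts: "dset n (\<lambda>G e. pverts G)"
proof -
  have "fo n' (\<lambda>G e. e i \<in> pverts G)" if i: "i < n'" for n' i
  proof -
    have "fo n' (\<lambda>G e. \<exists>a\<in>pverts G. a = e i)"
      using i by (intro fo_ex[where R = "\<lambda>G e a. a = e i"] fo_eq) auto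
    then show ?thesis by simp
  qed
  then show ?thesis unfolding dset_def by blast
qed

lemma fo_bex:
  assumes "dset n A" "fo (Suc n) (\<lambda>G e. R G e (e n))" "\<And>G e a. R G (e(n := a)) = R G e"
  shows "fo n (\<lambda>G e. \<exists>x\<in>A G e. R G e x)"
proof -
  have "fo n (\<lambda>G e. \<exists>x\<in>pverts G. x \<in> A G e \<and> R G e x)"
  proof (rule fo_ex[where R = "\<lambda>G e x. x \<in> A G e \<and> R G e x"])
    show "fo (Suc n) (\<lambda>G e. e n \<in> A G e \<and> R G e (e n))"
      using assms(2) dset_fo[OF assms(1)] by (intro fo_and) auto
    show "(\<lambda>x. x \<in> A G (e(n := a)) \<and> R G (e(n := a)) x) = (\<lambda>x. x \<in> A G e \<and> R G e x)" for G e a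
      using dset_local[OF assms(1)] assms(3) by simp
  qed
  moreover have "(\<exists>x\<in>pverts G. x \<in> A G e \<and> R G e x) \<longleftrightarrow> (\<exists>x\<in>A G e. R G e x)" for G e
    using dset_subset[OF assms(1)] by blast
  ultimately show ?thesis by simp
qed

lemma fo_ball:
  assumes "dset n A" "fo (Suc n) (\<lambda>G e. R G e (e n))" "\<And>G e a. R G (e(n := a)) = R G e"
  shows "fo n (\<lambda>G e. \<forall>x\<in>A G e. R G e x)"
proof -
  have "fo n (\<lambda>G e. \<exists>x\<in>A G e. \<not> R G e x)"
    by (rule fo_bex[OF assms(1)]) (simp_all add: assms(3) fo_not[OF assms(2)])
  from fo_not[OF this] show ?thesis by simp
qed

section \<open>Quantification over sequences of vertices\<close>

definition trunc :: "nat \<Rightarrow> (nat \<Rightarrow> 'a) \<Rightarrow> nat \<Rightarrow> 'a" where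
  "trunc k s r = (if r < k then s r else undefined)"

text \<open>Fixing all entries beyond position k makes the sequence a function of k consecutive
  variables, so changing a later variable leaves it literally equal.\<close>

definition block :: "nat \<Rightarrow> nat \<Rightarrow> (nat \<Rightarrow> 'a) \<Rightarrow> nat \<Rightarrow> 'a" where
  "block n k e = trunc k (\<lambda>r. e (n + r))"

lemma block_local: "n + k \<le> i \<Longrightarrow> block n k (e(i := a)) = block n k e"
  unfolding block_def trunc_def by auto

lemma block_nth: "r < k \<Longrightarrow> block n k e r = e (n + r)"
  by (simp add: block_def trunc_def)

text \<open>The sequence s is infinite, but R sees only its first k entries. After d steps of the
  induction the last d of these are quantified, while the first k - d are still tied to
  variables.\<close>

lemma fo_ex_block:
  assumes A: "dset n A" and R: "fo (n + k) (\<lambda>G e. R G e (block n k e))"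
    and loc: "\<And>G e i a. n \<le> i \<Longrightarrow> R G (e(i := a)) = R G e"
    and tr: "\<And>G e s. R G e (trunc k s) = R G e s"
  shows "fo n (\<lambda>G e. \<exists>s. (\<forall>r<k. s r \<in> A G e) \<and> R G e s)"
proof -
  have "fo (n + (k - d)) (\<lambda>G e. \<exists>s. (\<forall>r<k. s r \<in> A G e) \<and> (\<forall>r<k - d. s r = e (n + r)) \<and> R G e s)" if "d \<le> k" for d
    using that
  proof (induction d)
    case 0
    have "fo (n + k) (\<lambda>G e. (\<forall>r<k. e (n + r) \<in> A G e) \<and> R G e (block n k e))"
      using dset_fo[OF A] R by (intro fo_and fo_all_less) auto
    moreover have "(\<exists>s. (\<forall>r<k. s r \<in> A G e) \<and> (\<forall>r<k. s r = e (n + r)) \<and> R G e s) \<longleftrightarrow>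
        (\<forall>r<k. e (n + r) \<in> A G e) \<and> R G e (block n k e)" (is "?L \<longleftrightarrow> ?R") for G e
    proof
      assume ?L
      then obtain s where s: "\<forall>r<k. s r \<in> A G e" "\<forall>r<k. s r = e (n + r)" "R G e s" by blast
      have "trunc k s = block n k e" unfolding block_def trunc_def using s(2) by auto
      then have "R G e (block n k e)" using s(3) tr[of G e s] by simp
      then show ?R using s by auto
    next
      assume ?R
      then show ?L by (intro exI[of _ "block n k e"]) (auto simp: block_nth)
    qed
    ultimately show ?case by simp
  next
    case (Suc d)
    define j where "j = k - Suc d"
    have kd: "k - d = Suc j" and jk: "j < k" using Suc.prems by (simp_all add: j_def)
    let ?R = "\<lambda>G e a. \<exists>s. (\<forall>r<k. s r \<in> A G e) \<and> (\<forall>r<j. s r = e (n + r)) \<and> s j = a \<and> R G e s"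
    have "fo (n + j) (\<lambda>G e. \<exists>a\<in>pverts G. ?R G e a)"
    proof (rule fo_ex[where R = ?R])
      have "fo (n + Suc j) (\<lambda>G e. \<exists>s. (\<forall>r<k. s r \<in> A G e) \<and> (\<forall>r<Suc j. s r = e (n + r)) \<and> R G e s)"
        using Suc.IH Suc.prems unfolding kd by simp
      moreover have "(\<exists>s. (\<forall>r<k. s r \<in> A G e) \<and> (\<forall>r<Suc j. s r = e (n + r)) \<and> R G e s) \<longleftrightarrow> ?R G e (e (n + j))" for G e
        unfolding All_less_Suc by blast
      ultimately show "fo (Suc (n + j)) (\<lambda>G e. ?R G e (e (n + j)))" by simp
      show "?R G (e(n + j := a)) = ?R G e" for G e a
      proof -
        have "(\<forall>r<j. s r = (e(n + j := a)) (n + r)) \<longleftrightarrow> (\<forall>r<j. s r = e (n + r))" for s by auto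
        then show ?thesis using dset_local[OF A, of "n + j"] loc[of "n + j"] by (simp only: le_add1)
      qed
    qed
    \<comment> \<open>Letting a range over all vertices is harmless: it equals the entry
      \<open>s j\<close>, which lies in the definable set.\<close>
    moreover have "(\<exists>a\<in>pverts G. ?R G e a) \<longleftrightarrow>
        (\<exists>s. (\<forall>r<k. s r \<in> A G e) \<and> (\<forall>r<j. s r = e (n + r)) \<and> R G e s)" for G e
      using dset_subset[OF A, of G e] jk by (auto simp: subset_iff)
    ultimately show ?case by (simp add: j_def)
  qed
  from this[of k] show ?thesis by simp
qed

lemma maj_trunc: "j < m \<Longrightarrow> maj E (trunc (3 * m) s) j u = maj E s j u"
  unfolding maj_def trunc_def by simp

lemma agree_trunc: "agree E m (trunc (3 * m) s) = agree E m s"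
  unfolding agree_def fun_eq_iff using maj_trunc[of _ m E s] by auto

lemma generic_trunc: "generic E m (trunc (3 * m) s) = generic E m s"
  unfolding generic_def fun_eq_iff agree_trunc by (auto simp: trunc_def)

lemma full_trunc: "full E A m (trunc (3 * m) s) = full E A m s"
  unfolding full_def fun_eq_iff agree_trunc by simp

lemma sim_trunc: "sim E A m (trunc (3 * m) s) = sim E A m s"
  unfolding sim_def fun_eq_iff agree_trunc generic_trunc full_trunc by simp

lemma gtype_trunc: "j < m \<Longrightarrow> gtype E A m (trunc (3 * m) s) j = gtype E A m s j"
  unfolding gtype_def fun_eq_iff sim_trunc by (simp add: trunc_def)

lemma rare_trunc: "rare E A m (trunc (3 * m) s) = rare E A m s"
  unfolding rare_def fun_eq_iff using gtype_trunc[of _ m E A s] by auto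

lemma link_trunc: "link E A m (trunc (3 * m) s) = link E A m s"
  unfolding link_def fun_eq_iff rare_trunc using gtype_trunc[of _ m E A s] maj_trunc[of _ m E s] by (metis (no_types))

section \<open>Definability of labels, components and configurations\<close>

locale definable_groups =
  fixes n :: nat and A :: "'a pair_pre_digraph \<Rightarrow> (nat \<Rightarrow> 'a) \<Rightarrow> 'a set" and off m :: nat
  assumes A: "dset n A" and off: "off + 3 * m \<le> n"
begin

abbreviation "s e \<equiv> block off (3 * m) e"

lemma s_local: "n \<le> i \<Longrightarrow> s (e(i := a)) = s e"
  using block_local[of off "3 * m" i] off by simp

lemma A_local: "n \<le> i \<Longrightarrow> A G (e(i := a)) = A G e"
  using dset_local[OF A] .

lemma s_nth: "r < 3 * m \<Longrightarrow> s e r = e (off + r)"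
  by (rule block_nth)

lemma fo_maj: "j < m \<Longrightarrow> n \<le> n' \<Longrightarrow> i < n' \<Longrightarrow> fo n' (\<lambda>G e. maj (edge G) (s e) j (e i))"
  unfolding maj_def using off by (simp add: s_nth) (intro fo_or fo_and fo_edge; simp)

lemma drel_agree: "drel n (\<lambda>G e. agree (edge G) m (s e))"
  unfolding drel_def agree_def fun_eq_iff
  using fo_maj by (auto simp: s_local intro!: fo_all_less fo_iff)

lemma fo_generic: "n \<le> n' \<Longrightarrow> i < n' \<Longrightarrow> fo n' (\<lambda>G e. generic (edge G) m (s e) (e i))"
  unfolding generic_def
proof (rule fo_ex_less)
  fix j assume h: "n \<le> n'" "i < n'" "j < m"
  then show "fo n' (\<lambda>G e. agree (edge G) m (s e) (e i) (s e (3 * j)))"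
    using drel_fo[OF drel_agree h(1,2), of "off + 3 * j"] off h by (simp add: s_nth)
qed

lemma drel_full: "drel n (\<lambda>G e. full (edge G) (A G e) m (s e))"
  unfolding drel_def
proof (intro conjI allI impI)
  show "full (edge G) (A G (e(i := a))) m (s (e(i := a))) = full (edge G) (A G e) m (s e)" if "n \<le> i" for G e i a
    using that by (simp add: s_local A_local)
  fix n' i j assume h: "n \<le> n'" "i < n'" "j < n'"
  show "fo n' (\<lambda>G e. full (edge G) (A G e) m (s e) (e i) (e j))"
    unfolding full_def
  proof (rule fo_ball[OF dset_mono[OF A h(1)]])
    show "fo (Suc n') (\<lambda>G e. agree (edge G) m (s e) (e n') (e j) \<longrightarrow> edge G (e i) (e n'))"
      using h by (intro fo_imp fo_edge drel_fo[OF drel_agree]) auto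
  qed (use h in \<open>simp add: s_local\<close>)
qed

lemma drel_sim: "drel n (\<lambda>G e. sim (edge G) (A G e) m (s e))"
  unfolding drel_def
proof (intro conjI allI impI)
  show "sim (edge G) (A G (e(i := a))) m (s (e(i := a))) = sim (edge G) (A G e) m (s e)" if "n \<le> i" for G e i a
    using that by (simp add: s_local A_local)
  fix n' i j assume h: "n \<le> n'" "i < n'" "j < n'"
  show "fo n' (\<lambda>G e. sim (edge G) (A G e) m (s e) (e i) (e j))"
    unfolding sim_def
  proof (rule fo_and)
    show "fo n' (\<lambda>G e. agree (edge G) m (s e) (e i) (e j))" using h by (rule drel_fo[OF drel_agree])
    show "fo n' (\<lambda>G e. \<forall>w\<in>A G e. \<not> generic (edge G) m (s e) w \<longrightarrow>
        full (edge G) (A G e) m (s e) (e i) w = full (edge G) (A G e) m (s e) (e j) w)"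
    proof (rule fo_ball[OF dset_mono[OF A h(1)]])
      show "fo (Suc n') (\<lambda>G e. \<not> generic (edge G) m (s e) (e n') \<longrightarrow>
        full (edge G) (A G e) m (s e) (e i) (e n') = full (edge G) (A G e) m (s e) (e j) (e n'))"
        using h by (intro fo_imp fo_iff fo_not fo_generic drel_fo[OF drel_full]) auto
    qed (use h in \<open>simp add: s_local A_local\<close>)
  qed
qed

lemma fo_gtype:
  assumes "n \<le> n'" "i < n'" "j < m"
  shows "fo n' (\<lambda>G e. gtype (edge G) (A G e) m (s e) j (e i))"
proof -
  have "s e (3 * j) = e (off + 3 * j)" for e :: "nat \<Rightarrow> 'a" using assms(3) by (simp add: s_nth)
  then show ?thesis
    unfolding gtype_def using drel_fo[OF drel_sim assms(1,2), of "off + 3 * j"] off assms by simp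
qed

lemma fo_rare: "n \<le> n' \<Longrightarrow> i < n' \<Longrightarrow> fo n' (\<lambda>G e. rare (edge G) (A G e) m (s e) (e i))"
  unfolding rare_def by (intro fo_all_less fo_not fo_gtype)

lemma drel_link: "drel n (\<lambda>G e. link (edge G) (A G e) m (s e))"
  unfolding drel_def
proof (intro conjI allI impI)
  show "link (edge G) (A G (e(i := a))) m (s (e(i := a))) = link (edge G) (A G e) m (s e)" if "n \<le> i" for G e i a
    using that by (simp add: s_local A_local)
  fix n' i j assume h: "n \<le> n'" "i < n'" "j < n'"
  show "fo n' (\<lambda>G e. link (edge G) (A G e) m (s e) (e i) (e j))"
    unfolding link_def using h
    by (intro fo_or fo_and fo_ex_less fo_iff fo_not fo_edge fo_maj fo_gtype fo_rare)
qed

lemma drel_reach: "drel n (\<lambda>G e. reach (link (edge G) (A G e) m (s e)) (A G e) t)"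
proof (induction t)
  case 0
  show ?case unfolding drel_def using fo_eq by (auto simp: fun_eq_iff)
next
  case (Suc t)
  let ?F = "\<lambda>G e. link (edge G) (A G e) m (s e)"
  show ?case
    unfolding drel_def
  proof (intro conjI allI impI)
    show "reach (?F G (e(i := a))) (A G (e(i := a))) (Suc t) = reach (?F G e) (A G e) (Suc t)" if "n \<le> i" for G e i a
      using that by (simp add: s_local A_local)
    fix n' i j assume h: "n \<le> n'" "i < n'" "j < n'"
    show "fo n' (\<lambda>G e. reach (?F G e) (A G e) (Suc t) (e i) (e j))"
      unfolding reach.simps
    proof (rule fo_bex[OF dset_mono[OF A h(1)]])
      show "fo (Suc n') (\<lambda>G e. reach (?F G e) (A G e) t (e i) (e n') \<and> (e n' = e j \<or> ?F G e (e n') (e j)))"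
        using h by (intro fo_and fo_or fo_eq drel_fo[OF drel_link] drel_fo[OF Suc.IH]) auto
    qed (use h in \<open>simp add: s_local A_local\<close>)
  qed
qed

lemma fo_stable: "fo n (\<lambda>G e. stable (link (edge G) (A G e) m (s e)) (A G e) t)"
  unfolding stable_def
proof (rule fo_ball[OF A])
  let ?F = "\<lambda>G e. link (edge G) (A G e) m (s e)"
  show "fo (Suc n) (\<lambda>G e. \<forall>v\<in>A G e. reach (?F G e) (A G e) (Suc t) (e n) v \<longrightarrow> reach (?F G e) (A G e) t (e n) v)"
  proof (rule fo_ball[OF dset_mono[OF A]])
    show "fo (Suc (Suc n)) (\<lambda>G e. reach (?F G e) (A G e) (Suc t) (e n) (e (Suc n)) \<longrightarrow> reach (?F G e) (A G e) t (e n) (e (Suc n)))"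
      by (intro fo_imp drel_fo[OF drel_reach]) auto
  qed (simp_all add: s_local A_local del: reach.simps)
qed (simp add: s_local A_local)

text \<open>A cell is again a definable set, with its centre as a further variable. This is what
  lets the recursion of \<open>layered\<close> continue inside it.\<close>

lemma dset_cell:
  assumes "n \<le> c" "i < c"
  shows "dset c (\<lambda>G e. cell (link (edge G) (A G e) m (s e)) (A G e) t (e i))"
  unfolding dset_def
proof (intro conjI allI impI)
  show "cell (link (edge G) (A G e) m (s e)) (A G e) t (e i) \<subseteq> pverts G" for G e
    using cell_subset dset_subset[OF A] by (rule order_trans)
  show "cell (link (edge G) (A G (e(k := a))) m (s (e(k := a)))) (A G (e(k := a))) t ((e(k := a)) i) =
      cell (link (edge G) (A G e) m (s e)) (A G e) t (e i)" if "c \<le> k" for G e k a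
    using that assms by (simp add: s_local A_local)
  show "fo n' (\<lambda>G e. e j \<in> cell (link (edge G) (A G e) m (s e)) (A G e) t (e i))" if "c \<le> n'" "j < n'" for n' j
    unfolding cell_def mem_Collect_eq
    using that assms by (intro fo_and dset_fo[OF A] drel_fo[OF drel_reach]) auto
qed

end

text \<open>The membership of the representatives is split off since \<open>fo_ex_block\<close>
  supplies it.\<close>

definition config_body :: "nat \<Rightarrow> nat \<Rightarrow> nat \<Rightarrow> ('a \<Rightarrow> 'a \<Rightarrow> bool) \<Rightarrow> 'a set \<Rightarrow> (nat \<Rightarrow> 'a) \<Rightarrow> bool" where
  "config_body n t m E A s \<longleftrightarrow> stable (link E A m s) A t \<and> (\<forall>a\<in>A. layered n t E (cell (link E A m s) A t a))"

lemma config_split: "config n t m E A s \<longleftrightarrow> (\<forall>r<3 * m. s r \<in> A) \<and> config_body n t m E A s"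
  by (simp add: config_def config_body_def)

lemma config_body_trunc: "config_body n t m E A (trunc (3 * m) s) = config_body n t m E A s"
  by (simp add: config_body_def link_trunc)

text \<open>Definability of \<open>layered n\<close> is assumed because this lemma serves in the
  induction that proves it.\<close>

lemma fo_config_body:
  fixes A :: "'a pair_pre_digraph \<Rightarrow> (nat \<Rightarrow> 'a) \<Rightarrow> 'a set"
  assumes layered: "\<And>c (A :: 'a pair_pre_digraph \<Rightarrow> (nat \<Rightarrow> 'a) \<Rightarrow> 'a set). dset c A \<Longrightarrow> fo c (\<lambda>G e. layered n t (edge G) (A G e))"
    and A: "dset c A" and off: "off + 3 * m \<le> c"
  shows "fo c (\<lambda>G e. config_body n t m (edge G) (A G e) (block off (3 * m) e))"
proof -
  interpret definable_groups c A off m using A off by unfold_locales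
  show ?thesis
    unfolding config_body_def
  proof (rule fo_and[OF fo_stable fo_ball[OF A]])
    show "fo (Suc c) (\<lambda>G e. layered n t (edge G) (cell (link (edge G) (A G e) m (s e)) (A G e) t (e c)))"
      by (rule layered, rule dset_cell) auto
  qed (simp add: s_local A_local)
qed

lemma fo_twin:
  assumes A: "dset c A" and "i < c" "j < c"
  shows "fo c (\<lambda>G e. twin (edge G) (A G e) (e i) (e j))"
  unfolding twin_def
proof (rule fo_ball[OF A])
  show "fo (Suc c) (\<lambda>G e. e c \<noteq> e i \<longrightarrow> e c \<noteq> e j \<longrightarrow> edge G (e i) (e c) = edge G (e j) (e c))"
    using assms by (intro fo_imp fo_not fo_iff fo_eq fo_edge) auto
qed (use assms in simp)

lemma fo_layered: "dset c A \<Longrightarrow> fo c (\<lambda>G e. layered n t (edge G) (A G e))"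
proof (induction n arbitrary: c A)
  case 0
  show ?case
    unfolding layered.simps
  proof (rule fo_ex_block[OF 0])
    show "fo (c + t) (\<lambda>G e. \<forall>u\<in>A G e. \<exists>i<t. twin (edge G) (A G e) u (block c t e i))"
    proof (rule fo_ball[OF dset_mono[OF 0]])
      show "fo (Suc (c + t)) (\<lambda>G e. \<exists>i<t. twin (edge G) (A G e) (e (c + t)) (block c t e i))"
      proof (rule fo_ex_less)
        fix i assume i: "i < t"
        have "fo (Suc (c + t)) (\<lambda>G e. twin (edge G) (A G e) (e (c + t)) (e (c + i)))"
          using i by (intro fo_twin dset_mono[OF 0]) auto
        then show "fo (Suc (c + t)) (\<lambda>G e. twin (edge G) (A G e) (e (c + t)) (block c t e i))"
          using i by (simp add: block_nth)
      qed
    qed (simp_all add: block_local dset_local[OF 0])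
    show "(\<forall>u\<in>A G e. \<exists>i<t. twin (edge G) (A G e) u (trunc t s i)) = (\<forall>u\<in>A G e. \<exists>i<t. twin (edge G) (A G e) u (s i))" for G e s
      by (auto simp: trunc_def)
  qed (simp add: dset_local[OF 0])
next
  case (Suc n)
  have "fo c (\<lambda>G e. \<exists>m<Suc t. \<exists>s. (\<forall>r<3 * m. s r \<in> A G e) \<and> config_body n t m (edge G) (A G e) s)"
  proof (rule fo_ex_less, rule fo_ex_block[OF Suc.prems])
    fix m
    show "fo (c + 3 * m) (\<lambda>G e. config_body n t m (edge G) (A G e) (block c (3 * m) e))"
      by (rule fo_config_body[OF Suc.IH dset_mono[OF Suc.prems]]) auto
  qed (simp_all add: config_body_trunc dset_local[OF Suc.prems])
  then show ?case unfolding layered_Suc_config config_split less_Suc_eq_le .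
qed

lemma fo_ex_config:
  fixes R :: "'a pair_pre_digraph \<Rightarrow> (nat \<Rightarrow> 'a) \<Rightarrow> (nat \<Rightarrow> 'a) \<Rightarrow> bool"
  assumes "fo (c + 3 * m) (\<lambda>G e. R G e (block c (3 * m) e))" "\<And>G e i a. c \<le> i \<Longrightarrow> R G (e(i := a)) = R G e"
    "\<And>G e s. R G e (trunc (3 * m) s) = R G e s"
  shows "fo c (\<lambda>G e. \<exists>s. config n t m (edge G) (pverts G) s \<and> R G e s)"
proof -
  have "fo c (\<lambda>G e. \<exists>s. (\<forall>r<3 * m. s r \<in> pverts G) \<and> config_body n t m (edge G) (pverts G) s \<and> R G e s)"
  proof (rule fo_ex_block[OF dset_verts])
    show "fo (c + 3 * m) (\<lambda>G e. config_body n t m (edge G) (pverts G) (block c (3 * m) e) \<and> R G e (block c (3 * m) e))"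
      by (intro fo_and fo_config_body fo_layered dset_verts assms(1)) auto
  qed (simp_all add: config_body_trunc assms)
  then show ?thesis unfolding config_split conj_assoc .
qed

lemma fo_tight: "fo c (\<lambda>G e. tight n t t' m (edge G) (pverts G))"
proof -
  have "fo c (\<lambda>G e. \<exists>s. config n t m (edge G) (pverts G) s)" for t m
    using fo_ex_config[of c m "\<lambda>G e s. True" n t] by (simp add: fo_True)
  then show ?thesis unfolding tight_def by (intro fo_and fo_all_less fo_not)
qed

lemma fo_all_config:
  fixes R :: "'a pair_pre_digraph \<Rightarrow> (nat \<Rightarrow> 'a) \<Rightarrow> 'a \<Rightarrow> 'a \<Rightarrow> bool"
  assumes "drel (c + 3 * m) (\<lambda>G e. R G (block c (3 * m) e))" "\<And>G s. R G (trunc (3 * m) s) = R G s" "i < c" "j < c"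
  shows "fo c (\<lambda>G e. \<forall>s. config n t m (edge G) (pverts G) s \<longrightarrow> R G s (e i) (e j))"
proof -
  have "fo c (\<lambda>G e. \<exists>s. config n t m (edge G) (pverts G) s \<and> \<not> R G s (e i) (e j))"
  proof (rule fo_ex_config)
    show "fo (c + 3 * m) (\<lambda>G e. \<not> R G (block c (3 * m) e) (e i) (e j))"
      using assms(3,4) by (intro fo_not drel_fo[OF assms(1)]) auto
    show "(\<lambda>s. \<not> R G s ((e(k := a)) i) ((e(k := a)) j)) = (\<lambda>s. \<not> R G s (e i) (e j))" if "c \<le> k" for G e k a
      using that assms(3,4) by simp
  qed (simp add: assms(2))
  from fo_not[OF this] show ?thesis by simp
qed

section \<open>Connection models\<close>

lemma awalk_iff: "pre_digraph.awalk (with_proj T) u p v \<longleftrightarrow> u \<in> pverts T \<and> set p \<subseteq> parcs T \<and> pcas u p v"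
  by (simp add: pre_digraph.awalk_def cas_with_proj_eq)

lemma pcas_append: "pcas u (p @ q) w \<longleftrightarrow> (\<exists>v. pcas u p v \<and> pcas v q w)"
  by (induction p arbitrary: u) auto

lemma length_pawalk_verts: "length (pawalk_verts u p) = Suc (length p)"
  by (induction p arbitrary: u) auto

lemma pair_fin_digraph_wf: "pair_fin_digraph T \<Longrightarrow> (x, y) \<in> parcs T \<Longrightarrow> x \<in> pverts T \<and> y \<in> pverts T"
  using pair_wf_digraph.wellformed' pair_fin_digraph.axioms(1) by metis

lemma reachable_iff:
  assumes "pair_fin_digraph T"
  shows "x \<rightarrow>\<^sup>*\<^bsub>with_proj T\<^esub> y \<longleftrightarrow> x \<in> pverts T \<and> (x, y) \<in> (parcs T)\<^sup>*"
proof
  interpret wf_digraph "with_proj T"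
    using assms pair_fin_digraph.axioms(1) wf_digraph_wp_iff by blast
  assume "x \<rightarrow>\<^sup>*\<^bsub>with_proj T\<^esub> y"
  then show "x \<in> pverts T \<and> (x, y) \<in> (parcs T)\<^sup>*"
    using reachable_rtranclI[of "with_proj T" x y] reachable_in_verts(1) by simp
next
  interpret wf_digraph "with_proj T"
    using assms pair_fin_digraph.axioms(1) wf_digraph_wp_iff by blast
  assume h: "x \<in> pverts T \<and> (x, y) \<in> (parcs T)\<^sup>*"
  then have "(x, y) \<in> (parcs T)\<^sup>*" by blast
  then show "x \<rightarrow>\<^sup>*\<^bsub>with_proj T\<^esub> y"
  proof induction
    case base
    then show ?case using h by simp
  next
    case (step y z)
    then show ?case using reachable_adj_trans[of x y z] by simp
  qed
qed

lemma rtrancl_pcas: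
  assumes "(x, y) \<in> R\<^sup>*"
  shows "\<exists>p. set p \<subseteq> R \<and> pcas x p y"
  using assms
proof induction
  case base
  then show ?case by (intro exI[of _ "[]"]) simp
next
  case (step y z)
  then obtain p where "set p \<subseteq> R" "pcas x p y" by blast
  then show ?case using step.hyps by (intro exI[of _ "p @ [(y, z)]"]) (auto simp: pcas_append)
qed

locale rtree =
  fixes T :: "'a pair_pre_digraph" and r :: 'a
  assumes tree: "rooted_tree T r"
begin

lemma fin: "pair_fin_digraph T" using tree by (simp add: rooted_tree_def)

lemma unique_walk:
  assumes "set p \<subseteq> parcs T" "pcas r p x" "set q \<subseteq> parcs T" "pcas r q x" "x \<in> pverts T"
  shows "p = q"
proof -
  have "r \<in> pverts T" "\<exists>!p. pre_digraph.awalk (with_proj T) r p x"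
    using tree assms(5) unfolding rooted_tree_def by blast+
  moreover from this have "pre_digraph.awalk (with_proj T) r p x" "pre_digraph.awalk (with_proj T) r q x"
    using assms(1-4) unfolding awalk_iff by simp_all
  ultimately show ?thesis by (elim ex1E) metis
qed

lemma ex_walk:
  assumes "x \<in> pverts T"
  shows "\<exists>p. set p \<subseteq> parcs T \<and> pcas r p x"
  using tree assms unfolding rooted_tree_def awalk_iff by blast

text \<open>Root walks to two parents of z extend to root walks to z, which must be equal.\<close>

lemma parent_unique:
  assumes "(x, z) \<in> parcs T" "(y, z) \<in> parcs T"
  shows "x = y"
proof -
  note wf = pair_fin_digraph_wf[OF fin]
  obtain p where p: "set p \<subseteq> parcs T" "pcas r p x" using ex_walk[of x] wf[OF assms(1)] by blast
  obtain q where q: "set q \<subseteq> parcs T" "pcas r q y" using ex_walk[of y] wf[OF assms(2)] by blast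
  note pq = p q
  have "p @ [(x, z)] = q @ [(y, z)]"
  proof (rule unique_walk)
    show "pcas r (p @ [(x, z)]) z" "pcas r (q @ [(y, z)]) z" using pq by (auto simp: pcas_append)
    show "z \<in> pverts T" using wf[OF assms(1)] by blast
  qed (use pq assms in auto)
  then show ?thesis by simp
qed

lemma no_cycle:
  assumes "(x, y) \<in> parcs T" "(y, x) \<in> (parcs T)\<^sup>*"
  shows False
proof -
  have x: "x \<in> pverts T" using pair_fin_digraph_wf[OF fin] assms by blast
  obtain p where p: "set p \<subseteq> parcs T" "pcas r p x" using ex_walk[OF x] by blast
  obtain q where q: "set q \<subseteq> parcs T" "pcas y q x" using rtrancl_pcas[OF assms(2)] by blast
  have "p = p @ (x, y) # q"
  proof (rule unique_walk[OF _ _ _ _ x])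
    show "pcas r (p @ (x, y) # q) x" using p q by (auto simp: pcas_append)
  qed (use p q assms(1) in auto)
  then show False by simp
qed

lemma ancestors_comparable:
  assumes "(x, u) \<in> (parcs T)\<^sup>*" "(y, u) \<in> (parcs T)\<^sup>*"
  shows "(x, y) \<in> (parcs T)\<^sup>* \<or> (y, x) \<in> (parcs T)\<^sup>*"
  using assms
proof (induction rule: rtrancl_induct)
  case (step v u)
  from step.prems show ?case
  proof (cases rule: rtranclE)
    case base
    then show ?thesis using step.hyps by (auto intro: rtrancl_into_rtrancl)
  next
    case (step w)
    then have "w = v" using parent_unique \<open>(v, u) \<in> parcs T\<close> by blast
    then show ?thesis using step(1) \<open>(y, v) \<in> (parcs T)\<^sup>* \<Longrightarrow> _\<close> by blast
  qed
qed simp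

lemma child_parent:
  assumes "(x, a) \<in> parcs T" "(y, a) \<in> (parcs T)\<^sup>*" "y \<noteq> a"
  shows "(y, x) \<in> (parcs T)\<^sup>*"
  using assms(2)
proof (cases rule: rtranclE)
  case base
  then show ?thesis using assms(3) by simp
next
  case (step w)
  then show ?thesis using parent_unique[OF assms(1)] by blast
qed

lemma children_disjoint:
  assumes "(x, a) \<in> parcs T" "(x, b) \<in> parcs T" "(a, v) \<in> (parcs T)\<^sup>*" "(b, v) \<in> (parcs T)\<^sup>*"
  shows "a = b"
proof (rule ccontr)
  assume "a \<noteq> b"
  then have "(a, x) \<in> (parcs T)\<^sup>* \<or> (b, x) \<in> (parcs T)\<^sup>*"
    using ancestors_comparable[OF assms(3,4)] child_parent[OF assms(1), of b] child_parent[OF assms(2), of a] by blast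
  then show False using no_cycle assms(1,2) by blast
qed

text \<open>A common ancestor at or below the child a would put v below both a and b. So every
  common ancestor is strictly above a, hence at or above x.\<close>

lemma lca_children:
  assumes "(x, a) \<in> parcs T" "(x, b) \<in> parcs T" "(a, u) \<in> (parcs T)\<^sup>*" "(b, v) \<in> (parcs T)\<^sup>*" "a \<noteq> b"
  shows "is_lca T u v x"
proof -
  have x: "x \<in> pverts T" using pair_fin_digraph_wf[OF fin] assms by blast
  have "(y, x) \<in> (parcs T)\<^sup>*" if y: "(y, u) \<in> (parcs T)\<^sup>*" "(y, v) \<in> (parcs T)\<^sup>*" for y
  proof (cases "(a, y) \<in> (parcs T)\<^sup>*")
    case True
    then have "(a, v) \<in> (parcs T)\<^sup>*" using y(2) by simp
    then show ?thesis using children_disjoint[OF assms(1,2) _ assms(4)] assms(5) by blast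
  next
    case False
    then have "(y, a) \<in> (parcs T)\<^sup>*" "y \<noteq> a" using ancestors_comparable[OF assms(3) y(1)] by auto
    then show ?thesis using child_parent[OF assms(1)] by blast
  qed
  then show ?thesis
    unfolding is_lca_def reachable_iff[OF fin] using x assms(1-4) by (auto intro: converse_rtrancl_into_rtrancl)
qed

text \<open>The parts are the sets of leaves below the children of x. Vertices in different parts
  have x as their least common ancestor, so \<open>Adj x\<close> and the labels decide their
  adjacency.\<close>

lemma subtree_shrub:
  assumes E: "\<And>u v x. u \<in> leaves T \<Longrightarrow> v \<in> leaves T \<Longrightarrow> u \<noteq> v \<Longrightarrow> x \<in> pverts T \<Longrightarrow> is_lca T u v x \<Longrightarrow>
      E u v \<longleftrightarrow> (label u, label v) \<in> Adj x"
    and k: "card (label ` leaves T) \<le> k"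
    and x: "x \<in> pverts T"
    and h: "\<And>p v. v \<in> leaves T \<Longrightarrow> set p \<subseteq> parcs T \<Longrightarrow> pcas x p v \<Longrightarrow> length p \<le> h"
  shows "shrub h k E {v \<in> leaves T. (x, v) \<in> (parcs T)\<^sup>*}"
  using x h
proof (induction h arbitrary: x)
  case 0
  have "v = x" if v: "v \<in> leaves T" and xv: "(x, v) \<in> (parcs T)\<^sup>*" for v
  proof -
    obtain p where "set p \<subseteq> parcs T" "pcas x p v" using rtrancl_pcas[OF xv] by blast
    then show ?thesis using 0(2)[OF v] by fastforce
  qed
  then have "u = v" if "u \<in> {v \<in> leaves T. (x, v) \<in> (parcs T)\<^sup>*}" "v \<in> {v \<in> leaves T. (x, v) \<in> (parcs T)\<^sup>*}" for u v
    using that by blast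
  then show ?case unfolding shrub.simps by blast
next
  case (Suc h)
  let ?R = "(parcs T)\<^sup>*"
  let ?A = "\<lambda>x. {v \<in> leaves T. (x, v) \<in> ?R}"
  have finl: "finite (leaves T)"
    using pair_fin_digraph.pair_finite_verts[OF fin] by (rule finite_subset[rotated]) (auto simp: leaves_def)
  show ?case
  proof (cases "x \<in> leaves T")
    case True
    \<comment> \<open>A leaf may lie above the maximal depth; the remaining cuts of its single
      vertex are trivial.\<close>
    have "v = x" if "(x, v) \<in> ?R" for v
      using that True by (cases rule: converse_rtranclE) (auto simp: leaves_def)
    then have A: "?A x = {x}" using True by auto
    have "length p \<le> h" if p: "v \<in> leaves T" "set p \<subseteq> parcs T" "pcas x p v" for p v
    proof (cases p)
      case (Cons a q)
      then have "(x, snd a) \<in> parcs T" using p by (cases a) auto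
      then show ?thesis using True by (auto simp: leaves_def)
    qed simp
    then have IH: "shrub h k E (?A x)" by (rule Suc.IH[OF Suc.prems(1)])
    have "card (label ` ?A x) \<le> card (label ` leaves T)" using finl by (intro card_mono) auto
    then have "card (label ` ?A x) \<le> k" using k by linarith
    then show ?thesis
    proof (rule shrub_SucI[where part = "\<lambda>v. x", rotated 2])
      show "dices E (?A x) label (\<lambda>v. x)" by (simp add: dices_def)
      show "finite (?A x)" using finl by simp
      show "shrub h k E {b \<in> ?A x. x = x}" using IH by simp
    qed
  next
    case False
    have "\<exists>y. (x, y) \<in> parcs T \<and> (y, v) \<in> ?R" if "v \<in> ?A x" for v
    proof -
      have "(x, v) \<in> ?R" "x \<noteq> v" using that False by auto
      then show ?thesis by (metis converse_rtranclE)
    qed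
    then have "\<forall>v. \<exists>y. v \<in> ?A x \<longrightarrow> (x, y) \<in> parcs T \<and> (y, v) \<in> ?R" by blast
    then obtain part where part: "\<And>v. v \<in> ?A x \<Longrightarrow> (x, part v) \<in> parcs T \<and> (part v, v) \<in> ?R"
      unfolding choice_iff by blast
    show ?thesis
    proof (rule shrub_SucI[where lab = label and part = part])
      show "finite (?A x)" using finl by simp
      have "card (label ` ?A x) \<le> card (label ` leaves T)" using finl by (intro card_mono) auto
      then show "card (label ` ?A x) \<le> k" using k by linarith
      have e: "E u v \<longleftrightarrow> (label u, label v) \<in> Adj x" if h: "u \<in> ?A x" "v \<in> ?A x" "part u \<noteq> part v" for u v
      proof -
        have "is_lca T u v x" using part[OF h(1)] part[OF h(2)] h(3) by (intro lca_children) auto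
        then show ?thesis using E[of u v x] h Suc.prems(1) by auto
      qed
      show "dices E (?A x) label part"
        unfolding dices_def
      proof (intro ballI impI)
        fix u v u' v' assume h: "u \<in> ?A x" "v \<in> ?A x" "u' \<in> ?A x" "v' \<in> ?A x" "part u \<noteq> part v"
          "part u' \<noteq> part v'" "label u = label u'" "label v = label v'"
        show "E u v = E u' v'" using e[OF h(1,2,5)] e[OF h(3,4,6)] h(7,8) by simp
      qed
      fix a assume a: "a \<in> ?A x"
      note pa = part[OF a]
      show "shrub h k E {b \<in> ?A x. part b = part a}"
      proof (rule shrub_subset)
        show "shrub h k E (?A (part a))"
        proof (rule Suc.IH)
          show "part a \<in> pverts T" using pa pair_fin_digraph_wf[OF fin] by blast
          fix p v assume p: "v \<in> leaves T" "set p \<subseteq> parcs T" "pcas (part a) p v"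
          have "length ((x, part a) # p) \<le> Suc h" using p pa by (intro Suc.prems(2)) auto
          then show "length p \<le> h" by simp
        qed
        show "{b \<in> ?A x. part b = part a} \<subseteq> ?A (part a)"
        proof
          fix b assume b: "b \<in> {b \<in> ?A x. part b = part a}"
          then show "b \<in> ?A (part a)" using part[of b] by simp
        qed
      qed
    qed
  qed
qed

text \<open>There is one root walk per leaf, so the maximum is over a finite set. The successor
  appears because p lists arcs while depth counts nodes.\<close>

lemma tree_depth_walk:
  assumes "x \<in> leaves T" "set p \<subseteq> parcs T" "pcas r p x"
  shows "Suc (length p) \<le> tree_depth T r"
proof -
  let ?S = "{length (pawalk_verts r p) | p x. x \<in> leaves T \<and> pre_digraph.awalk (with_proj T) r p x}"
  have r: "r \<in> pverts T" using tree by (simp add: rooted_tree_def)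
  have "?S \<subseteq> (\<lambda>x. length (pawalk_verts r (THE p. pre_digraph.awalk (with_proj T) r p x))) ` leaves T"
  proof
    fix l assume "l \<in> ?S"
    then obtain p x where l: "l = length (pawalk_verts r p)" "x \<in> leaves T" "pre_digraph.awalk (with_proj T) r p x"
      by blast
    have "\<exists>!p. pre_digraph.awalk (with_proj T) r p x"
      using tree l(2) unfolding rooted_tree_def leaves_def by blast
    then have "(THE p. pre_digraph.awalk (with_proj T) r p x) = p" using l(3) by (rule the1_equality)
    then show "l \<in> (\<lambda>x. length (pawalk_verts r (THE p. pre_digraph.awalk (with_proj T) r p x))) ` leaves T"
      using l(1,2) by (intro image_eqI[of _ _ x]) simp_all
  qed
  moreover have "finite (leaves T)"
    using pair_fin_digraph.pair_finite_verts[OF fin] by (rule finite_subset[rotated]) (auto simp: leaves_def)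
  ultimately have "finite ?S" using finite_subset by blast
  moreover have "length (pawalk_verts r p) \<in> ?S" using assms r unfolding awalk_iff by blast
  ultimately have "length (pawalk_verts r p) \<le> Max ?S" by (rule Max_ge)
  then show ?thesis unfolding tree_depth_def length_pawalk_verts .
qed

end

lemma connection_model_shrub:
  assumes c: "connection_model G Labels label T r Adj" and d: "tree_depth T r \<le> Suc h"
  shows "shrub h (card Labels) (edge G) (pverts G)"
proof -
  interpret rtree T r using c by unfold_locales (simp add: connection_model_def)
  have lv: "leaves T = pverts G" using c by (simp add: connection_model_def)
  have r: "r \<in> pverts T" using tree by (simp add: rooted_tree_def)
  have "shrub h (card Labels) (edge G) {v \<in> leaves T. (r, v) \<in> (parcs T)\<^sup>*}"
  proof (rule subtree_shrub[OF _ _ r])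
    show "edge G u v \<longleftrightarrow> (label u, label v) \<in> Adj x" if "u \<in> leaves T" "v \<in> leaves T" "u \<noteq> v" "is_lca T u v x" for u v x
      using c that unfolding connection_model_def edge_def by blast
    show "card (label ` leaves T) \<le> card Labels"
      using c unfolding connection_model_def by (intro card_mono) auto
    show "length p \<le> h" if "v \<in> leaves T" "set p \<subseteq> parcs T" "pcas r p v" for p v
      using tree_depth_walk[OF that] d by simp
  qed
  moreover have "{v \<in> leaves T. (r, v) \<in> (parcs T)\<^sup>*} = leaves T"
  proof -
    have "(r, v) \<in> (parcs T)\<^sup>*" if "v \<in> leaves T" for v
    proof -
      have "\<exists>p. pre_digraph.awalk (with_proj T) r p v"
        using tree that unfolding rooted_tree_def leaves_def by blast
      then have "r \<rightarrow>\<^sup>*\<^bsub>with_proj T\<^esub> v"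
        using wf_digraph.reachable_awalk wf_digraph_wp_iff fin pair_fin_digraph.axioms(1) by metis
      then show ?thesis using reachable_iff[OF fin] by blast
    qed
    then show ?thesis by blast
  qed
  ultimately show ?thesis using lv by simp
qed

section \<open>From iterated dicings to tree models\<close>

lemma rooted_treeI:
  assumes fin: "finite (pverts T)" and wf: "parcs T \<subseteq> pverts T \<times> pverts T" and r: "r \<in> pverts T"
    and reach: "\<And>x. x \<in> pverts T \<Longrightarrow> (r, x) \<in> (parcs T)\<^sup>*"
    and root: "\<And>x. (x, r) \<notin> parcs T"
    and parent: "\<And>x y z. (x, z) \<in> parcs T \<Longrightarrow> (y, z) \<in> parcs T \<Longrightarrow> x = y"
  shows "rooted_tree T r"
  unfolding rooted_tree_def
proof (intro conjI ballI)
  show "pair_fin_digraph T"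
    using fin wf finite_subset[OF wf] by unfold_locales auto
  show "r \<in> pverts T" by (rule r)
  have u: "p = q" if "set p \<subseteq> parcs T" "pcas r p x" "set q \<subseteq> parcs T" "pcas r q x" for p q x
    using that
  proof (induction p arbitrary: x q rule: rev_induct)
    case Nil
    then have "pcas r q r" by simp
    then show ?case using Nil(3) root by (cases q rule: rev_cases) (auto simp: pcas_append)
  next
    case (snoc a p)
    then have a: "pcas r p (fst a)" "snd a = x" "a \<in> parcs T" by (auto simp: pcas_append)
    show ?case
    proof (cases q rule: rev_cases)
      case Nil
      then show ?thesis using a snoc.prems(4) root[of "fst a"] by (cases a) auto
    next
      case (snoc q' b)
      then have b: "pcas r q' (fst b)" "snd b = x" "b \<in> parcs T" using \<open>pcas r q x\<close> \<open>set q \<subseteq> parcs T\<close> by (auto simp: pcas_append)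
      have "a = b" using a b parent[of "fst a" x "fst b"] by (cases a; cases b) auto
      moreover have "p = q'"
        using snoc.IH[OF _ a(1), of q'] \<open>set (p @ [a]) \<subseteq> parcs T\<close> \<open>set q \<subseteq> parcs T\<close> b(1) \<open>a = b\<close> snoc by auto
      ultimately show ?thesis using snoc by simp
    qed
  qed
  fix x assume "x \<in> pverts T"
  then obtain p where "set p \<subseteq> parcs T" "pcas r p x" using rtrancl_pcas reach by metis
  then show "\<exists>!p. pre_digraph.awalk (with_proj T) r p x"
    unfolding awalk_iff using u r by blast
qed

text \<open>A tree written as nested equivalence relations: \<open>cl i a\<close> is the class of a
  at height i, and the list \<open>lab a\<close> holds one label for each cut.\<close>

definition level_model ::
  "nat \<Rightarrow> nat \<Rightarrow> ('a \<Rightarrow> 'a \<Rightarrow> bool) \<Rightarrow> 'a set \<Rightarrow> (nat \<Rightarrow> 'a \<Rightarrow> 'a set) \<Rightarrow> ('a \<Rightarrow> nat list) \<Rightarrow> bool"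
where
  "level_model h k E A cl lab \<longleftrightarrow>
     (\<forall>i\<le>h. \<forall>a\<in>A. a \<in> cl i a \<and> cl i a \<subseteq> A) \<and>
     (\<forall>i\<le>h. \<forall>a\<in>A. \<forall>b\<in>cl i a. cl i b = cl i a) \<and>
     (\<forall>i<h. \<forall>a\<in>A. cl i a \<subseteq> cl (Suc i) a) \<and>
     (\<forall>a\<in>A. cl h a = A) \<and> (\<forall>a\<in>A. cl 0 a = {a}) \<and>
     (\<forall>a\<in>A. length (lab a) = h \<and> set (lab a) \<subseteq> {..<k}) \<and>
     (\<forall>i<h. \<forall>u\<in>A. \<forall>v\<in>A. \<forall>u'\<in>A. \<forall>v'\<in>A. cl (Suc i) u = cl (Suc i) v \<longrightarrow> cl (Suc i) u' = cl (Suc i) u \<longrightarrow>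
        cl (Suc i) v' = cl (Suc i) u \<longrightarrow> cl i u \<noteq> cl i v \<longrightarrow> cl i u' \<noteq> cl i v' \<longrightarrow> lab u = lab u' \<longrightarrow>
        lab v = lab v' \<longrightarrow> (E u v \<longleftrightarrow> E u' v'))"

lemmas level_modelD =
  level_model_def[THEN iffD1, THEN conjunct1, rule_format, THEN conjunct1]
  level_model_def[THEN iffD1, THEN conjunct1, rule_format, THEN conjunct2]
  level_model_def[THEN iffD1, THEN conjunct2, THEN conjunct1, rule_format]
  level_model_def[THEN iffD1, THEN conjunct2, THEN conjunct2, THEN conjunct1, rule_format]
  level_model_def[THEN iffD1, THEN conjunct2, THEN conjunct2, THEN conjunct2, THEN conjunct1, rule_format]
  level_model_def[THEN iffD1, THEN conjunct2, THEN conjunct2, THEN conjunct2, THEN conjunct2, THEN conjunct1, rule_format]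
  level_model_def[THEN iffD1, THEN conjunct2, THEN conjunct2, THEN conjunct2, THEN conjunct2, THEN conjunct2, THEN conjunct1, rule_format, THEN conjunct1]
  level_model_def[THEN iffD1, THEN conjunct2, THEN conjunct2, THEN conjunct2, THEN conjunct2, THEN conjunct2, THEN conjunct1, rule_format, THEN conjunct2]
  level_model_def[THEN iffD1, THEN conjunct2, THEN conjunct2, THEN conjunct2, THEN conjunct2, THEN conjunct2, THEN conjunct2, rule_format]

lemma shrub_level_model:
  assumes "shrub h k E A"
  shows "\<exists>cl lab. level_model h k E A cl lab"
  using assms
proof (induction h arbitrary: A)
  case 0
  then show ?case
    by (intro exI[of _ "\<lambda>i a. {a}"] exI[of _ "\<lambda>a. []"]) (auto simp: level_model_def)
next
  case (Suc h)
  obtain lab0 part :: "'a \<Rightarrow> nat" where l: "lab0 ` A \<subseteq> {..<k}" and d: "dices E A lab0 part"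
    and s: "\<And>p. shrub h k E {a \<in> A. part a = p}" using Suc.prems unfolding shrub.simps by blast
  let ?B = "\<lambda>p. {a \<in> A. part a = p}"
  have "\<forall>p. \<exists>cl lab. level_model h k E (?B p) cl lab" using Suc.IH s by blast
  then obtain c where "\<forall>p. \<exists>lab. level_model h k E (?B p) (c p) lab" by (rule choice[THEN exE])
  then obtain lb where "\<forall>p. level_model h k E (?B p) (c p) (lb p)" by (rule choice[THEN exE])
  then have m: "level_model h k E (?B p) (c p) (lb p)" for p by (rule spec)
  note M = level_modelD[OF m]
  define cl where "cl i a = (if i \<le> h then c (part a) i a else A)" for i a
  define lab where "lab a = lab0 a # lb (part a) a" for a
  have aB: "a \<in> ?B (part a)" if "a \<in> A" for a using that by simp
  have in1: "a \<in> c (part a) i a \<and> c (part a) i a \<subseteq> ?B (part a)" if "a \<in> A" "i \<le> h" for a i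
    using M(1,2)[OF that(2) aB[OF that(1)]] by simp
  have top: "c (part a) h a = ?B (part a)" if "a \<in> A" for a
    using M(5)[OF aB[OF that]] by simp
  show ?case
  proof (intro exI[of _ cl] exI[of _ lab])
    show "level_model (Suc h) k E A cl lab"
      unfolding level_model_def
    proof (intro conjI allI impI ballI)
      fix i a assume "i \<le> Suc h" "a \<in> A"
      then show "a \<in> cl i a" "cl i a \<subseteq> A" using in1[of a i] by (auto simp: cl_def)
    next
      fix i a b assume h: "i \<le> Suc h" "a \<in> A" "b \<in> cl i a"
      show "cl i b = cl i a"
      proof (cases "i \<le> h")
        case True
        then have b: "b \<in> c (part a) i a" using h(3) by (simp add: cl_def)
        then have "part b = part a" using in1[OF h(2) True] by auto
        moreover have "c (part a) i b = c (part a) i a" using M(3)[OF True aB[OF h(2)] b] .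
        ultimately show ?thesis using True by (simp add: cl_def)
      qed (simp add: cl_def)
    next
      fix i a assume h: "i < Suc h" "a \<in> A"
      show "cl i a \<subseteq> cl (Suc i) a"
      proof (cases "i < h")
        case True
        then have "c (part a) i a \<subseteq> c (part a) (Suc i) a" using M(4)[OF True aB[OF h(2)]] by simp
        then show ?thesis using True by (simp add: cl_def)
      next
        case False
        then have "i = h" using h(1) by simp
        then show ?thesis using in1[OF h(2), of h] by (auto simp: cl_def)
      qed
    next
      fix a assume a: "a \<in> A"
      show "cl (Suc h) a = A" by (simp add: cl_def)
      show "cl 0 a = {a}" using M(6)[OF aB[OF a]] by (simp add: cl_def)
      have "length (lb (part a) a) = h \<and> set (lb (part a) a) \<subseteq> {..<k}" using M(7,8)[OF aB[OF a]] by simp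
      then show "length (lab a) = Suc h" "set (lab a) \<subseteq> {..<k}" using l a by (auto simp: lab_def)
    next
      fix i u v u' v'
      assume h: "i < Suc h" "u \<in> A" "v \<in> A" "u' \<in> A" "v' \<in> A" "cl (Suc i) u = cl (Suc i) v"
        "cl (Suc i) u' = cl (Suc i) u" "cl (Suc i) v' = cl (Suc i) u" "cl i u \<noteq> cl i v" "cl i u' \<noteq> cl i v'"
        "lab u = lab u'" "lab v = lab v'"
      show "E u v \<longleftrightarrow> E u' v'"
      proof (cases "i < h")
        case True
        \<comment> \<open>Below the top, a common class implies a common part, so a single inner
          model covers all four vertices.\<close>
        have p: "part w = part u" if "w \<in> A" "cl (Suc i) w = cl (Suc i) u" for w
        proof -
          have "w \<in> cl (Suc i) u" using in1[OF that(1), of "Suc i"] that(2) True by (auto simp: cl_def)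
          then show ?thesis using in1[OF h(2), of "Suc i"] True by (auto simp: cl_def)
        qed
        have pp: "part v = part u" "part u' = part u" "part v' = part u"
          by (rule p[OF h(3) h(6)[symmetric]], rule p[OF h(4,7)], rule p[OF h(5,8)])
        show ?thesis
          by (rule level_modelD(9)[OF m[of "part u"], of i]) (use True h pp in \<open>simp_all add: cl_def lab_def\<close>)
      next
        case False
        then have i: "i = h" using h(1) by simp
        have pc: "part u = part v \<Longrightarrow> cl h u = cl h v" if "u \<in> A" "v \<in> A" for u v
          using top[OF that(1)] top[OF that(2)] by (simp add: cl_def)
        show ?thesis
        proof (rule dicesD[OF d])
          show "part u \<noteq> part v" "part u' \<noteq> part v'" using pc h i by blast+
          show "lab0 u = lab0 u'" "lab0 v = lab0 v'" using h by (simp_all add: lab_def)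
        qed (use h in simp_all)
      qed
    qed
  qed
qed

text \<open>Tree nodes have the type of the vertices, and the leaves must be the vertices
  themselves. So the singleton classes at height 0 keep their elements, and all other nodes get
  elements outside A.\<close>

lemma ex_node_names:
  fixes A :: "'a::infinite set"
  assumes "finite (N :: (nat \<times> 'a set) set)" "finite A"
  shows "\<exists>f :: nat \<times> 'a set \<Rightarrow> 'a. inj_on f (N \<union> (\<lambda>a. (0, {a})) ` A) \<and> (\<forall>a\<in>A. f (0, {a}) = a)"
proof -
  let ?N = "N - (\<lambda>a. (0, {a})) ` A"
  have "infinite (- A)" using assms(2) infinite_UNIV by (simp add: Compl_eq_Diff_UNIV)
  then obtain B where B: "B \<subseteq> - A" "finite B" "card B = card ?N"
    using infinite_arbitrarily_large by blast
  have "finite ?N" using assms(1) by simp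
  then obtain g where g: "bij_betw g ?N B" using B finite_same_card_bij by metis
  define f where "f x = (if x \<in> (\<lambda>a. (0, {a})) ` A then the_elem (snd x) else g x)" for x
  have fA: "f (0, {a}) = a" if "a \<in> A" for a using that by (simp add: f_def)
  have fN: "f x \<in> - A" "f x = g x" if "x \<in> ?N" for x
  proof -
    show "f x = g x" using that by (simp add: f_def)
    then show "f x \<in> - A" using g B(1) that unfolding bij_betw_def by auto
  qed
  have "inj_on f (?N \<union> (\<lambda>a. (0, {a})) ` A)"
    unfolding inj_on_Un
  proof (intro conjI)
    show "inj_on f ?N" using g fN(2) unfolding bij_betw_def inj_on_def by simp
    show "inj_on f ((\<lambda>a. (0, {a})) ` A)" by (rule inj_onI) (auto simp: fA)
    show "f ` (?N - (\<lambda>a. (0, {a})) ` A) \<inter> f ` ((\<lambda>a. (0, {a})) ` A - ?N) = {}"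
    proof -
      have "f x \<notin> A" if "x \<in> ?N" for x using fN(1)[OF that] by simp
      then show ?thesis by (auto simp: fA)
    qed
  qed
  moreover have "N \<union> (\<lambda>a. (0, {a})) ` A = ?N \<union> (\<lambda>a. (0, {a})) ` A" by blast
  ultimately show ?thesis using fA by metis
qed


locale level_tree =
  fixes h k :: nat and E :: "'a::infinite \<Rightarrow> 'a \<Rightarrow> bool" and A :: "'a set" and cl :: "nat \<Rightarrow> 'a \<Rightarrow> 'a set"
    and lab :: "'a \<Rightarrow> nat list" and f :: "nat \<times> 'a set \<Rightarrow> 'a"
  assumes M: "level_model h k E A cl lab" and finA: "finite A" and A_ne: "A \<noteq> {}" and symE: "sym_on_set E A"
    and inj: "\<And>i j a b. i \<le> h \<Longrightarrow> j \<le> h \<Longrightarrow> a \<in> A \<Longrightarrow> b \<in> A \<Longrightarrow> f (i, cl i a) = f (j, cl j b) \<Longrightarrow> i = j \<and> cl i a = cl j b"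
    and f0: "\<And>a. a \<in> A \<Longrightarrow> f (0, {a}) = a"
begin

text \<open>The height belongs to the name: a class that persists over several heights gives a chain
  of distinct nodes, and all leaves have the same depth.\<close>

definition node :: "nat \<Rightarrow> 'a \<Rightarrow> 'a" where
  "node i a = f (i, cl i a)"

definition T :: "'a pair_pre_digraph" where
  "T = \<lparr> pverts = {node i a | i a. i \<le> h \<and> a \<in> A}, parcs = {(node (Suc i) a, node i a) | i a. i < h \<and> a \<in> A} \<rparr>"

definition root :: 'a where
  "root = node h (SOME a. a \<in> A)"

lemmas D = level_modelD[OF M]

lemma node_eq: "i \<le> h \<Longrightarrow> j \<le> h \<Longrightarrow> a \<in> A \<Longrightarrow> b \<in> A \<Longrightarrow> node i a = node j b \<longleftrightarrow> i = j \<and> cl i a = cl j b"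
proof
  assume "i \<le> h" "j \<le> h" "a \<in> A" "b \<in> A" "node i a = node j b"
  then show "i = j \<and> cl i a = cl j b" unfolding node_def by (rule inj)
next
  assume "i = j \<and> cl i a = cl j b"
  then have "(i, cl i a) = (j, cl j b)" unfolding prod.inject .
  then show "node i a = node j b" unfolding node_def by (simp only:)
qed

lemma node_0: "a \<in> A \<Longrightarrow> node 0 a = a"
  unfolding node_def using D(6) f0 by simp

lemma root_eq: "a \<in> A \<Longrightarrow> node h a = root"
  unfolding root_def node_def using D(5) someI[of "\<lambda>a. a \<in> A" a] by simp

lemma cl_up1: "i < h \<Longrightarrow> a \<in> A \<Longrightarrow> b \<in> A \<Longrightarrow> cl i a = cl i b \<Longrightarrow> cl (Suc i) a = cl (Suc i) b"
proof -
  assume h: "i < h" "a \<in> A" "b \<in> A" "cl i a = cl i b"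
  have "b \<in> cl i b" using D(1) h by simp
  then have "b \<in> cl (Suc i) a" using D(4)[OF h(1,2)] h(4) by blast
  then show ?thesis using D(3)[of "Suc i" a b] h by simp
qed

lemma cl_up: "i \<le> j \<Longrightarrow> j \<le> h \<Longrightarrow> a \<in> A \<Longrightarrow> b \<in> A \<Longrightarrow> cl i a = cl i b \<Longrightarrow> cl j a = cl j b"
proof (induction j rule: dec_induct)
  case (step j)
  then show ?case using cl_up1[of j a b] by simp
qed simp

lemma arcI: "i < h \<Longrightarrow> a \<in> A \<Longrightarrow> (node (Suc i) a, node i a) \<in> parcs T"
  unfolding T_def by simp blast

lemma nodeI: "i \<le> h \<Longrightarrow> a \<in> A \<Longrightarrow> node i a \<in> pverts T"
  unfolding T_def by simp blast

lemma nodeE: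
  assumes "x \<in> pverts T"
  obtains i a where "x = node i a" "i \<le> h" "a \<in> A"
  using assms unfolding T_def by simp blast

lemma reach_down: "i \<le> j \<Longrightarrow> j \<le> h \<Longrightarrow> a \<in> A \<Longrightarrow> (node j a, node i a) \<in> (parcs T)\<^sup>*"
proof (induction j rule: dec_induct)
  case (step j)
  have "(node (Suc j) a, node j a) \<in> parcs T" using step.prems by (intro arcI) auto
  then show ?case using step by (auto intro: converse_rtrancl_into_rtrancl)
qed simp

lemma arcE:
  assumes "(x, y) \<in> parcs T"
  obtains i a where "i < h" "a \<in> A" "x = node (Suc i) a" "y = node i a"
  using assms unfolding T_def by simp blast

lemma reach_node:
  assumes "(node j b, y) \<in> (parcs T)\<^sup>*" "j \<le> h" "b \<in> A"
  shows "\<exists>i a. i \<le> j \<and> a \<in> A \<and> y = node i a \<and> cl j a = cl j b"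
  using assms(1)
proof induction
  case base
  then show ?case using assms by blast
next
  case (step y z)
  then obtain i a where ia: "i \<le> j" "a \<in> A" "y = node i a" "cl j a = cl j b" by blast
  obtain i0 a0 where z: "i0 < h" "a0 \<in> A" "y = node (Suc i0) a0" "z = node i0 a0"
    using step.hyps(2) by (rule arcE)
  have e: "i = Suc i0" "cl i a = cl (Suc i0) a0"
    using node_eq[of i "Suc i0" a a0] ia z assms(2) by auto
  have "cl j a0 = cl j a" using cl_up[of i j a0 a] e ia z assms(2) by simp
  then show ?case using z e ia by (intro exI[of _ i0] exI[of _ a0]) simp
qed

lemma walk_length:
  assumes "set p \<subseteq> parcs T" "pcas (node j b) p y" "j \<le> h" "b \<in> A"
  shows "\<exists>i a. a \<in> A \<and> y = node i a \<and> j = i + length p"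
  using assms
proof (induction p arbitrary: j b)
  case Nil
  then show ?case by (intro exI[of _ j] exI[of _ b]) simp
next
  case (Cons e p)
  then have e: "(node j b, snd e) \<in> parcs T" by (cases e) auto
  obtain i0 a0 where z: "i0 < h" "a0 \<in> A" "node j b = node (Suc i0) a0" "snd e = node i0 a0"
    using e by (rule arcE)
  have j: "j = Suc i0" using node_eq[of j "Suc i0" b a0] z Cons.prems by simp
  obtain i a where "a \<in> A" "y = node i a" "i0 = i + length p"
    using Cons.IH[of i0 a0] Cons.prems z by auto
  then show ?case using j by (intro exI[of _ i] exI[of _ a]) simp
qed

lemma finite_T: "finite (pverts T)"
proof -
  have "pverts T = (\<lambda>(i, a). node i a) ` ({..h} \<times> A)" unfolding T_def by auto
  then show ?thesis using finA by simp
qed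

lemma root_in: "root \<in> pverts T"
  using A_ne nodeI[of h] root_eq by fastforce

lemma rooted: "rooted_tree T root"
proof (rule rooted_treeI)
  show "finite (pverts T)" by (rule finite_T)
  show "parcs T \<subseteq> pverts T \<times> pverts T" by (auto elim!: arcE intro!: nodeI)
  show "root \<in> pverts T" by (rule root_in)
  show "(root, x) \<in> (parcs T)\<^sup>*" if "x \<in> pverts T" for x
  proof -
    obtain i a where "x = node i a" "i \<le> h" "a \<in> A" using \<open>x \<in> pverts T\<close> by (rule nodeE)
    then show ?thesis using reach_down[of i h a] root_eq by simp
  qed
  show "(x, root) \<notin> parcs T" for x
  proof
    assume "(x, root) \<in> parcs T"
    then obtain i a where "i < h" "a \<in> A" "root = node i a" by (rule arcE)
    then show False using node_eq[of h i a a] root_eq by simp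
  qed
  fix x y z assume xz: "(x, z) \<in> parcs T" and yz: "(y, z) \<in> parcs T"
  obtain i a where a: "i < h" "a \<in> A" "x = node (Suc i) a" "z = node i a" using xz by (rule arcE)
  obtain j b where b: "j < h" "b \<in> A" "y = node (Suc j) b" "z = node j b" using yz by (rule arcE)
  have "i = j" "cl i a = cl j b" using node_eq[of i j a b] a b by auto
  then show "x = y" using cl_up1[of i a b] a b by (simp add: node_def)
qed

lemma leaves_T: "leaves T = A"
proof
  show "leaves T \<subseteq> A"
  proof
    fix x assume x: "x \<in> leaves T"
    then have "x \<in> pverts T" unfolding leaves_def by blast
    then obtain i a where ia: "x = node i a" "i \<le> h" "a \<in> A" by (rule nodeE)
    show "x \<in> A"
    proof (cases i)
      case 0
      then show ?thesis using ia node_0 by simp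
    next
      case (Suc i')
      then have "(x, node i' a) \<in> parcs T" using ia arcI by simp
      then show ?thesis using x unfolding leaves_def by blast
    qed
  qed
  show "A \<subseteq> leaves T"
  proof
    fix a assume a: "a \<in> A"
    have "a = node 0 a" using node_0[OF a] by simp
    then have "a \<in> pverts T" using nodeI[of 0 a] a by simp
    moreover have "(a, y) \<notin> parcs T" for y
    proof
      assume "(a, y) \<in> parcs T"
      then obtain i b where "i < h" "b \<in> A" "a = node (Suc i) b" by (rule arcE)
      then show False using node_eq[of 0 "Suc i" a b] node_0[OF a] a by simp
    qed
    ultimately show "a \<in> leaves T" unfolding leaves_def by blast
  qed
qed

lemma depth_T: "tree_depth T root = Suc h"
proof -
  have len: "length (pawalk_verts root p) = Suc h" if lx: "x \<in> leaves T" and wx: "pre_digraph.awalk (with_proj T) root p x" for p x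
  proof -
    have x: "x \<in> A" using lx leaves_T by simp
    obtain i a where ia: "a \<in> A" "x = node i a" "h = i + length p"
      using walk_length[of p h x x] wx root_eq[OF x] x unfolding awalk_iff by auto
    then have "i = 0" using node_eq[of i 0 a x] node_0[OF x] x by simp
    then show ?thesis using ia by (simp add: length_pawalk_verts)
  qed
  obtain a where a: "a \<in> A" using A_ne by blast
  then have "a \<in> pverts T" using leaves_T unfolding leaves_def by blast
  then obtain p where p: "pre_digraph.awalk (with_proj T) root p a"
    using rooted unfolding rooted_tree_def by blast
  have "{length (pawalk_verts root p) | p x. x \<in> leaves T \<and> pre_digraph.awalk (with_proj T) root p x} = {Suc h}"
    using len p a leaves_T by fastforce
  then show ?thesis unfolding tree_depth_def by simp
qed

definition label :: "'a \<Rightarrow> nat" where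
  "label a = to_nat (lab a)"

text \<open>Recording the label pairs realised by an edge is enough, because by the last clause of
  \<open>level_model\<close> all pairs that meet at x with the same labels behave alike.\<close>

definition Adj :: "'a \<Rightarrow> (nat \<times> nat) set" where
  "Adj x = {(label u, label v) | u v. \<exists>i<h. u \<in> A \<and> v \<in> A \<and> x = node (Suc i) u \<and> cl (Suc i) u = cl (Suc i) v \<and>
     cl i u \<noteq> cl i v \<and> E u v}"

text \<open>If u and v still shared a class one height lower, its node would be a common ancestor
  below x. So x is the place where their classes first meet.\<close>

lemma lca_level:
  assumes lca: "is_lca T u v x" and uv: "u \<in> A" "v \<in> A" "u \<noteq> v"
  shows "\<exists>i<h. x = node (Suc i) u \<and> cl (Suc i) u = cl (Suc i) v \<and> cl i u \<noteq> cl i v"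
proof -
  have fin: "pair_fin_digraph T" using rooted by (simp add: rooted_tree_def)
  note L = lca[unfolded is_lca_def reachable_iff[OF fin]]
  have x: "x \<in> pverts T" "(x, u) \<in> (parcs T)\<^sup>*" "(x, v) \<in> (parcs T)\<^sup>*" using L by simp_all
  obtain i a where ia: "x = node i a" "i \<le> h" "a \<in> A" using x(1) by (rule nodeE)
  have c: "cl i w = cl i a" if w: "w \<in> A" "(x, w) \<in> (parcs T)\<^sup>*" for w
  proof -
    obtain i' a' where "i' \<le> i" "a' \<in> A" "w = node i' a'" "cl i a' = cl i a"
      using reach_node[of i a w] w ia by auto
    moreover from this have "i' = 0" "cl 0 w = cl i' a'" using node_eq[of 0 i' w a'] node_0[OF w(1)] w ia by auto
    then have "w = a'" using D(6) w(1) \<open>a' \<in> A\<close> by auto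
    ultimately show ?thesis by simp
  qed
  have cu: "cl i u = cl i a" "cl i v = cl i a" using c uv x by simp_all
  have xu: "x = node i u" using ia cu by (simp add: node_def)
  have "i \<noteq> 0"
  proof
    assume "i = 0"
    then have "cl 0 u = cl 0 v" using cu by simp
    then show False using D(6)[OF uv(1)] D(6)[OF uv(2)] uv(3) by simp
  qed
  then obtain i' where i': "i = Suc i'" by (cases i) auto
  have "cl i' u \<noteq> cl i' v"
  proof
    assume e: "cl i' u = cl i' v"
    have "node i' u \<in> pverts T" using ia i' uv by (intro nodeI) auto
    moreover have "(node i' u, u) \<in> (parcs T)\<^sup>*" using reach_down[of 0 i' u] node_0[OF uv(1)] uv ia i' by simp
    moreover have "(node i' u, v) \<in> (parcs T)\<^sup>*"
      using reach_down[of 0 i' v] node_0[OF uv(2)] uv ia i' e by (simp add: node_def)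
    ultimately have "(node i' u, x) \<in> (parcs T)\<^sup>*" using L by blast
    then obtain i2 a2 where "i2 \<le> i'" "a2 \<in> A" "x = node i2 a2" using reach_node[of i' u x] uv ia i' by auto
    then show False using node_eq[of i i2 u a2] xu i' ia uv by simp
  qed
  then show ?thesis using i' xu cu ia by (intro exI[of _ i']) simp
qed

lemma model:
  assumes G: "pverts G = A" "\<And>u v. u \<in> A \<Longrightarrow> v \<in> A \<Longrightarrow> E u v \<longleftrightarrow> (u, v) \<in> parcs G"
  shows "connection_model G (to_nat ` {xs :: nat list. set xs \<subseteq> {..<k} \<and> length xs = h}) label T root Adj"
  unfolding connection_model_def
proof (intro conjI ballI impI allI)
  let ?L = "to_nat ` {xs :: nat list. set xs \<subseteq> {..<k} \<and> length xs = h}"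
  show "finite ?L" using finite_lists_length_eq[of "{..<k}" h] by simp
  have lL: "label a \<in> ?L" if "a \<in> A" for a using D(7,8)[OF that] by (simp add: label_def)
  then show "label ` pverts G \<subseteq> ?L" using G(1) by blast
  show "rooted_tree T root" by (rule rooted)
  show "leaves T = pverts G" using leaves_T G(1) by simp
  show "Adj x \<subseteq> ?L \<times> ?L" for x unfolding Adj_def using lL by blast
  show "sym (Adj x)" for x
  proof (rule symI)
    fix a b assume "(a, b) \<in> Adj x"
    then obtain u v i where uv: "a = label u" "b = label v" "i < h" "u \<in> A" "v \<in> A" "x = node (Suc i) u"
      "cl (Suc i) u = cl (Suc i) v" "cl i u \<noteq> cl i v" "E u v" unfolding Adj_def by blast
    have "x = node (Suc i) v" using uv by (simp add: node_def)
    moreover have "E v u" using uv sym_on_setD[OF symE] by blast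
    ultimately show "(b, a) \<in> Adj x" unfolding Adj_def mem_Collect_eq
      using uv by (intro exI[of _ v] exI[of _ u] conjI exI[of _ i]) auto
  qed
  fix u v x assume uv: "u \<in> pverts G" "v \<in> pverts G" "u \<noteq> v" and lca: "is_lca T u v x"
  then have A: "u \<in> A" "v \<in> A" using G(1) by simp_all
  obtain i where i: "i < h" "x = node (Suc i) u" "cl (Suc i) u = cl (Suc i) v" "cl i u \<noteq> cl i v"
    using lca_level[OF lca A uv(3)] by blast
  have "E u v \<longleftrightarrow> (label u, label v) \<in> Adj x"
  proof
    assume "E u v"
    then show "(label u, label v) \<in> Adj x" unfolding Adj_def using i A by blast
  next
    assume "(label u, label v) \<in> Adj x"
    then obtain u' v' i' where uv': "label u = label u'" "label v = label v'" "i' < h" "u' \<in> A" "v' \<in> A" "x = node (Suc i') u'"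
      "cl (Suc i') u' = cl (Suc i') v'" "cl i' u' \<noteq> cl i' v'" "E u' v'" unfolding Adj_def by blast
    have "i' = i" "cl (Suc i) u' = cl (Suc i) u" using node_eq[of "Suc i'" "Suc i" u' u] uv' i A by auto
    moreover have "lab u = lab u'" "lab v = lab v'" using uv'(1,2) by (simp_all add: label_def)
    ultimately have "E u v \<longleftrightarrow> E u' v'" using uv' i A by (intro D(9)[of i]) auto
    then show "E u v" using uv'(9) by simp
  qed
  then show "(u, v) \<in> parcs G \<longleftrightarrow> (label u, label v) \<in> Adj x" using G(2)[OF A] by simp
qed

end

lemma sym_on_set_edge: "simple_graph G \<Longrightarrow> sym_on_set (edge G) A"
  unfolding simple_graph_def sym_on_set_def edge_def
  using pair_sym_digraph.pair_sym_arcs[of G] pair_graph.axioms(2)[of G] pair_pseudo_graph.axioms(2)[of G]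
  unfolding symmetric_def by (auto dest: symD)

lemma finite_pverts: "simple_graph G \<Longrightarrow> finite (pverts G)"
  unfolding simple_graph_def
  using pair_fin_digraph.pair_finite_verts[of G] pair_graph.axioms(2)[of G] pair_pseudo_graph.axioms(1)[of G] by blast

lemma shrub_shrubdepth:
  fixes C :: "'a::infinite pair_pre_digraph set"
  assumes "graph_class C" "\<And>G. G \<in> C \<Longrightarrow> shrub h k (edge G) (pverts G)"
  shows "shrubdepth_at_most C (Suc h)"
  unfolding shrubdepth_at_most_def
\<comment> \<open>The label set depends on h and k only: codes of lists with one number below k for
  each of the h cuts.\<close>
proof (intro exI[of _ "to_nat ` {xs :: nat list. set xs \<subseteq> {..<k} \<and> length xs = h}"] conjI ballI)
  show "finite (to_nat ` {xs :: nat list. set xs \<subseteq> {..<k} \<and> length xs = h})"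
    using finite_lists_length_eq[of "{..<k}" h] by simp
  fix G assume G: "G \<in> C"
  then have sg: "simple_graph G" using assms(1) by (simp add: graph_class_def)
  let ?A = "pverts G"
  have fin: "finite ?A" and ne: "?A \<noteq> {}" using finite_pverts[OF sg] sg by (simp_all add: simple_graph_def)
  obtain cl lab where M: "level_model h k (edge G) ?A cl lab" using shrub_level_model[OF assms(2)[OF G]] by blast
  let ?N = "(\<lambda>(i, a). (i, cl i a)) ` ({..h} \<times> ?A)"
  obtain f where f: "inj_on f (?N \<union> (\<lambda>a. (0, {a})) ` ?A)" "\<forall>a\<in>?A. f (0, {a}) = a"
    using ex_node_names[of ?N ?A] fin by auto
  interpret level_tree h k "edge G" ?A cl lab f
  proof
    fix i j a b assume h: "i \<le> h" "j \<le> h" "a \<in> ?A" "b \<in> ?A" "f (i, cl i a) = f (j, cl j b)"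
    have "(i, cl i a) \<in> ?N" "(j, cl j b) \<in> ?N" using h by auto
    then have "(i, cl i a) = (j, cl j b)" using inj_onD[OF f(1) h(5)] by blast
    then show "i = j \<and> cl i a = cl j b" unfolding prod.inject .
  qed (use M fin ne sym_on_set_edge[OF sg] f(2) in auto)
  have "connection_model G (to_nat ` {xs :: nat list. set xs \<subseteq> {..<k} \<and> length xs = h}) label T root Adj"
    by (rule model) (simp_all add: edge_def)
  then show "\<exists>label T r Adj. connection_model G (to_nat ` {xs :: nat list. set xs \<subseteq> {..<k} \<and> length xs = h}) label T r Adj \<and>
      tree_depth T r \<le> Suc h"
    by (intro exI[of _ label] exI[of _ T] exI[of _ root] exI[of _ Adj] conjI) (simp_all add: depth_T)
qed

section \<open>The dicing\<close>

lemma pair_graph_induced: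
  assumes "pair_graph G" "A \<subseteq> pverts G"
  shows "pair_graph (induced G A)"
proof -
  interpret pair_graph G by fact
  have sy: "(v, u) \<in> parcs G" if "(u, v) \<in> parcs G" for u v
    using pair_sym_arcs that unfolding symmetric_def by (auto dest: symD)
  show ?thesis
  proof
    show "finite (pverts (induced G A))" "finite (parcs (induced G A))"
      using pair_finite_verts pair_finite_arcs finite_subset[OF assms(2)] by (simp_all add: induced_def)
    show "fst e \<noteq> snd e" if "e \<in> parcs (induced G A)" for e
      using that pair_no_loops by (simp add: induced_def)
    show "symmetric (with_proj (induced G A))"
      unfolding symmetric_def by (rule symI) (use sy in \<open>auto simp: induced_def\<close>)
  qed (auto simp: induced_def)
qed

lemma simple_graph_induced: "simple_graph G \<Longrightarrow> A \<subseteq> pverts G \<Longrightarrow> A \<noteq> {} \<Longrightarrow> simple_graph (induced G A)"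
  unfolding simple_graph_def using pair_graph_induced by (auto simp: induced_def)

lemma shrub_induced:
  assumes "shrub h k (edge G) A" "finite A"
  shows "shrub h k (edge (induced G A)) A"
proof -
  have "shrub h (k * 1) (edge (induced G A)) A"
  proof (rule shrub_relabel[where f = "\<lambda>_. ()", OF assms])
    show "card ((\<lambda>_. ()) ` A) \<le> 1" using card_mono[of UNIV "(\<lambda>_. ()) ` A"] by simp
  qed (auto simp: edge_def induced_def)
  then show ?thesis by simp
qed

text \<open>Taking all graphs within the bounds, instead of the parts that actually occur, makes the
  class hereditary at once.\<close>

definition shrub_class :: "nat \<Rightarrow> nat \<Rightarrow> 'a pair_pre_digraph set" where
  "shrub_class h k = {G. simple_graph G \<and> shrub h k (edge G) (pverts G)}"

lemma induced_shrub_class: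
  assumes "simple_graph G" "A \<subseteq> pverts G" "A \<noteq> {}" "shrub h k (edge G) A"
  shows "induced G A \<in> shrub_class h k"
  unfolding shrub_class_def mem_Collect_eq
  using simple_graph_induced[OF assms(1-3)] shrub_induced[OF assms(4)] finite_subset[OF assms(2) finite_pverts[OF assms(1)]]
  by (simp add: induced_def)

lemma hereditary_shrub_class: "hereditary (shrub_class h k)"
  unfolding hereditary_def
proof (intro ballI allI impI, elim conjE)
  fix G :: "'a pair_pre_digraph" and A
  assume "G \<in> shrub_class h k" "A \<subseteq> pverts G" "A \<noteq> {}"
  then show "induced G A \<in> shrub_class h k"
    by (intro induced_shrub_class shrub_subset[of h k "edge G" "pverts G" A]) (simp_all add: shrub_class_def)
qed

lemma part_of_quotient:
  assumes "equiv V r" "w \<in> V"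
  shows "part_of (V // r) w = r `` {w}"
  unfolding part_of_def
proof (rule the_equality)
  show "r `` {w} \<in> V // r \<and> w \<in> r `` {w}"
    using quotientI[OF assms(2), of r] equiv_class_self[OF assms] by blast
  fix B assume B: "B \<in> V // r \<and> w \<in> B"
  then obtain x where "B = r `` {x}" by (auto elim: quotientE)
  then show "B = r `` {w}" using B equiv_class_eq[OF assms(1), of x w] by simp
qed

lemma card_quotient_le:
  assumes eq: "equiv V r" and f: "\<And>u v. u \<in> V \<Longrightarrow> v \<in> V \<Longrightarrow> f u = f v \<Longrightarrow> (u, v) \<in> r" and fin: "finite V"
  shows "card (V // r) \<le> card (f ` V)"
proof -
  have "V // r \<subseteq> (\<lambda>y. r `` {SOME u. u \<in> V \<and> f u = y}) ` f ` V"
  proof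
    fix B assume "B \<in> V // r"
    then obtain u where u: "u \<in> V" "B = r `` {u}" by (auto elim: quotientE)
    let ?u = "SOME u'. u' \<in> V \<and> f u' = f u"
    have "?u \<in> V \<and> f ?u = f u" by (rule someI) (use u in simp)
    then have "r `` {?u} = B" using f u equiv_class_eq[OF eq] by metis
    then show "B \<in> (\<lambda>y. r `` {SOME u. u \<in> V \<and> f u = y}) ` f ` V" using u(1) by blast
  qed
  then have "card (V // r) \<le> card ((\<lambda>y. r `` {SOME u. u \<in> V \<and> f u = y}) ` f ` V)" using fin by (intro card_mono) auto
  also have "\<dots> \<le> card (f ` V)" using fin by (intro card_image_le) simp
  finally show ?thesis .
qed

lemma dicing_quotient:
  assumes eqP: "equiv V P" and eqL: "equiv V L" and V: "V = pverts G" and sym: "sym_on_set (edge G) V"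
    and d: "\<And>u v u' v'. u \<in> V \<Longrightarrow> v \<in> V \<Longrightarrow> u' \<in> V \<Longrightarrow> v' \<in> V \<Longrightarrow> (u, v) \<notin> P \<Longrightarrow> (u', v') \<notin> P \<Longrightarrow>
      (u, u') \<in> L \<Longrightarrow> (v, v') \<in> L \<Longrightarrow> edge G u v \<longleftrightarrow> edge G u' v'"
  shows "dicing G (V // P) (V // L)"
  unfolding dicing_def
proof (intro conjI)
  show "partition_on (pverts G) (V // P)" "partition_on (pverts G) (V // L)"
    using partition_on_quotient eqP eqL V by blast+
  \<comment> \<open>The label pairs realised by an edge between different parts; the assumption on
    adjacency says that one realisation speaks for all.\<close>
  let ?Z = "{(L `` {u}, L `` {v}) | u v. u \<in> V \<and> v \<in> V \<and> (u, v) \<notin> P \<and> edge G u v}"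
  show "\<exists>Z\<subseteq>V // L \<times> V // L. sym Z \<and> (\<forall>u\<in>pverts G. \<forall>v\<in>pverts G. part_of (V // P) u \<noteq> part_of (V // P) v \<longrightarrow>
    ((u, v) \<in> parcs G) = ((part_of (V // L) u, part_of (V // L) v) \<in> Z))"
  proof (intro exI[of _ ?Z] conjI ballI impI)
    show "?Z \<subseteq> V // L \<times> V // L" by (auto intro: quotientI)
    have "sym P" using eqP by (simp add: equiv_def)
    show "sym ?Z"
    proof (rule symI)
      fix a b assume "(a, b) \<in> ?Z"
      then obtain u v where uv: "a = L `` {u}" "b = L `` {v}" "u \<in> V" "v \<in> V" "(u, v) \<notin> P" "edge G u v" by blast
      have "(v, u) \<notin> P" using uv(5) \<open>sym P\<close> by (auto dest: symD)
      moreover have "edge G v u" using uv sym_on_setD[OF sym] by blast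
      ultimately show "(b, a) \<in> ?Z" using uv by blast
    qed
    fix u v assume uv: "u \<in> pverts G" "v \<in> pverts G" "part_of (V // P) u \<noteq> part_of (V // P) v"
    then have u: "u \<in> V" "v \<in> V" using V by simp_all
    have nP: "(u, v) \<notin> P"
      using uv(3) part_of_quotient[OF eqP] u equiv_class_eq[OF eqP] by metis
    show "((u, v) \<in> parcs G) = ((part_of (V // L) u, part_of (V // L) v) \<in> ?Z)"
      unfolding part_of_quotient[OF eqL u(1)] part_of_quotient[OF eqL u(2)]
    proof
      assume "(u, v) \<in> parcs G"
      then show "(L `` {u}, L `` {v}) \<in> ?Z" using u nP unfolding edge_def by blast
    next
      assume "(L `` {u}, L `` {v}) \<in> ?Z"
      then obtain u' v' where h: "L `` {u} = L `` {u'}" "L `` {v} = L `` {v'}" "u' \<in> V" "v' \<in> V" "(u', v') \<notin> P" "edge G u' v'"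
        by blast
      have "(u, u') \<in> L" "(v, v') \<in> L" using eq_equiv_class[OF h(1) eqL h(3)] eq_equiv_class[OF h(2) eqL h(4)] by simp_all
      then have "edge G u v \<longleftrightarrow> edge G u' v'" using d u h nP by blast
      then show "(u, v) \<in> parcs G" using h(6) unfolding edge_def by blast
    qed
  qed
qed

section \<open>Formulas without parameters\<close>

lemma tuples_0: "tuples G 0 = {[]}"
  by (auto simp: tuples_def)

lemma finitary_0: "finitary_on C 0 p"
proof -
  have "{defined_rel G p bs | bs. bs \<in> tuples G 0} = {defined_rel G p []}" for G :: "'a pair_pre_digraph"
    by (auto simp: tuples_0)
  then show ?thesis unfolding finitary_on_def by (intro exI[of _ 1]) simp
qed

text \<open>Collects what both cases have to supply. With m = 0 there is only the empty tuple, so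
  being finitary is immediate. Equivalence is demanded on every simple graph, the dicing only on
  C.\<close>

lemma dicing_formulas:
  fixes C :: "'a::infinite pair_pre_digraph set" and P L :: "'a pair_pre_digraph \<Rightarrow> 'a \<Rightarrow> 'a \<Rightarrow> bool"
  assumes C: "graph_class C"
    and foP: "fo 2 (\<lambda>G e. P G (e 0) (e 1))" and foL: "fo 2 (\<lambda>G e. L G (e 0) (e 1))"
    and eqP: "\<And>G. simple_graph G \<Longrightarrow> equiv (pverts G) {(a, b). a \<in> pverts G \<and> b \<in> pverts G \<and> P G a b}"
    and eqL: "\<And>G. simple_graph G \<Longrightarrow> equiv (pverts G) {(a, b). a \<in> pverts G \<and> b \<in> pverts G \<and> L G a b}"
    and d: "\<And>G u v u' v'. G \<in> C \<Longrightarrow> u \<in> pverts G \<Longrightarrow> v \<in> pverts G \<Longrightarrow> u' \<in> pverts G \<Longrightarrow> v' \<in> pverts G \<Longrightarrow>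
      \<not> P G u v \<Longrightarrow> \<not> P G u' v' \<Longrightarrow> L G u u' \<Longrightarrow> L G v v' \<Longrightarrow> edge G u v \<longleftrightarrow> edge G u' v'"
    and l: "\<And>G. G \<in> C \<Longrightarrow> \<exists>f :: 'a \<Rightarrow> 'c. card (f ` pverts G) \<le> l \<and>
      (\<forall>u\<in>pverts G. \<forall>v\<in>pverts G. f u = f v \<longrightarrow> L G u v)"
    and sh: "\<And>G a. G \<in> C \<Longrightarrow> a \<in> pverts G \<Longrightarrow> shrub h k (edge G) {b \<in> pverts G. P G a b}"
  shows "\<exists>(C' :: 'a pair_pre_digraph set) (m :: nat) (phi :: fm) (lam :: fm) (l :: nat).
    graph_class C' \<and> hereditary C' \<and> shrubdepth_at_most C' (Suc h) \<and>
    binary_formula m phi \<and> finitary_on C m phi \<and> defines_partition TYPE('a) m phi \<and>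
    binary_formula m lam \<and> finitary_on C m lam \<and> defines_partition TYPE('a) m lam \<and>
    (\<forall>G\<in>C. \<exists>s\<in>tuples G m.
       dicing G (defined_partition G phi s) (defined_partition G lam s) \<and>
       card (defined_partition G lam s) \<le> l \<and>
       (\<forall>A\<in>defined_partition G phi s. induced G A \<in> C'))"
proof -
  let ?r = "\<lambda>R G. {(a, b). a \<in> pverts G \<and> b \<in> pverts G \<and> R G a b}"
  obtain p where p: "fv p \<subseteq> {..<2}" "\<And>G e. sat G e p \<longleftrightarrow> P G (e 0) (e 1)" using foP unfolding fo_def by blast
  obtain q where q: "fv q \<subseteq> {..<2}" "\<And>G e. sat G e q \<longleftrightarrow> L G (e 0) (e 1)" using foL unfolding fo_def by blast
  have rp: "defined_rel G p [] = ?r P G" and rq: "defined_rel G q [] = ?r L G" for G :: "'a pair_pre_digraph"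
    unfolding defined_rel_def p(2) q(2) by simp_all
  have sg: "simple_graph G" if "G \<in> C" for G using C that by (simp add: graph_class_def)
  have C': "graph_class (shrub_class h k :: 'a pair_pre_digraph set)" by (simp add: graph_class_def shrub_class_def)
  show ?thesis
  proof (rule exI[of _ "shrub_class h k"], rule exI[of _ 0], rule exI[of _ p], rule exI[of _ q], rule exI[of _ l],
      intro conjI ballI)
    show "graph_class (shrub_class h k :: 'a pair_pre_digraph set)" by (rule C')
    show "hereditary (shrub_class h k :: 'a pair_pre_digraph set)" by (rule hereditary_shrub_class)
    show "shrubdepth_at_most (shrub_class h k :: 'a pair_pre_digraph set) (Suc h)"
      by (rule shrub_shrubdepth[OF C', where k = k]) (simp add: shrub_class_def)
    show "binary_formula 0 p" "binary_formula 0 q" using p(1) q(1) by (simp_all add: binary_formula_def)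
    show "finitary_on C 0 p" "finitary_on C 0 q" by (rule finitary_0)+
    show "defines_partition TYPE('a) 0 p" "defines_partition TYPE('a) 0 q"
      unfolding defines_partition_def tuples_0 using eqP eqL by (simp_all add: rp rq)
    fix G assume G: "G \<in> C"
    let ?V = "pverts G"
    note eP = eqP[OF sg[OF G]] and eL = eqL[OF sg[OF G]]
    show "\<exists>s\<in>tuples G 0. dicing G (defined_partition G p s) (defined_partition G q s) \<and>
       card (defined_partition G q s) \<le> l \<and> (\<forall>A\<in>defined_partition G p s. induced G A \<in> shrub_class h k)"
      unfolding tuples_0 defined_partition_def
    proof (intro bexI[of _ "[]"] conjI ballI)
      show "dicing G (?V // defined_rel G p []) (?V // defined_rel G q [])"
        unfolding rp rq
      proof (rule dicing_quotient[OF eP eL refl sym_on_set_edge[OF sg[OF G]]])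
        fix u v u' v' assume "u \<in> ?V" "v \<in> ?V" "u' \<in> ?V" "v' \<in> ?V" "(u, v) \<notin> ?r P G" "(u', v') \<notin> ?r P G"
          "(u, u') \<in> ?r L G" "(v, v') \<in> ?r L G"
        then show "edge G u v \<longleftrightarrow> edge G u' v'" by (intro d[OF G]) simp_all
      qed
      obtain f :: "'a \<Rightarrow> 'c" where f: "card (f ` ?V) \<le> l" "\<forall>u\<in>?V. \<forall>v\<in>?V. f u = f v \<longrightarrow> L G u v"
        using l[OF G] by blast
      have "card (?V // ?r L G) \<le> card (f ` ?V)"
        by (rule card_quotient_le[OF eL _ finite_pverts[OF sg[OF G]]]) (use f(2) in simp)
      then show "card (?V // defined_rel G q []) \<le> l" unfolding rq using f(1) by linarith
      fix A assume "A \<in> ?V // defined_rel G p []"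
      then obtain a where a: "a \<in> ?V" "A = ?r P G `` {a}" unfolding rp by (auto elim: quotientE)
      then have A: "A = {b \<in> ?V. P G a b}" by auto
      have "a \<in> A" using equiv_class_self[OF eP a(1)] a(2) by simp
      then show "induced G A \<in> shrub_class h k"
        using sh[OF G a(1)] A by (intro induced_shrub_class[OF sg[OF G]]) auto
    qed simp
  qed
qed

lemma equiv_restrictI:
  assumes "\<And>a. a \<in> V \<Longrightarrow> R a a" "\<And>a b. a \<in> V \<Longrightarrow> b \<in> V \<Longrightarrow> R a b \<Longrightarrow> R b a"
    "\<And>a b c. a \<in> V \<Longrightarrow> b \<in> V \<Longrightarrow> c \<in> V \<Longrightarrow> R a b \<Longrightarrow> R b c \<Longrightarrow> R a c"
  shows "equiv V {(a, b). a \<in> V \<and> b \<in> V \<and> R a b}"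
proof (rule equivI)
  show "refl_on V {(a, b). a \<in> V \<and> b \<in> V \<and> R a b}" using assms(1) by (auto simp: refl_on_def)
  show "sym {(a, b). a \<in> V \<and> b \<in> V \<and> R a b}" using assms(2) by (auto simp: sym_def)
  show "trans {(a, b). a \<in> V \<and> b \<in> V \<and> R a b}" using assms(3) by (intro transI) blast
qed auto

lemma config_equiv:
  assumes "config n t m E A s" "sym_on_set E A"
  shows "a \<in> A \<Longrightarrow> reach (link E A m s) A t a a"
    "a \<in> A \<Longrightarrow> b \<in> A \<Longrightarrow> reach (link E A m s) A t a b \<Longrightarrow> reach (link E A m s) A t b a"
    "a \<in> A \<Longrightarrow> b \<in> A \<Longrightarrow> c \<in> A \<Longrightarrow> reach (link E A m s) A t a b \<Longrightarrow> reach (link E A m s) A t b c \<Longrightarrow>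
       reach (link E A m s) A t a c"
proof -
  have st: "stable (link E A m s) A t" using assms(1) by (simp add: config_def)
  show "a \<in> A \<Longrightarrow> reach (link E A m s) A t a a" by (rule reach_refl)
  show "a \<in> A \<Longrightarrow> b \<in> A \<Longrightarrow> reach (link E A m s) A t a b \<Longrightarrow> reach (link E A m s) A t b a"
    by (rule reach_sym[OF st sym_link[OF assms(2)]])
  show "a \<in> A \<Longrightarrow> b \<in> A \<Longrightarrow> c \<in> A \<Longrightarrow> reach (link E A m s) A t a b \<Longrightarrow> reach (link E A m s) A t b c \<Longrightarrow>
       reach (link E A m s) A t a c" by (rule reach_trans[OF st])
qed

lemma dicing_depth_2:
  fixes C :: "'a::infinite pair_pre_digraph set"
  assumes C: "graph_class C" and K: "\<And>G. G \<in> C \<Longrightarrow> shrub (Suc 0) K (edge G) (pverts G)"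
  shows "\<exists>(C' :: 'a pair_pre_digraph set) (m :: nat) (phi :: fm) (lam :: fm) (l :: nat).
    graph_class C' \<and> hereditary C' \<and> shrubdepth_at_most C' (Suc 0) \<and>
    binary_formula m phi \<and> finitary_on C m phi \<and> defines_partition TYPE('a) m phi \<and>
    binary_formula m lam \<and> finitary_on C m lam \<and> defines_partition TYPE('a) m lam \<and>
    (\<forall>G\<in>C. \<exists>s\<in>tuples G m.
       dicing G (defined_partition G phi s) (defined_partition G lam s) \<and>
       card (defined_partition G lam s) \<le> l \<and>
       (\<forall>A\<in>defined_partition G phi s. induced G A \<in> C'))"
proof (rule dicing_formulas[OF C, where P = "\<lambda>G a b. a = b" and L = "\<lambda>G. twin (edge G) (pverts G)" and l = K and k = 0])
  show "fo 2 (\<lambda>G e. e 0 = e 1)" by (rule fo_eq) simp_all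
  show "fo 2 (\<lambda>G e. twin (edge G) (pverts G) (e 0) (e 1))" by (rule fo_twin[OF dset_verts]) simp_all
  show "equiv (pverts G) {(a, b). a \<in> pverts G \<and> b \<in> pverts G \<and> a = b}" for G :: "'a pair_pre_digraph"
    by (rule equiv_restrictI) auto
  show "equiv (pverts G) {(a, b). a \<in> pverts G \<and> b \<in> pverts G \<and> twin (edge G) (pverts G) a b}"
    if "simple_graph G" for G :: "'a pair_pre_digraph"
    using twin_refl twin_sym twin_trans[OF sym_on_set_edge[OF that]] by (intro equiv_restrictI)
  fix G assume G: "G \<in> C"
  then have sg: "simple_graph G" using C by (simp add: graph_class_def)
  show "edge G u v \<longleftrightarrow> edge G u' v'" if "u \<in> pverts G" "v \<in> pverts G" "u' \<in> pverts G" "v' \<in> pverts G" "u \<noteq> v" "u' \<noteq> v'"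
    "twin (edge G) (pverts G) u u'" "twin (edge G) (pverts G) v v'" for u v u' v'
    using twin_determined[OF sym_on_set_edge[OF sg]] that by blast
  have "layered 0 K (edge G) (pverts G)" using shrub_0_layered[OF _ K[OF G]] sg by (simp add: simple_graph_def)
  then obtain s where s: "\<forall>i<K. s i \<in> pverts G" "\<forall>u\<in>pverts G. \<exists>i<K. twin (edge G) (pverts G) u (s i)" by auto
  then obtain f where f: "\<And>u. u \<in> pverts G \<Longrightarrow> f u < K \<and> twin (edge G) (pverts G) u (s (f u))" by metis
  have "f ` pverts G \<subseteq> {..<K}" using f by auto
  then have "card (f ` pverts G) \<le> K" using card_mono[of "{..<K}"] by fastforce
  moreover have "twin (edge G) (pverts G) u v" if "u \<in> pverts G" "v \<in> pverts G" "f u = f v" for u v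
  proof (rule twin_trans[OF sym_on_set_edge[OF sg] that(1) _ that(2)])
    show "twin (edge G) (pverts G) u (s (f u))" using f that(1) by blast
    show "twin (edge G) (pverts G) (s (f u)) v" using f[OF that(2)] that(3) by (auto intro: twin_sym)
    show "s (f u) \<in> pverts G" using f[OF that(1)] s(1) by blast
  qed
  ultimately show "\<exists>f :: 'a \<Rightarrow> nat. card (f ` pverts G) \<le> K \<and>
      (\<forall>u\<in>pverts G. \<forall>v\<in>pverts G. f u = f v \<longrightarrow> twin (edge G) (pverts G) u v)" by blast
  show "shrub 0 0 (edge G) {b \<in> pverts G. a = b}" for a by simp
qed

lemma dicing_depth_ge_3:
  fixes C :: "'a::infinite pair_pre_digraph set"
  assumes C: "graph_class C" and K: "\<And>G. G \<in> C \<Longrightarrow> shrub (Suc (Suc n)) K (edge G) (pverts G)"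
  shows "\<exists>(C' :: 'a pair_pre_digraph set) (m :: nat) (phi :: fm) (lam :: fm) (l :: nat).
    graph_class C' \<and> hereditary C' \<and> shrubdepth_at_most C' (Suc (Suc n)) \<and>
    binary_formula m phi \<and> finitary_on C m phi \<and> defines_partition TYPE('a) m phi \<and>
    binary_formula m lam \<and> finitary_on C m lam \<and> defines_partition TYPE('a) m lam \<and>
    (\<forall>G\<in>C. \<exists>s\<in>tuples G m.
       dicing G (defined_partition G phi s) (defined_partition G lam s) \<and>
       card (defined_partition G lam s) \<le> l \<and>
       (\<forall>A\<in>defined_partition G phi s. induced G A \<in> C'))"
proof -
  obtain k and T :: "nat \<Rightarrow> nat" where kT: "\<forall>(E :: 'a \<Rightarrow> 'a \<Rightarrow> bool) A. finite A \<longrightarrow> sym_on_set E A \<longrightarrow> A \<noteq> {} \<longrightarrow>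
     shrub (Suc (Suc n)) K E A \<longrightarrow>
     (\<exists>i\<le>k. \<exists>m\<le>k. tight n (T i) (T (Suc i)) m E A) \<and>
     (\<forall>i m. m \<le> k \<longrightarrow> tight n (T i) (T (Suc i)) m E A \<longrightarrow>
        (\<forall>s s'. config n (T i) m E A s \<longrightarrow> config n (T i) m E A s' \<longrightarrow> matched E A m s s'))"
    using canonical_config[of n K] by (elim exE)
  \<comment> \<open>The number q codes a pair of a level and a number of triples, both at most
    k.\<close>
  define i where "i q = q div (k + 1)" for q
  define m where "m q = q mod (k + 1)" for q
  define ok where "ok G q \<longleftrightarrow> tight n (T (i q)) (T (Suc (i q))) (m q) (edge G) (pverts G)" for G :: "'a pair_pre_digraph" and q
  \<comment> \<open>At most one q is first on a given graph, so different tight levels cannot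
    interfere.\<close>
  define first where "first G q \<longleftrightarrow> ok G q \<and> (\<forall>q'<q. \<not> ok G q')" for G q
  define conf where "conf G q s \<longleftrightarrow> config n (T (i q)) (m q) (edge G) (pverts G) s" for G :: "'a pair_pre_digraph" and q s
  define rch where "rch G q s = reach (link (edge G) (pverts G) (m q) s) (pverts G) (T (i q))" for G :: "'a pair_pre_digraph" and q s
  define sm where "sm G q s = sim (edge G) (pverts G) (m q) s" for G :: "'a pair_pre_digraph" and q s
  define Q where "Q = (k + 1) * (k + 1)"
  \<comment> \<open>A finite conjunction over q and a universal quantifier over
    \<open>3 * m q\<close> vertices, both first-order.\<close>
  define P where "P G a b \<longleftrightarrow> (\<forall>q<Q. first G q \<longrightarrow> (\<forall>s. conf G q s \<longrightarrow> rch G q s a b))" for G a b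
  define L where "L G a b \<longleftrightarrow> (\<forall>q<Q. first G q \<longrightarrow> (\<forall>s. conf G q s \<longrightarrow> sm G q s a b))" for G a b
  have mk: "m q \<le> k" for q unfolding m_def by (simp add: less_Suc_eq_le[symmetric])
  have ik: "i q \<le> k" if "q < Q" for q
  proof -
    have "q div (k + 1) < k + 1" using that unfolding Q_def by (intro less_mult_imp_div_less)
    then show ?thesis unfolding i_def by simp
  qed
  have fo_first: "fo c (\<lambda>G e. first G q)" for c q
    unfolding first_def ok_def by (intro fo_and fo_all_less fo_not fo_tight)
  have groups: "definable_groups (2 + 3 * m q) (\<lambda>(G :: 'a pair_pre_digraph) e. pverts G) 2 (m q)" for q
    by unfold_locales (rule dset_verts, simp)
  \<comment> \<open>On C a tight pair exists and all its configurations are matched. The universal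
    quantifier can thus be replaced by any single configuration.\<close>
  have core: "\<exists>q<Q. \<exists>s. first G q \<and> conf G q s \<and> (\<forall>u\<in>pverts G. \<forall>v\<in>pverts G. (P G u v \<longleftrightarrow> rch G q s u v) \<and>
      (L G u v \<longleftrightarrow> sm G q s u v))" if G: "G \<in> C" for G
  proof -
    have sg: "simple_graph G" using C G by (simp add: graph_class_def)
    let ?E = "edge G" and ?V = "pverts G"
    have "?V \<noteq> {}" using sg by (simp add: simple_graph_def)
    note canon = kT[rule_format, OF finite_pverts[OF sg] sym_on_set_edge[OF sg] this K[OF G]]
    obtain i0 m0 where im: "i0 \<le> k" "m0 \<le> k" "tight n (T i0) (T (Suc i0)) m0 ?E ?V" using canon by blast
    let ?q = "i0 * (k + 1) + m0"
    have "m0 < k + 1" using im(2) by simp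
    then have "(m0 + i0 * (k + 1)) div (k + 1) = i0" "(m0 + i0 * (k + 1)) mod (k + 1) = m0"
      using div_mult_self1[of "k + 1" m0 i0] mod_mult_self1[of m0 i0 "k + 1"] by (simp_all del: mult_Suc_right)
    then have "i ?q = i0" "m ?q = m0" unfolding i_def m_def by (simp_all only: add.commute)
    then have okq: "ok G ?q" unfolding ok_def using im(3) by simp
    have "?q < Q"
    proof -
      have "?q < Suc i0 * (k + 1)" using im(2) by simp
      also have "\<dots> \<le> Q" unfolding Q_def using im(1) by (intro mult_le_mono) auto
      finally show ?thesis .
    qed
    define q where "q = (LEAST q. ok G q)"
    have okq0: "ok G q" unfolding q_def using okq by (rule LeastI)
    have "q \<le> ?q" unfolding q_def using okq by (rule Least_le)
    then have qQ: "q < Q" using \<open>?q < Q\<close> by simp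
    have fq: "first G q" unfolding first_def using okq0 not_less_Least unfolding q_def by blast
    have uniq: "q' = q" if "first G q'" for q'
      using that fq unfolding first_def by (metis linorder_neqE_nat)
    obtain s where s: "conf G q s" using okq0 unfolding ok_def tight_def conf_def by blast
    have mt: "matched ?E ?V (m q) s s'" if "conf G q s'" for s'
      using canon mk[of q] okq0 s that unfolding ok_def conf_def by blast
    have "P G u v \<longleftrightarrow> rch G q s u v" "L G u v \<longleftrightarrow> sm G q s u v" if "u \<in> ?V" "v \<in> ?V" for u v
    proof -
      have "rch G q s u v \<longleftrightarrow> rch G q s' u v" if "conf G q s'" for s'
        unfolding rch_def by (rule matched.reach_eq[OF mt[OF that] \<open>v \<in> ?V\<close>])
      then show "P G u v \<longleftrightarrow> rch G q s u v" unfolding P_def using qQ fq uniq s by metis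
      have "sm G q s u v \<longleftrightarrow> sm G q s' u v" if "conf G q s'" for s'
        unfolding sm_def by (rule matched.sim_eq[OF mt[OF that] \<open>u \<in> ?V\<close> \<open>v \<in> ?V\<close>])
      then show "L G u v \<longleftrightarrow> sm G q s u v" unfolding L_def using qQ fq uniq s by metis
    qed
    then show ?thesis using qQ fq s by blast
  qed
  show ?thesis
  \<comment> \<open>Different graphs may select different levels up to k; the sum covers them all
    and makes the class of parts independent of the graph.\<close>
  proof (rule dicing_formulas[OF C, where P = P and L = L and l = "simcount k" and k = "\<Sum>j\<le>k. shrub_count n (T j)"])
    show "fo 2 (\<lambda>G e. P G (e 0) (e 1))"
      unfolding P_def conf_def
    proof (intro fo_all_less fo_imp fo_first fo_all_config)
      fix q
      show "drel (2 + 3 * m q) (\<lambda>G e. rch G q (block 2 (3 * m q) e))"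
        unfolding rch_def by (rule definable_groups.drel_reach[OF groups])
    qed (simp_all add: rch_def link_trunc)
    show "fo 2 (\<lambda>G e. L G (e 0) (e 1))"
      unfolding L_def conf_def
    proof (intro fo_all_less fo_imp fo_first fo_all_config)
      fix q
      show "drel (2 + 3 * m q) (\<lambda>G e. sm G q (block 2 (3 * m q) e))"
        unfolding sm_def by (rule definable_groups.drel_sim[OF groups])
    qed (simp_all add: sm_def sim_trunc)
    show "equiv (pverts G) {(a, b). a \<in> pverts G \<and> b \<in> pverts G \<and> P G a b}" if "simple_graph G" for G :: "'a pair_pre_digraph"
    proof (rule equiv_restrictI)
      note ce = config_equiv[OF _ sym_on_set_edge[OF that]]
      show "P G a a" if "a \<in> pverts G" for a
        unfolding P_def conf_def rch_def using ce(1) that by blast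
      show "P G b a" if "a \<in> pverts G" "b \<in> pverts G" "P G a b" for a b
        using that(3) unfolding P_def conf_def rch_def using ce(2) that(1,2) by blast
      show "P G a c" if "a \<in> pverts G" "b \<in> pverts G" "c \<in> pverts G" "P G a b" "P G b c" for a b c
        using that(4,5) unfolding P_def conf_def rch_def using ce(3) that(1-3) by blast
    qed
    show "equiv (pverts G) {(a, b). a \<in> pverts G \<and> b \<in> pverts G \<and> L G a b}" for G :: "'a pair_pre_digraph"
      by (rule equiv_restrictI) (simp_all add: L_def sm_def sim_iff)
    fix G assume G: "G \<in> C"
    then have sg: "simple_graph G" using C by (simp add: graph_class_def)
    obtain q s where q: "q < Q" "conf G q s" and PL: "\<And>u v. u \<in> pverts G \<Longrightarrow> v \<in> pverts G \<Longrightarrow> P G u v \<longleftrightarrow> rch G q s u v"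
      "\<And>u v. u \<in> pverts G \<Longrightarrow> v \<in> pverts G \<Longrightarrow> L G u v \<longleftrightarrow> sm G q s u v" using core[OF G] by blast
    have st: "stable (link (edge G) (pverts G) (m q) s) (pverts G) (T (i q))" using q(2) by (simp add: conf_def config_def)
    note se = sym_on_set_edge[OF sg]
    show "edge G u v \<longleftrightarrow> edge G u' v'" if h: "u \<in> pverts G" "v \<in> pverts G" "u' \<in> pverts G" "v' \<in> pverts G"
      "\<not> P G u v" "\<not> P G u' v'" "L G u u'" "L G v v'" for u v u' v'
    proof (rule dicesD[OF dices_cell[OF st se] h(1-4)])
      note ce = cell_eq_iff[OF st sym_link[OF se]]
      show "cell (link (edge G) (pverts G) (m q) s) (pverts G) (T (i q)) u \<noteq> cell (link (edge G) (pverts G) (m q) s) (pverts G) (T (i q)) v"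
        using h(5) unfolding PL(1)[OF h(1,2)] rch_def ce[OF h(1,2)] .
      show "cell (link (edge G) (pverts G) (m q) s) (pverts G) (T (i q)) u' \<noteq> cell (link (edge G) (pverts G) (m q) s) (pverts G) (T (i q)) v'"
        using h(6) unfolding PL(1)[OF h(3,4)] rch_def ce[OF h(3,4)] .
      show "simlab (edge G) (pverts G) (m q) s u = simlab (edge G) (pverts G) (m q) s u'"
        using h(7) unfolding PL(2)[OF h(1,3)] sm_def sim_iff .
      show "simlab (edge G) (pverts G) (m q) s v = simlab (edge G) (pverts G) (m q) s v'"
        using h(8) unfolding PL(2)[OF h(2,4)] sm_def sim_iff .
    qed
    show "\<exists>f :: 'a \<Rightarrow> nat set \<times> nat set set. card (f ` pverts G) \<le> simcount k \<and>
        (\<forall>u\<in>pverts G. \<forall>v\<in>pverts G. f u = f v \<longrightarrow> L G u v)"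
    proof (intro exI conjI ballI impI)
      show "card (simlab (edge G) (pverts G) (m q) s ` pverts G) \<le> simcount k"
        using card_simlab simcount_mono[OF mk] order_trans by blast
      show "L G u v" if "u \<in> pverts G" "v \<in> pverts G" "simlab (edge G) (pverts G) (m q) s u = simlab (edge G) (pverts G) (m q) s v" for u v
        unfolding PL(2)[OF that(1,2)] sm_def sim_iff using that(3) .
    qed
    fix a assume a: "a \<in> pverts G"
    let ?c = "cell (link (edge G) (pverts G) (m q) s) (pverts G) (T (i q)) a"
    have "{b \<in> pverts G. P G a b} = ?c" unfolding cell_def using PL(1)[OF a] by (auto simp: rch_def)
    moreover have "shrub (Suc n) (shrub_count n (T (i q))) (edge G) ?c"
    proof (rule layered_shrub)
      show "finite ?c" by (rule finite_subset[OF cell_subset finite_pverts[OF sg]])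
      show "sym_on_set (edge G) ?c" by (rule sym_on_set_edge[OF sg])
      show "layered n (T (i q)) (edge G) ?c" using q(2) a unfolding conf_def config_def by blast
    qed
    moreover have "shrub_count n (T (i q)) \<le> (\<Sum>j\<le>k. shrub_count n (T j))"
      using ik[OF q(1)] member_le_sum[of "i q" "{..k}" "\<lambda>j. shrub_count n (T j)"] by simp
    ultimately show "shrub (Suc n) (\<Sum>j\<le>k. shrub_count n (T j)) (edge G) {b \<in> pverts G. P G a b}"
      using shrub_mono by metis
  qed
qed

theorem theorem13:
  fixes C :: "'a::infinite pair_pre_digraph set" and d :: nat
  assumes "graph_class C" and "d > 1" and "shrubdepth_at_most C d"
  shows "\<exists>(C' :: 'a pair_pre_digraph set) (m :: nat) (phi :: fm) (lam :: fm) (l :: nat).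
    graph_class C' \<and> hereditary C' \<and> shrubdepth_at_most C' (d - 1) \<and>
    binary_formula m phi \<and> finitary_on C m phi \<and> defines_partition TYPE('a) m phi \<and>
    binary_formula m lam \<and> finitary_on C m lam \<and> defines_partition TYPE('a) m lam \<and>
    (\<forall>G\<in>C. \<exists>s\<in>tuples G m.
       dicing G (defined_partition G phi s) (defined_partition G lam s) \<and>
       card (defined_partition G lam s) \<le> l \<and>
       (\<forall>A\<in>defined_partition G phi s. induced G A \<in> C'))"
proof -
  obtain Labels :: "nat set" where L: "\<And>G. G \<in> C \<Longrightarrow>
      \<exists>label T r Adj. connection_model G Labels label T r Adj \<and> tree_depth T r \<le> d"
    using assms(3) unfolding shrubdepth_at_most_def by blast
  \<comment> \<open>Depth counts nodes, so a tree of depth d performs d - 1 cuts.\<close>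
  have K: "shrub (d - 1) (card Labels) (edge G) (pverts G)" if "G \<in> C" for G
  proof -
    obtain label T r Adj where "connection_model G Labels label T r Adj" "tree_depth T r \<le> d" using L[OF \<open>G \<in> C\<close>] by blast
    then show ?thesis using assms(2) by (intro connection_model_shrub) auto
  qed
  show ?thesis
  proof (cases "d = 2")
    case True
    then have "shrub (Suc 0) (card Labels) (edge G) (pverts G)" if "G \<in> C" for G using K[OF that] by simp
    from dicing_depth_2[OF assms(1) this] show ?thesis using True by (simp only: diff_Suc_1 numeral_2_eq_2)
  next
    case False
    then have n: "d - 1 = Suc (Suc (d - 3))" using assms(2) by simp
    show ?thesis using dicing_depth_ge_3[OF assms(1) K[unfolded n]] unfolding n .
  qed
qed

end
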